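(* There is a constant $C>0$ with the following property. Whenever $k\ge C\log n$, any randomized algorithm for dynamic (fully dynamic, i.e. insertions and deletions) monotone submodular maximization under cardinality constraint $k$ that achieves an approximation guarantee of $0.584$ must have amortized query complexity at least $\Omega(n/k^3)$, where $n$ is the length of the stream.
   Context: Dynamic submodular maximization under a cardinality constraint: there is a finite ground set $V$, a positive integer $k$, and query (value-oracle) access to a nonnegative monotone submodular function $f:2^V\to\mathbb{R}$. Starting from $V_0=\emptyset$, in each round $i=1,\dots,n$ an element $e_i$ is either inserted ($V_i=V_{i-1}\cup\{e_i\}$) or deleted ($V_i=V_{i-1}\setminus\{e_i\}$); after the update the algorithm may query $f$ and must output $S_i\subseteq V_i$ with $|S_i|\le k$. A $\gamma$-approximate solution in round $i$ means $f(S_i)\ge\gamma\cdot\mathrm{OPT}_i$ with $\mathrm{OPT}_i=\max_{T\subseteq V_i,|T|\le k}f(T)$. The algorithm remembers all previous query answers. A randomized algorithm achieves approximation guarantee $\gamma$ if for every $n$ and every stream of length $n$, with probability at least $2/3$ it outputs a $\gamma$-approximate solution in every round. It has amortized query complexity $Q(n)$ if the total number of queries on any stream of length $n$ is at most $n\cdot Q(n)$. (The lower bound holds even if the algorithm knows $V$ and $n$ in advance and may query any set of elements that have appeared so far.)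
   Formalization: The formal theorem also assumes k ≤ n/2: for k ≥ n, outputting S_i = V_i is optimal with no queries, so the bound fails as stated; for k > n/2 it would say at most that some query is made. Randomness is modelled by a probability space on the reals. *)

theory Defs
  imports "HOL-Probability.Probability"
begin

section \<open>Update streams\<close>

datatype 'a update = Insert (elem: 'a) | Delete (elem: 'a)

fun apply_update :: "'a set \<Rightarrow> 'a update \<Rightarrow> 'a set" where
  "apply_update S (Insert e) = S \<union> {e}"
| "apply_update S (Delete e) = S - {e}"

text \<open>\<open>live (take i us)\<close> is the current set \<open>V\<^sub>i\<close> after the first \<open>i\<close> updates.\<close>

definition live :: "'a update list \<Rightarrow> 'a set" where
  "live us = foldl apply_update {} us"

definition appeared :: "'a update list \<Rightarrow> 'a set" where
  "appeared us = (\<Union>j\<le>length us. live (take j us))"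

section \<open>Instances\<close>

definition submodular_on :: "'a set \<Rightarrow> ('a set \<Rightarrow> real) \<Rightarrow> bool" where
  "submodular_on V f \<longleftrightarrow>
     (\<forall>A B. A \<subseteq> V \<longrightarrow> B \<subseteq> V \<longrightarrow> f (A \<union> B) + f (A \<inter> B) \<le> f A + f B)"

definition problem_instance ::
  "nat \<Rightarrow> 'a set \<Rightarrow> ('a set \<Rightarrow> real) \<Rightarrow> 'a update list \<Rightarrow> bool" where
  "problem_instance n V f us \<longleftrightarrow>
     finite V \<and> (\<forall>A\<subseteq>V. 0 \<le> f A) \<and> mono_on (Pow V) f \<and> submodular_on V f \<and>
     length us = n \<and> elem ` set us \<subseteq> V"

definition OPT :: "nat \<Rightarrow> ('a set \<Rightarrow> real) \<Rightarrow> 'a set \<Rightarrow> real" where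
  "OPT k f W = Max (f ` {T. T \<subseteq> W \<and> card T \<le> k})"

section \<open>Algorithms\<close>

text \<open>
  The work done within one round is a well-founded adaptive decision tree: either output a
  set, or query a set and continue according to the value returned by the oracle.
  In each round a deterministic algorithm sees the updates up to and including the current
  one and the list of all queries made in earlier rounds together with their answers.
\<close>

datatype 'a computation =
    Output "'a set"
  | Query "'a set" "real \<Rightarrow> 'a computation"

type_synonym 'a strategy = "'a update list \<Rightarrow> ('a set \<times> real) list \<Rightarrow> 'a computation"

primrec comp_queries :: "('a set \<Rightarrow> real) \<Rightarrow> 'a computation \<Rightarrow> ('a set \<times> real) list" where
  "comp_queries f (Output S) = []"
| "comp_queries f (Query T g) = (T, f T) # comp_queries f (g (f T))"

primrec comp_output :: "('a set \<Rightarrow> real) \<Rightarrow> 'a computation \<Rightarrow> 'a set" where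
  "comp_output f (Output S) = S"
| "comp_output f (Query T g) = comp_output f (g (f T))"

text \<open>\<open>transcript A f us i\<close> lists all queries made in rounds \<open>1, \<dots>, i\<close>, with their answers.\<close>

primrec transcript ::
  "'a strategy \<Rightarrow> ('a set \<Rightarrow> real) \<Rightarrow> 'a update list \<Rightarrow> nat \<Rightarrow> ('a set \<times> real) list" where
  "transcript A f us 0 = []"
| "transcript A f us (Suc i) =
     transcript A f us i @ comp_queries f (A (take (Suc i) us) (transcript A f us i))"

text \<open>The rounds are numbered from \<open>1\<close>.\<close>

definition round_comp ::
  "'a strategy \<Rightarrow> ('a set \<Rightarrow> real) \<Rightarrow> 'a update list \<Rightarrow> nat \<Rightarrow> 'a computation" where
  "round_comp A f us i = A (take i us) (transcript A f us (i - 1))"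

definition solution ::
  "'a strategy \<Rightarrow> ('a set \<Rightarrow> real) \<Rightarrow> 'a update list \<Rightarrow> nat \<Rightarrow> 'a set" where
  "solution A f us i = comp_output f (round_comp A f us i)"

text \<open>
  A randomized algorithm for streams of length \<open>n\<close> and cardinality constraint \<open>k\<close> draws a
  random seed from a probability space \<open>M\<close> and then runs the deterministic strategy
  \<open>alg \<omega> V\<close>. It knows \<open>V\<close>; it also knows \<open>n\<close> and \<open>k\<close>, since \<open>alg\<close> may be
  chosen depending on them. Queries may involve deleted elements, but not elements that have not appeared
  yet.
\<close>

definition randomized_algorithm ::
  "nat \<Rightarrow> nat \<Rightarrow> 'w measure \<Rightarrow> ('w \<Rightarrow> 'a set \<Rightarrow> 'a strategy) \<Rightarrow> bool" where
  "randomized_algorithm n k M alg \<longleftrightarrow>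
     prob_space M \<and>
     (\<forall>V f us. problem_instance n V f us \<longrightarrow>
       (\<forall>\<omega>\<in>space M. \<forall>i\<in>{1..n}.
          (\<forall>(T, y)\<in>set (comp_queries f (round_comp (alg \<omega> V) f us i)).
             T \<subseteq> appeared (take i us)) \<and>
          solution (alg \<omega> V) f us i \<subseteq> live (take i us) \<and>
          card (solution (alg \<omega> V) f us i) \<le> k))"

text \<open>
  The function and the stream are fixed before the seed is drawn. Non-measurable sets have
  \<open>measure\<close> zero, so the bound below includes the measurability of the success event.
\<close>

definition achieves_guarantee ::
  "nat \<Rightarrow> nat \<Rightarrow> 'w measure \<Rightarrow> ('w \<Rightarrow> 'a set \<Rightarrow> 'a strategy) \<Rightarrow> real \<Rightarrow> bool" where
  "achieves_guarantee n k M alg \<gamma> \<longleftrightarrow>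
     (\<forall>V f us. problem_instance n V f us \<longrightarrow>
       measure M {\<omega> \<in> space M. \<forall>i\<in>{1..n}.
         f (solution (alg \<omega> V) f us i) \<ge> \<gamma> * OPT k f (live (take i us))} \<ge> 2 / 3)"

definition amortized_query_complexity ::
  "nat \<Rightarrow> 'w measure \<Rightarrow> ('w \<Rightarrow> 'a set \<Rightarrow> 'a strategy) \<Rightarrow> real \<Rightarrow> bool" where
  "amortized_query_complexity n M alg q \<longleftrightarrow>
     (\<forall>V f us. problem_instance n V f us \<longrightarrow>
       (\<forall>\<omega>\<in>space M. real (length (transcript (alg \<omega> V) f us n)) \<le> real n * q))"

end

theory Submission
  imports Defs
begin

text \<open>
  A long-lived ground set of about \<open>n / 2\<close> elements is inserted first. Then follow about \<open>n / k\<close>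
  batches of \<open>O(k)\<close> elements, each of which is inserted and deleted again. For each batch there is a
  random hidden optimum: \<open>0.55 k\<close> elements of the ground set together with \<open>0.45 k\<close> elements of the
  batch. The part in the batch is concealed because a set of \<open>O(k)\<close> batch elements contains
  a substantial part of it only with probability \<open>exp (- \<Omega>(k))\<close>, as in the classical \<open>1 - 1/e\<close>
  hardness. The part in the ground set is concealed in the same way before the batch appears; afterwards it
  is revealed by a single element, but a query hits it only with probability \<open>O(k\<^sup>2 / n)\<close>. An algorithm
  ignorant of the hidden optimum reaches less than \<open>0.584\<close> of its value, so most batches cost
  \<open>\<Omega>(n / k\<^sup>2)\<close> queries.

  One minus the objective is a product of nonnegative decreasing supermodular functions, one for each batch.
  Choosing the instance at random and averaging over the seed reduces the claim to a deterministic
  algorithm. Resampling the hidden set of a single batch, while the run is compared with the one on the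
  function in which this set is erased, bounds the probability that a given query helps.

  For \<open>n = O(k\<^sup>2)\<close> only \<open>\<Omega>(n / k)\<close> queries are needed; there it suffices that every batch
  must be queried at all, and linear functions whose weights grow geometrically from batch to
  batch show this.
\<close>

section \<open>Decreasing supermodular functions\<close>

text \<open>A set queried after batch \<open>j\<close> has arrived depends on earlier answers and
  may thus be correlated with the hidden set of \<open>j\<close>. Comparing with the erased function
  removes this: until the round in which the batch is judged, both that function and the stream
  ignore \<open>\<tau> j\<close>, so the sets asked are fixed before \<open>\<tau> j\<close> is
  drawn and a union bound over them is legitimate. An output is treated as one more query. The main
  obstacle is that the ground part of a later hidden set is live all along. Early queries might
  detect it and early outputs might profit from it; both are excluded by a union bound over all
  batches and all queries of the stream. Here \<open>k \<ge> C log n\<close> enters: a chance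
  \<open>exp (- \<Omega>(k))\<close> per set has to beat a polynomial in \<open>n\<close>. Answers
  must agree exactly, not approximately, since a decision tree may branch on any real number. Hence
  the functions that are precisely exponential on small intersections and precisely constant on
  large sets. The latter also caps at \<open>O(k)\<close> the number of ground elements in a query
  that matters; rows of the ground set have about \<open>n / k\<close> candidates, whence the chance
  \<open>O(k^2 / n)\<close> of hitting one hidden element.\<close>

definition decreasing_supermodular_on :: "'a set \<Rightarrow> ('a set \<Rightarrow> real) \<Rightarrow> bool" where
  "decreasing_supermodular_on V \<phi> \<longleftrightarrow>
     (\<forall>S\<subseteq>V. 0 \<le> \<phi> S) \<and>
     (\<forall>S T. S \<subseteq> T \<longrightarrow> T \<subseteq> V \<longrightarrow> \<phi> T \<le> \<phi> S) \<and>
     (\<forall>S T. S \<subseteq> V \<longrightarrow> T \<subseteq> V \<longrightarrow> \<phi> S + \<phi> T \<le> \<phi> (S \<union> T) + \<phi> (S \<inter> T))"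

lemma decreasing_supermodular_onI:
  assumes "\<And>S. S \<subseteq> V \<Longrightarrow> 0 \<le> \<phi> S"
    and "\<And>S T. S \<subseteq> T \<Longrightarrow> T \<subseteq> V \<Longrightarrow> \<phi> T \<le> \<phi> S"
    and "\<And>S T. S \<subseteq> V \<Longrightarrow> T \<subseteq> V \<Longrightarrow> \<phi> S + \<phi> T \<le> \<phi> (S \<union> T) + \<phi> (S \<inter> T)"
  shows "decreasing_supermodular_on V \<phi>"
  using assms by (auto simp: decreasing_supermodular_on_def)

lemma decreasing_supermodular_onD:
  assumes "decreasing_supermodular_on V \<phi>"
  shows "S \<subseteq> V \<Longrightarrow> 0 \<le> \<phi> S"
    and "S \<subseteq> T \<Longrightarrow> T \<subseteq> V \<Longrightarrow> \<phi> T \<le> \<phi> S"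
    and "S \<subseteq> V \<Longrightarrow> T \<subseteq> V \<Longrightarrow> \<phi> S + \<phi> T \<le> \<phi> (S \<union> T) + \<phi> (S \<inter> T)"
  using assms by (auto simp: decreasing_supermodular_on_def)

lemma decreasing_supermodular_on_const: "0 \<le> c \<Longrightarrow> decreasing_supermodular_on V (\<lambda>_. c)"
  by (rule decreasing_supermodular_onI) auto

text \<open>\<open>u\<close> and \<open>i\<close> stand for the values at union and intersection.
  Expanding \<open>(a + b - u) * (a' + b' - u') + u * u' - a * a' - b * b'\<close> leaves
  \<open>(a - u) * (b' - u') + (b - u) * (a' - u')\<close>, so monotonicity and nonnegativity are
  what make supermodularity survive multiplication.\<close>

lemma four_point_product:
  fixes u a b i u' a' b' i' :: real
  assumes "0 \<le> u" "u \<le> a" "u \<le> b" "a + b \<le> u + i"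
    and "0 \<le> u'" "u' \<le> a'" "u' \<le> b'" "a' + b' \<le> u' + i'"
  shows "a * a' + b * b' \<le> u * u' + i * i'"
proof -
  have "(a + b - u) * (a' + b' - u') \<le> i * i'"
    by (rule mult_mono) (use assms in auto)
  moreover have "0 \<le> (a - u) * (b' - u') + (b - u) * (a' - u')"
    using assms by (intro add_nonneg_nonneg mult_nonneg_nonneg) auto
  ultimately show ?thesis by (simp add: algebra_simps)
qed

lemma decreasing_supermodular_on_mult:
  assumes "decreasing_supermodular_on V \<phi>" "decreasing_supermodular_on V \<psi>"
  shows "decreasing_supermodular_on V (\<lambda>S. \<phi> S * \<psi> S)"
proof (rule decreasing_supermodular_onI)
  note [simp] = decreasing_supermodular_onD[OF assms(1)] decreasing_supermodular_onD[OF assms(2)]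
  show "0 \<le> \<phi> S * \<psi> S" if "S \<subseteq> V" for S
    using that by simp
  show "\<phi> T * \<psi> T \<le> \<phi> S * \<psi> S" if "S \<subseteq> T" "T \<subseteq> V" for S T
    using that by (intro mult_mono) auto
  show "\<phi> S * \<psi> S + \<phi> T * \<psi> T \<le> \<phi> (S \<union> T) * \<psi> (S \<union> T) + \<phi> (S \<inter> T) * \<psi> (S \<inter> T)"
    if "S \<subseteq> V" "T \<subseteq> V" for S T
    using that by (intro four_point_product) auto
qed

lemma decreasing_supermodular_on_prod:
  assumes "finite I" "\<And>i. i \<in> I \<Longrightarrow> decreasing_supermodular_on V (\<phi> i)"
  shows "decreasing_supermodular_on V (\<lambda>S. \<Prod>i\<in>I. \<phi> i S)"
  using assms
  by (induction I) (auto intro: decreasing_supermodular_on_mult decreasing_supermodular_on_const)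

text \<open>The values at union and intersection weakly majorize the two others, and
  \<open>max c\<close> is convex and increasing. In terms of \<open>1 - \<phi>\<close> this is the
  truncation of a monotone submodular function from above.\<close>

lemma decreasing_supermodular_on_max:
  assumes "decreasing_supermodular_on V \<phi>"
  shows "decreasing_supermodular_on V (\<lambda>S. max c (\<phi> S))"
proof (rule decreasing_supermodular_onI)
  note D = decreasing_supermodular_onD[OF assms]
  show "0 \<le> max c (\<phi> S)" if "S \<subseteq> V" for S
    using D(1)[OF that] by simp
  show "max c (\<phi> T) \<le> max c (\<phi> S)" if "S \<subseteq> T" "T \<subseteq> V" for S T
    using D(2)[OF that] by auto
  show "max c (\<phi> S) + max c (\<phi> T) \<le> max c (\<phi> (S \<union> T)) + max c (\<phi> (S \<inter> T))"
    if "S \<subseteq> V" "T \<subseteq> V" for S T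
    using D(2)[of S "S \<union> T"] D(2)[of T "S \<union> T"] D(2)[of "S \<inter> T" S] D(2)[of "S \<inter> T" T]
      D(3)[OF that] that by (auto simp: max_def)
qed

text \<open>Provides the shape of \<open>batch_factor\<close>: \<open>v\<close> becomes
  \<open>hidden_share\<close>, a lower bound of the ground part, so that subtracting it preserves
  the nonnegativity required for products.\<close>

lemma decreasing_supermodular_on_add_scaled:
  assumes "decreasing_supermodular_on V \<phi>" "decreasing_supermodular_on V \<psi>" "0 \<le> c"
    and "\<And>S. S \<subseteq> V \<Longrightarrow> v \<le> \<phi> S"
  shows "decreasing_supermodular_on V (\<lambda>S. \<phi> S - v + c * \<psi> S)"
proof (rule decreasing_supermodular_onI)
  note D = decreasing_supermodular_onD[OF assms(1)] decreasing_supermodular_onD[OF assms(2)]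
  show "0 \<le> \<phi> S - v + c * \<psi> S" if "S \<subseteq> V" for S
    using assms(3,4) D(4)[OF that] that by (simp add: add_nonneg_nonneg)
  show "\<phi> T - v + c * \<psi> T \<le> \<phi> S - v + c * \<psi> S" if "S \<subseteq> T" "T \<subseteq> V" for S T
    using D(2)[OF that] mult_left_mono[OF D(5)[OF that] assms(3)] by simp
  show "\<phi> S - v + c * \<psi> S + (\<phi> T - v + c * \<psi> T)
      \<le> \<phi> (S \<union> T) - v + c * \<psi> (S \<union> T) + (\<phi> (S \<inter> T) - v + c * \<psi> (S \<inter> T))"
    if "S \<subseteq> V" "T \<subseteq> V" for S T
    using D(3)[OF that] mult_left_mono[OF D(6)[OF that] assms(3)] by (simp add: algebra_simps)
qed

section \<open>Convex functions of cardinalities\<close>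

lemma convex_four_point:
  fixes h :: "real \<Rightarrow> real"
  assumes "convex_on UNIV h" "i \<le> m" "i \<le> n" "m + n = i + u"
  shows "h m + h n \<le> h i + h u"
proof (cases "i = u")
  case True
  hence "m = i" "n = i" using assms by auto
  then show ?thesis using True by simp
next
  case False
  with assms have "i < u" by auto
  define s where "s = (m - i) / (u - i)"
  have s: "0 \<le> s" "s \<le> 1" using \<open>i < u\<close> assms by (auto simp: s_def field_simps)
  have si: "s * (u - i) = m - i"
    using \<open>i < u\<close> by (simp add: s_def)
  have m: "m = (1 - s) * i + s * u" and n: "n = (1 - (1 - s)) * i + (1 - s) * u"
    using si assms(4) by (simp_all add: algebra_simps)
  have "h m \<le> (1 - s) * h i + s * h u"
    using convex_onD[OF assms(1) s, of i u] by (simp add: m)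
  moreover have "h n \<le> (1 - (1 - s)) * h i + (1 - s) * h u"
    using convex_onD[OF assms(1), of "1 - s" i u] s by (simp add: n)
  ultimately show ?thesis by (simp add: algebra_simps)
qed

text \<open>The cardinality of \<open>S \<inter> X\<close> is modular in \<open>S\<close>, and a
  convex function of a monotone modular one is supermodular. As \<open>h\<close> is antitone, its
  sign has to be checked only at the full set \<open>X\<close>.\<close>

lemma decreasing_supermodular_on_card:
  fixes h :: "real \<Rightarrow> real"
  assumes "convex_on UNIV h" "antimono h" "finite X" "0 \<le> h (real (card X) / r)" "0 \<le> r"
  shows "decreasing_supermodular_on V (\<lambda>S. h (real (card (S \<inter> X)) / r))"
proof (rule decreasing_supermodular_onI)
  have mono: "h (real (card (T \<inter> X)) / r) \<le> h (real (card (S \<inter> X)) / r)" if "S \<inter> X \<subseteq> T \<inter> X" for S T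
    using that assms(3,5) by (intro antimonoD[OF assms(2)] divide_right_mono) (auto intro: card_mono)
  show "0 \<le> h (real (card (S \<inter> X)) / r)" for S
    using mono[of S X] assms(4) by simp
  show "h (real (card (T \<inter> X)) / r) \<le> h (real (card (S \<inter> X)) / r)" if "S \<subseteq> T" for S T
    using that by (intro mono) auto
  show "h (real (card (S \<inter> X)) / r) + h (real (card (T \<inter> X)) / r)
      \<le> h (real (card ((S \<union> T) \<inter> X)) / r) + h (real (card (S \<inter> T \<inter> X)) / r)" for S T
  proof -
    have "card (S \<inter> X) + card (T \<inter> X) = card ((S \<union> T) \<inter> X) + card (S \<inter> T \<inter> X)"
      using card_Un_Int[of "S \<inter> X" "T \<inter> X"] assms(3)
      by (simp add: Int_Un_distrib2[symmetric] inf_sup_aci)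
    hence "real (card (S \<inter> X)) + real (card (T \<inter> X))
        = real (card (S \<inter> T \<inter> X)) + real (card ((S \<union> T) \<inter> X))"
      by (metis add.commute of_nat_add)
    moreover have "card (S \<inter> T \<inter> X) \<le> card (S \<inter> X)" "card (S \<inter> T \<inter> X) \<le> card (T \<inter> X)"
      using assms(3) by (auto intro!: card_mono)
    ultimately have "h (real (card (S \<inter> X)) / r) + h (real (card (T \<inter> X)) / r)
      \<le> h (real (card (S \<inter> T \<inter> X)) / r) + h (real (card ((S \<union> T) \<inter> X)) / r)"
      using assms(5)
      by (intro convex_four_point[OF assms(1)]) (auto simp: divide_right_mono add_divide_distrib[symmetric])
    then show ?thesis by simp
  qed
qed

lemma problem_instance_min_one_minus:
  assumes "decreasing_supermodular_on V \<phi>" "finite V" "0 \<le> c" "\<And>S. S \<subseteq> V \<Longrightarrow> \<phi> S \<le> 1"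
    and "length us = n" "elem ` set us \<subseteq> V"
  shows "problem_instance n V (\<lambda>S. min (1 - \<phi> S) c) us"
proof -
  have "decreasing_supermodular_on V (\<lambda>S. max (1 - c) (\<phi> S))"
    by (rule decreasing_supermodular_on_max) fact
  note D = decreasing_supermodular_onD[OF this]
  have eq: "min (1 - \<phi> S) c = 1 - max (1 - c) (\<phi> S)" for S
    by auto
  have "mono_on (Pow V) (\<lambda>S. min (1 - \<phi> S) c)"
    using D(2) unfolding eq by (intro mono_onI) auto
  moreover have "submodular_on V (\<lambda>S. min (1 - \<phi> S) c)"
    using D(3) unfolding eq submodular_on_def by (smt (verit))
  ultimately show ?thesis
    using assms(2-) unfolding problem_instance_def by auto
qed

text \<open>
  Replacing \<open>exp (- r x)\<close> by its tangent line at \<open>d\<close> from \<open>d\<close> on makes a hidden set more valuable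
  than generic elements, but only to someone who already holds a \<open>d\<close>-fraction of it.
\<close>

definition exp_linear :: "real \<Rightarrow> real \<Rightarrow> real \<Rightarrow> real" where
  "exp_linear d r x = (if x \<le> d then exp (- r * x) else exp (- r * d) * (1 - r * (x - d)))"

definition exp_linear_slope :: "real \<Rightarrow> real \<Rightarrow> real \<Rightarrow> real" where
  "exp_linear_slope d r x = - r * exp (- r * min x d)"

lemma exp_tangent: "exp x * (1 + (y - x)) \<le> exp (y::real)"
proof -
  have "exp x * (1 + (y - x)) \<le> exp x * exp (y - x)"
    by (intro mult_left_mono) auto
  then show ?thesis by (simp flip: exp_add)
qed

text \<open>\<open>exp_linear_slope\<close> is a subgradient at every point. Convexity, monotonicity
  and the Lipschitz bound are all read off from this inequality.\<close>

lemma exp_linear_tangent: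
  assumes "0 \<le> r"
  shows "exp_linear d r x + exp_linear_slope d r x * (y - x) \<le> exp_linear d r y"
proof -
  have t: "exp (- r * x) * (1 - r * (y - x)) \<le> exp (- r * y)" for x y
    using exp_tangent[of "- r * x" "- r * y"] by (simp add: algebra_simps)
  consider "x \<le> d" "y \<le> d" | "x \<le> d" "d < y" | "d < x" "y \<le> d" | "d < x" "d < y" by linarith
  then show ?thesis
  proof cases
    case 1
    then show ?thesis using t[of x y] by (simp add: exp_linear_def exp_linear_slope_def algebra_simps)
  next
    case 2
    \<comment> \<open>From \<open>x\<close> to \<open>d\<close> the tangent of the exponential is
      used; beyond \<open>d\<close> the slope at \<open>x\<close> is at least as steep as the one of
      the linear piece.\<close>
    have "exp (- r * d) \<le> exp (- r * x)" using 2 assms by (simp add: mult_left_mono)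
    hence "r * exp (- r * d) * (y - d) \<le> r * exp (- r * x) * (y - d)"
      using 2 assms by (intro mult_right_mono mult_left_mono) auto
    then show ?thesis using 2 t[of x d] by (simp add: exp_linear_def exp_linear_slope_def algebra_simps)
  next
    case 3
    then show ?thesis using t[of d y] by (simp add: exp_linear_def exp_linear_slope_def algebra_simps)
  next
    case 4
    then show ?thesis by (simp add: exp_linear_def exp_linear_slope_def algebra_simps)
  qed
qed

lemma convex_on_exp_linear:
  assumes "0 \<le> r"
  shows "convex_on UNIV (exp_linear d r)"
proof (rule convex_onI)
  fix s x y :: real assume s: "0 < s" "s < 1"
  define z where "z = (1 - s) *\<^sub>R x + s *\<^sub>R y"
  define g where "g = exp_linear_slope d r z"
  have "(1 - s) * (exp_linear d r z + g * (x - z)) \<le> (1 - s) * exp_linear d r x"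
    "s * (exp_linear d r z + g * (y - z)) \<le> s * exp_linear d r y"
    using s unfolding g_def by (auto intro!: mult_left_mono exp_linear_tangent assms)
  moreover have "(1 - s) * (x - z) + s * (y - z) = 0"
    by (simp add: z_def algebra_simps)
  hence "g * ((1 - s) * (x - z) + s * (y - z)) = 0" by simp
  ultimately show "exp_linear d r z \<le> (1 - s) * exp_linear d r x + s * exp_linear d r y"
    by (simp add: algebra_simps)
qed auto

lemma antimono_exp_linear:
  assumes "0 \<le> r"
  shows "antimono (exp_linear d r)"
proof (rule antimonoI)
  fix x y :: real assume "x \<le> y"
  have "exp_linear_slope d r y \<le> 0"
    using assms by (simp add: exp_linear_slope_def)
  hence "0 \<le> exp_linear_slope d r y * (x - y)"
    using \<open>x \<le> y\<close> by (intro mult_nonpos_nonpos) auto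
  then show "exp_linear d r y \<le> exp_linear d r x"
    using exp_linear_tangent[OF assms, of d y x] by linarith
qed

lemma exp_linear_le_exp:
  assumes "0 \<le> r"
  shows "exp_linear d r x \<le> exp (- r * x)"
  using exp_tangent[of "- r * d" "- r * x"] by (auto simp: exp_linear_def algebra_simps)

lemma exp_linear_eq_exp: "x \<le> d \<Longrightarrow> exp_linear d r x = exp (- r * x)"
  by (simp add: exp_linear_def)

lemma exp_linear_0: "0 \<le> d \<Longrightarrow> exp_linear d r 0 = 1"
  by (simp add: exp_linear_def)

lemma exp_linear_le_1:
  assumes "0 \<le> r" "0 \<le> d" "0 \<le> x"
  shows "exp_linear d r x \<le> 1"
  using antimonoD[OF antimono_exp_linear[OF assms(1)] assms(3), of d] exp_linear_0[OF assms(2), of r]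
  by simp

lemma exp_linear_Lipschitz:
  assumes "0 \<le> r" "0 \<le> d" "0 \<le> x" "x \<le> y"
  shows "exp_linear d r x \<le> exp_linear d r y + r * (y - x)"
proof -
  have "- r \<le> exp_linear_slope d r x"
    using assms by (simp add: exp_linear_slope_def mult_left_le)
  hence "- r * (y - x) \<le> exp_linear_slope d r x * (y - x)"
    using assms by (intro mult_right_mono) auto
  then show ?thesis
    using exp_linear_tangent[OF assms(1), of d x y] by simp
qed

section \<open>Transcripts and counting\<close>

text \<open>Two runs of one decision tree ask the same sets until an answer differs. That
  \<open>m\<close> is in range for both lists matters later: a cap on the queries of the actual run
  then limits how far one must look in the comparison run.\<close>

lemma comp_queries_diff:
  "comp_queries f c \<noteq> comp_queries g c \<Longrightarrow>
     \<exists>m<length (comp_queries g c). m < length (comp_queries f c) \<and>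
       f (fst (comp_queries g c ! m)) \<noteq> g (fst (comp_queries g c ! m))"
proof (induction c)
  case (Output S)
  then show ?case by simp
next
  case (Query T h)
  show ?case
  proof (cases "f T = g T")
    case True
    with Query.prems have "comp_queries f (h (g T)) \<noteq> comp_queries g (h (g T))" by simp
    with Query.IH[OF rangeI] obtain m where
      "m < length (comp_queries g (h (g T)))" "m < length (comp_queries f (h (g T)))"
      "f (fst (comp_queries g (h (g T)) ! m)) \<noteq> g (fst (comp_queries g (h (g T)) ! m))"
      by blast
    with True show ?thesis by (intro exI[of _ "Suc m"]) simp
  next
    case False
    then show ?thesis by (intro exI[of _ 0]) simp
  qed
qed

lemma comp_output_eq:
  "comp_queries f c = comp_queries g c \<Longrightarrow> comp_output f c = comp_output g c"
  by (induction c) auto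

lemma transcript_diff:
  "transcript A f us i \<noteq> transcript A g us i \<Longrightarrow>
     \<exists>m<length (transcript A g us i). m < length (transcript A f us i) \<and>
       f (fst (transcript A g us i ! m)) \<noteq> g (fst (transcript A g us i ! m))"
proof (induction i)
  case 0
  then show ?case by simp
next
  case (Suc i)
  let ?l = "length (transcript A g us i)"
  show ?case
  proof (cases "transcript A f us i = transcript A g us i")
    case True
    let ?c = "A (take (Suc i) us) (transcript A g us i)"
    from Suc.prems True have "comp_queries f ?c \<noteq> comp_queries g ?c" by simp
    then obtain m where "m < length (comp_queries g ?c)" "m < length (comp_queries f ?c)"
      "f (fst (comp_queries g ?c ! m)) \<noteq> g (fst (comp_queries g ?c ! m))"
      using comp_queries_diff by blast
    with True show ?thesis by (intro exI[of _ "?l + m"]) simp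
  next
    case False
    with Suc.IH obtain m where "m < ?l" "m < length (transcript A f us i)"
      "f (fst (transcript A g us i ! m)) \<noteq> g (fst (transcript A g us i ! m))"
      by blast
    then show ?thesis by (intro exI[of _ m]) (simp add: nth_append)
  qed
qed

lemma transcript_prefix:
  "i \<le> j \<Longrightarrow> \<exists>ys. transcript A f us j = transcript A f us i @ ys"
  by (induction j) (auto simp: le_Suc_eq)

lemma length_transcript_mono: "i \<le> j \<Longrightarrow> length (transcript A f us i) \<le> length (transcript A f us j)"
  by (metis transcript_prefix length_append le_add1)

text \<open>Transcripts carry no marks between rounds, so equality of the whole lists does not at
  once align the rounds. But a disagreement by round \<open>i\<close> would leave different recorded
  answers at the same position \<open>m\<close> of the two full lists.\<close>

lemma transcript_eq_prefix:
  assumes "transcript A f us j = transcript A g us j" "i \<le> j"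
  shows "transcript A f us i = transcript A g us i"
proof (rule ccontr)
  assume "transcript A f us i \<noteq> transcript A g us i"
  then obtain m where m: "m < length (transcript A g us i)" "m < length (transcript A f us i)"
    "f (fst (transcript A g us i ! m)) \<noteq> g (fst (transcript A g us i ! m))"
    using transcript_diff by blast
  obtain xs where xs: "transcript A f us j = transcript A f us i @ xs"
    using transcript_prefix assms(2) by blast
  obtain ys where ys: "transcript A g us j = transcript A g us i @ ys"
    using transcript_prefix assms(2) by blast
  have answers: "y = h T" if "(T, y) \<in> set (transcript A h us i)" for T y h i
    using that
  proof (induction i)
    case (Suc i)
    have "y = h T" if "(T, y) \<in> set (comp_queries h c)" for c
      using that by (induction c) auto
    with Suc show ?case by auto
  qed simp
  have "transcript A f us i ! m = transcript A g us i ! m"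
    using assms(1) m xs ys by (metis nth_append)
  moreover have "snd (transcript A h us i ! m) = h (fst (transcript A h us i ! m))"
    if "m < length (transcript A h us i)" for h
    using answers[of "fst (transcript A h us i ! m)" "snd (transcript A h us i ! m)" h i] that by simp
  ultimately show False using m by metis
qed

lemma solution_eq:
  assumes "transcript A f us i = transcript A g us i" "1 \<le> i"
  shows "solution A f us i = solution A g us i"
proof -
  obtain r where r: "i = Suc r" using assms(2) by (cases i) auto
  have eq: "transcript A f us r = transcript A g us r"
    by (rule transcript_eq_prefix[OF assms(1)]) (simp add: r)
  let ?c = "A (take (Suc r) us) (transcript A g us r)"
  have "comp_queries f ?c = comp_queries g ?c"
    using assms(1) eq by (simp add: r)
  from comp_output_eq[OF this] show ?thesis
    by (simp add: r solution_def round_comp_def eq)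
qed

lemma transcript_cong:
  "take i us = take i us' \<Longrightarrow> transcript A f us i = transcript A f us' i"
proof (induction i)
  case (Suc i)
  have "take i us = take i us'"
    using arg_cong[OF Suc.prems, of "take i"] by (simp add: min_def)
  with Suc show ?case by simp
qed simp

lemma solution_cong:
  assumes "take i us = take i us'"
  shows "solution A f us i = solution A f us' i"
proof -
  have "take (i - 1) us = take (i - 1) us'"
    using arg_cong[OF assms, of "take (i - 1)"] by (simp add: min_def split: if_splits)
  then show ?thesis
    using transcript_cong[of "i - 1" us us'] assms by (simp add: solution_def round_comp_def)
qed

lemma transcript_query_round:
  assumes "T \<in> fst ` set (transcript A f us i)"
  obtains r where "1 \<le> r" "r \<le> i" "T \<in> fst ` set (comp_queries f (round_comp A f us r))"
  using assms
proof (induction i arbitrary: thesis)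
  case (Suc i)
  from Suc.prems(2) consider "T \<in> fst ` set (transcript A f us i)"
    | "T \<in> fst ` set (comp_queries f (A (take (Suc i) us) (transcript A f us i)))"
    by auto
  then show ?case
  proof cases
    case 1
    then obtain r where "1 \<le> r" "r \<le> i" "T \<in> fst ` set (comp_queries f (round_comp A f us r))"
      using Suc.IH by blast
    then show ?thesis using Suc.prems(1)[of r] by simp
  next
    case 2
    then show ?thesis using Suc.prems(1)[of "Suc i"] by (simp add: round_comp_def)
  qed
qed simp

section \<open>Live sets of update sequences\<close>

lemma live_snoc: "live (us @ [u]) = apply_update (live us) u"
  by (simp add: live_def)

lemma live_append: "live (us @ vs) = foldl apply_update (live us) vs"
  by (simp add: live_def)

lemma foldl_Insert: "foldl apply_update S (map Insert xs) = S \<union> set xs"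
  by (induction xs arbitrary: S) auto

lemma foldl_Delete: "foldl apply_update S (map Delete xs) = S - set xs"
  by (induction xs arbitrary: S) auto

lemma live_subset_inserted: "live us \<subseteq> {e. Insert e \<in> set us}"
proof (induction us rule: rev_induct)
  case Nil
  then show ?case by (simp add: live_def)
next
  case (snoc u us)
  then show ?case by (cases u) (auto simp: live_snoc)
qed

lemma appeared_subset_inserted: "appeared us \<subseteq> {e. Insert e \<in> set us}"
  unfolding appeared_def using live_subset_inserted set_take_subset by fastforce

section \<open>Double counting, resampling and random transversals\<close>

text \<open>Counts pairs of an instance and a hit batch. If the bound failed, at most half of the
  batches of any instance could exceed \<open>L\<close> queries, so each instance in
  \<open>Succ - Bad\<close>, a fraction of at least \<open>2/3 - 1/12 = 7/12\<close>, would have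
  \<open>t / 2\<close> hits. The resulting density \<open>7/24\<close> exceeds the permitted
  \<open>1/8\<close>.\<close>

lemma batch_counting:
  fixes q :: "nat \<Rightarrow> 'c \<Rightarrow> nat"
  assumes "finite \<Omega>" "\<Omega> \<noteq> {}" "Succ \<subseteq> \<Omega>" "2 / 3 * real (card \<Omega>) \<le> real (card Succ)"
    and "Bad \<subseteq> \<Omega>" "real (card Bad) \<le> real (card \<Omega>) / 12"
    and "\<And>j. j < t \<Longrightarrow> Hit j \<subseteq> \<Omega>" "\<And>j. j < t \<Longrightarrow> real (card (Hit j)) \<le> real (card \<Omega>) / 8"
    and "\<And>\<tau>. \<tau> \<in> \<Omega> \<Longrightarrow> real (\<Sum>j<t. q j \<tau>) \<le> N"
    and "\<And>\<tau> j. \<tau> \<in> Succ \<Longrightarrow> \<tau> \<notin> Bad \<Longrightarrow> j < t \<Longrightarrow> q j \<tau> \<le> L \<Longrightarrow> \<tau> \<in> Hit j"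
  shows "real (L + 1) * real t \<le> 2 * N"
proof (rule ccontr)
  assume "\<not> ?thesis"
  hence N: "2 * N < real (L + 1) * real t" by simp
  have "0 \<le> N"
    using assms(2,9) by (meson equals0I of_nat_0_le_iff order_trans)
  hence t: "0 < real t" using N by (cases "t = 0") auto
  have fin: "finite Succ" "finite Bad" using assms(1,3,5) finite_subset by auto
  define G where "G = Succ - Bad"
  have G: "G \<subseteq> \<Omega>" "finite G" using assms(3) fin by (auto simp: G_def)
  have "card Succ \<le> card G + card Bad"
    using card_Un_le[of G Bad] card_mono[of "G \<union> Bad" Succ] fin G by (force simp: G_def)
  hence cG: "7 / 12 * real (card \<Omega>) \<le> real (card G)"
    using assms(4,6) by linarith
  have many: "real t / 2 \<le> (\<Sum>j<t. of_bool (\<tau> \<in> Hit j))" if "\<tau> \<in> G" for \<tau>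
  proof -
    have "real (L + 1) * (\<Sum>j<t. of_bool (L < q j \<tau>)) = (\<Sum>j<t. real (L + 1) * of_bool (L < q j \<tau>))"
      by (simp add: sum_distrib_left)
    also have "\<dots> \<le> (\<Sum>j<t. real (q j \<tau>))"
      by (intro sum_mono) auto
    also have "\<dots> \<le> N" using assms(9)[of \<tau>] that G by auto
    finally have "real (L + 1) * (\<Sum>j<t. of_bool (L < q j \<tau>)) \<le> N" .
    also have "N < real (L + 1) * (real t / 2)" using N by simp
    finally have "real (L + 1) * (\<Sum>j<t. of_bool (L < q j \<tau>)) < real (L + 1) * (real t / 2)" .
    hence a: "(\<Sum>j<t. of_bool (L < q j \<tau>)) \<le> real t / 2"
      by (subst (asm) mult_less_cancel_left_pos) auto
    have "(\<Sum>j<t. of_bool (q j \<tau> \<le> L)) + (\<Sum>j<t. of_bool (L < q j \<tau>)) = (\<Sum>j<t. 1 :: real)"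
      unfolding sum.distrib[symmetric] by (intro sum.cong) auto
    moreover have "(\<Sum>j<t. of_bool (q j \<tau> \<le> L)) \<le> (\<Sum>j<t. of_bool (\<tau> \<in> Hit j) :: real)"
      using that assms(10)[of \<tau>] by (intro sum_mono) (auto simp: G_def)
    ultimately show ?thesis using a by simp
  qed
  have "7 / 12 * real (card \<Omega>) * (real t / 2) \<le> real (card G) * (real t / 2)"
    using cG by (intro mult_right_mono) auto
  also have "\<dots> \<le> (\<Sum>\<tau>\<in>G. \<Sum>j<t. of_bool (\<tau> \<in> Hit j))"
    using sum_mono[OF many] by simp
  also have "\<dots> \<le> (\<Sum>\<tau>\<in>\<Omega>. \<Sum>j<t. of_bool (\<tau> \<in> Hit j))"
    using G assms(1) by (intro sum_mono2) (auto intro: sum_nonneg)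
  also have "\<dots> = (\<Sum>j<t. \<Sum>\<tau>\<in>\<Omega>. of_bool (\<tau> \<in> Hit j))"
    by (rule sum.swap)
  also have "\<dots> = (\<Sum>j<t. real (card (Hit j)))"
    using assms(1,7) by (intro sum.cong) (auto simp: of_bool_def sum.If_cases Int_absorb1)
  also have "\<dots> \<le> (\<Sum>j<t. real (card \<Omega>) / 8)"
    using assms(8) by (intro sum_mono) auto
  finally have "7 / 24 * (real (card \<Omega>) * real t) \<le> 1 / 8 * (real (card \<Omega>) * real t)"
    by (simp add: algebra_simps)
  moreover have "0 < real (card \<Omega>) * real t"
    using assms(1,2) t by (simp add: card_gt_0_iff)
  ultimately show False by (simp add: mult.commute)
qed

text \<open>Law of total probability: a bound that holds conditionally on all coordinates other than
  \<open>j\<close> holds outright.\<close>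

lemma card_resample:
  fixes \<Omega> :: "('i \<Rightarrow> 'c) set"
  assumes "finite \<Omega>"
    and "\<And>\<sigma>. \<sigma> \<in> \<Omega> \<Longrightarrow> real (card {x. \<sigma>(j := x) \<in> \<Omega> \<and> P (\<sigma>(j := x))})
           \<le> \<epsilon> * real (card {x. \<sigma>(j := x) \<in> \<Omega>})"
  shows "real (card {\<sigma> \<in> \<Omega>. P \<sigma>}) \<le> \<epsilon> * real (card \<Omega>)"
proof -
  \<comment> \<open>Overwriting coordinate \<open>j\<close> by a fixed value yields a label for the
    class of functions agreeing outside \<open>j\<close>.\<close>
  let ?r = "\<lambda>\<sigma>. \<sigma>(j := undefined)"
  have fiber: "card {\<sigma> \<in> \<Omega>. ?r \<sigma> = ?r \<rho> \<and> Q \<sigma>} = card {x. \<rho>(j := x) \<in> \<Omega> \<and> Q (\<rho>(j := x))}" for \<rho> Q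
  proof -
    have "bij_betw (\<lambda>x. \<rho>(j := x)) {x. \<rho>(j := x) \<in> \<Omega> \<and> Q (\<rho>(j := x))}
            {\<sigma> \<in> \<Omega>. ?r \<sigma> = ?r \<rho> \<and> Q \<sigma>}"
    proof (rule bij_betwI[where g = "\<lambda>\<sigma>. \<sigma> j"])
      have "\<rho>(j := \<sigma> j) = \<sigma>" if "?r \<sigma> = ?r \<rho>" for \<sigma>
        using that by (metis fun_upd_triv fun_upd_upd)
      then show "(\<lambda>\<sigma>. \<sigma> j) \<in> {\<sigma> \<in> \<Omega>. ?r \<sigma> = ?r \<rho> \<and> Q \<sigma>} \<rightarrow> {x. \<rho>(j := x) \<in> \<Omega> \<and> Q (\<rho>(j := x))}"
        and "\<sigma> \<in> {\<sigma> \<in> \<Omega>. ?r \<sigma> = ?r \<rho> \<and> Q \<sigma>} \<Longrightarrow> \<rho>(j := \<sigma> j) = \<sigma>" for \<sigma>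
        by auto
    qed auto
    then show ?thesis by (simp add: bij_betw_same_card)
  qed
  have "real (card {\<sigma> \<in> \<Omega>. P \<sigma>}) = (\<Sum>\<sigma>\<in>\<Omega>. of_bool (P \<sigma>))"
    using assms(1) by (simp add: of_bool_def sum.If_cases Int_def)
  also have "\<dots> = (\<Sum>y\<in>?r ` \<Omega>. \<Sum>\<sigma>\<in>{\<sigma>. \<sigma> \<in> \<Omega> \<and> ?r \<sigma> = y}. of_bool (P \<sigma>))"
    by (rule sum.image_gen[OF assms(1)])
  also have "\<dots> \<le> (\<Sum>y\<in>?r ` \<Omega>. \<epsilon> * (\<Sum>\<sigma>\<in>{\<sigma>. \<sigma> \<in> \<Omega> \<and> ?r \<sigma> = y}. 1))"
  proof (rule sum_mono)
    fix y assume "y \<in> ?r ` \<Omega>"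
    then obtain \<rho> where \<rho>: "\<rho> \<in> \<Omega>" "y = ?r \<rho>" by auto
    have "(\<Sum>\<sigma>\<in>{\<sigma>. \<sigma> \<in> \<Omega> \<and> ?r \<sigma> = y}. of_bool (P \<sigma>))
        = real (card {\<sigma> \<in> \<Omega>. ?r \<sigma> = ?r \<rho> \<and> P \<sigma>})"
      using assms(1) \<rho>(2) by (simp add: of_bool_def sum.If_cases Int_def conj_ac)
    also have "\<dots> \<le> \<epsilon> * real (card {x. \<rho>(j := x) \<in> \<Omega>})"
      unfolding fiber by (rule assms(2)[OF \<rho>(1)])
    also have "card {x. \<rho>(j := x) \<in> \<Omega>} = card {\<sigma>. \<sigma> \<in> \<Omega> \<and> ?r \<sigma> = y}"
      using fiber[of \<rho> "\<lambda>_. True"] \<rho>(2) by simp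
    also have "real (card {\<sigma>. \<sigma> \<in> \<Omega> \<and> ?r \<sigma> = y}) = (\<Sum>\<sigma>\<in>{\<sigma>. \<sigma> \<in> \<Omega> \<and> ?r \<sigma> = y}. 1)"
      by simp
    finally show "(\<Sum>\<sigma>\<in>{\<sigma>. \<sigma> \<in> \<Omega> \<and> ?r \<sigma> = y}. of_bool (P \<sigma>))
      \<le> \<epsilon> * (\<Sum>\<sigma>\<in>{\<sigma>. \<sigma> \<in> \<Omega> \<and> ?r \<sigma> = y}. 1)" .
  qed
  also have "\<dots> = \<epsilon> * (\<Sum>y\<in>?r ` \<Omega>. \<Sum>\<sigma>\<in>{\<sigma>. \<sigma> \<in> \<Omega> \<and> ?r \<sigma> = y}. 1)"
    by (simp add: sum_distrib_left)
  also have "\<dots> = \<epsilon> * (\<Sum>\<sigma>\<in>\<Omega>. 1)"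
    by (subst sum.image_gen[OF assms(1), of _ ?r]) simp
  finally show ?thesis by simp
qed

text \<open>The left side is the expected number of elements of \<open>T\<close> in a uniform
  transversal of the rows in \<open>J\<close>.\<close>

lemma sum_row_density_le:
  assumes "finite J" "disjoint_family_on R J" "finite U" "\<And>l. l \<in> J \<Longrightarrow> R l \<subseteq> U"
    and "0 < \<rho>" "\<And>l. l \<in> J \<Longrightarrow> \<rho> \<le> real (card (R l))"
  shows "(\<Sum>l\<in>J. real (card (T \<inter> R l)) / real (card (R l))) \<le> real (card (T \<inter> U)) / \<rho>"
proof -
  have "(\<Sum>l\<in>J. real (card (T \<inter> R l)) / real (card (R l))) \<le> (\<Sum>l\<in>J. real (card (T \<inter> R l)) / \<rho>)"
    using assms(5,6) by (intro sum_mono divide_left_mono) (auto intro!: mult_pos_pos dest: less_le_trans)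
  also have "\<dots> = real (\<Sum>l\<in>J. card (T \<inter> R l)) / \<rho>"
    by (simp add: sum_divide_distrib)
  also have "(\<Sum>l\<in>J. card (T \<inter> R l)) = card (\<Union>l\<in>J. T \<inter> R l)"
    using assms(1,2) finite_subset[OF assms(4,3)] by (intro card_UN_disjoint[symmetric])
      (auto simp: disjoint_family_on_def)
  also have "real (card (\<Union>l\<in>J. T \<inter> R l)) / \<rho> \<le> real (card (T \<inter> U)) / \<rho>"
    using assms(3,4,5) by (intro divide_right_mono) (auto intro!: card_mono)
  finally show ?thesis .
qed

text \<open>Chernoff bound: Markov's inequality for \<open>c\<close> to the number of hits. The
  expectation factorizes over the independent rows, each factor being estimated by
  \<open>1 + x \<le> exp x\<close>; rows outside \<open>J\<close> contribute the weight 1.\<close>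

lemma card_transversal_large:
  fixes R :: "'i \<Rightarrow> 'a set" and s c :: real
  assumes "finite I" "J \<subseteq> I" "\<And>l. l \<in> I \<Longrightarrow> finite (R l)" "1 \<le> c"
    and "disjoint_family_on R J" "finite U" "\<And>l. l \<in> J \<Longrightarrow> R l \<subseteq> U"
    and "0 < \<rho>" "\<And>l. l \<in> J \<Longrightarrow> \<rho> \<le> real (card (R l))"
  shows "real (card {x \<in> PiE I R. s \<le> real (card {l \<in> J. x l \<in> T})})
    \<le> c powr (- s) * exp ((c - 1) * (real (card (T \<inter> U)) / \<rho>)) * real (card (PiE I R))"
proof -
  let ?X = "PiE I R"
  let ?g = "\<lambda>l y. if l \<in> J \<and> y \<in> T then c else 1"
  define d where "d l = (if l \<in> J then real (card (T \<inter> R l)) / real (card (R l)) else 0)" for l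
  have finX: "finite ?X" using assms(1,3) by (intro finite_PiE) auto
  have finJ: "finite J" using assms(1,2) finite_subset by auto
  have prod_g: "(\<Prod>l\<in>I. ?g l (x l)) = c powr real (card {l \<in> J. x l \<in> T})" for x
  proof -
    have "(\<Prod>l\<in>I. ?g l (x l)) = c ^ card {l \<in> J. x l \<in> T}"
    proof -
      have "I \<inter> {l. l \<in> J \<and> x l \<in> T} = {l \<in> J. x l \<in> T}" using assms(2) by auto
      then show ?thesis using assms(1) by (simp add: prod.If_cases)
    qed
    then show ?thesis using assms(4) by (simp add: powr_realpow)
  qed
  have "c powr s * real (card {x \<in> ?X. s \<le> real (card {l \<in> J. x l \<in> T})})
      = (\<Sum>x\<in>{x \<in> ?X. s \<le> real (card {l \<in> J. x l \<in> T})}. c powr s)"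
    by simp
  also have "\<dots> \<le> (\<Sum>x\<in>{x \<in> ?X. s \<le> real (card {l \<in> J. x l \<in> T})}. \<Prod>l\<in>I. ?g l (x l))"
    unfolding prod_g using assms(4) by (intro sum_mono powr_mono) auto
  also have "\<dots> \<le> (\<Sum>x\<in>?X. \<Prod>l\<in>I. ?g l (x l))"
    using finX assms(4) by (intro sum_mono2) (auto intro!: prod_nonneg)
  also have "\<dots> = (\<Prod>l\<in>I. \<Sum>y\<in>R l. ?g l y)"
    using assms(1,3) by (intro prod_sum_PiE[symmetric]) auto
  also have "\<dots> \<le> (\<Prod>l\<in>I. real (card (R l)) * exp ((c - 1) * d l))"
  proof (rule prod_mono, intro conjI)
    fix l assume l: "l \<in> I"
    show "0 \<le> (\<Sum>y\<in>R l. ?g l y)" using assms(4) by (intro sum_nonneg) auto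
    show "(\<Sum>y\<in>R l. ?g l y) \<le> real (card (R l)) * exp ((c - 1) * d l)"
    proof (cases "l \<in> J")
      case True
      hence pos: "0 < real (card (R l))" by (rule less_le_trans[OF assms(8) assms(9)])
      have "(\<Sum>y\<in>R l. ?g l y) = (\<Sum>y\<in>R l. 1 + (c - 1) * of_bool (y \<in> T))"
        using True by (intro sum.cong) auto
      also have "\<dots> = real (card (R l)) + (c - 1) * real (card (T \<inter> R l))"
        using assms(3)[OF l]
        by (simp add: sum.distrib sum_distrib_left[symmetric] of_bool_def sum.If_cases Int_commute)
      also have "\<dots> = real (card (R l)) * (1 + (c - 1) * d l)"
        using pos True by (simp add: d_def field_simps)
      also have "\<dots> \<le> real (card (R l)) * exp ((c - 1) * d l)"
        by (intro mult_left_mono) auto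
      finally show ?thesis .
    qed (simp add: d_def)
  qed
  also have "\<dots> = real (card ?X) * exp ((c - 1) * (\<Sum>l\<in>I. d l))"
    using assms(1) by (simp add: prod.distrib card_PiE exp_sum[symmetric] sum_distrib_left)
  also have "(\<Sum>l\<in>I. d l) = (\<Sum>l\<in>J. real (card (T \<inter> R l)) / real (card (R l)))"
    using assms(1,2) by (simp add: d_def sum.If_cases Int_absorb1)
  also have "real (card ?X) * exp ((c - 1) * \<dots>)
      \<le> real (card ?X) * exp ((c - 1) * (real (card (T \<inter> U)) / \<rho>))"
    using mult_left_mono[OF sum_row_density_le[OF finJ assms(5-9), of T], of "c - 1"] assms(4)
    by (intro mult_left_mono) auto
  finally have "c powr s * real (card {x \<in> ?X. s \<le> real (card {l \<in> J. x l \<in> T})})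
      \<le> real (card ?X) * exp ((c - 1) * (real (card (T \<inter> U)) / \<rho>))" .
  hence "c powr (- s) * (c powr s * real (card {x \<in> ?X. s \<le> real (card {l \<in> J. x l \<in> T})}))
      \<le> c powr (- s) * (real (card ?X) * exp ((c - 1) * (real (card (T \<inter> U)) / \<rho>)))"
    by (intro mult_left_mono) auto
  moreover have "c powr (- s) * c powr s = 1"
    using assms(4) by (simp add: powr_minus)
  hence "c powr (- s) * (c powr s * y) = y" for y by (simp flip: mult.assoc)
  ultimately show ?thesis by (simp only: mult.assoc mult.commute[of "exp _"])
qed

text \<open>Union bound over the rows; a uniform choice from row \<open>l\<close> lies in
  \<open>T\<close> with probability equal to the density of \<open>T\<close> in that row.\<close>

lemma card_transversal_meets:
  fixes R :: "'i \<Rightarrow> 'a set"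
  assumes "finite I" "J \<subseteq> I" "\<And>l. l \<in> I \<Longrightarrow> finite (R l)"
    and "disjoint_family_on R J" "finite U" "\<And>l. l \<in> J \<Longrightarrow> R l \<subseteq> U"
    and "0 < \<rho>" "\<And>l. l \<in> J \<Longrightarrow> \<rho> \<le> real (card (R l))"
  shows "real (card {x \<in> PiE I R. \<exists>l\<in>J. x l \<in> T})
    \<le> real (card (T \<inter> U)) / \<rho> * real (card (PiE I R))"
proof -
  let ?X = "PiE I R"
  have finX: "finite ?X" using assms(1,3) by (intro finite_PiE) auto
  have finJ: "finite J" using assms(1,2) finite_subset by auto
  have one: "real (card {x \<in> ?X. x l \<in> T}) = real (card (T \<inter> R l)) / real (card (R l)) * real (card ?X)"
    if l: "l \<in> J" for l
  proof -
    have lI: "l \<in> I" using l assms(2) by auto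
    have pos: "0 < real (card (R l))" by (rule less_le_trans[OF assms(7) assms(8)[OF l]])
    have "{x \<in> ?X. x l \<in> T} = PiE I (R(l := T \<inter> R l))"
      using lI by (auto simp: PiE_def Pi_def split: if_splits)
    hence "card {x \<in> ?X. x l \<in> T} = card (T \<inter> R l) * (\<Prod>i\<in>I - {l}. card (R i))"
      using assms(1) lI by (simp add: card_PiE prod.remove[of I l])
    moreover have "card ?X = card (R l) * (\<Prod>i\<in>I - {l}. card (R i))"
      using assms(1) lI by (simp add: card_PiE prod.remove[of I l])
    ultimately show ?thesis using pos by simp
  qed
  have "{x \<in> ?X. \<exists>l\<in>J. x l \<in> T} = (\<Union>l\<in>J. {x \<in> ?X. x l \<in> T})" by auto
  hence "card {x \<in> ?X. \<exists>l\<in>J. x l \<in> T} \<le> (\<Sum>l\<in>J. card {x \<in> ?X. x l \<in> T})"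
    by (simp only: card_UN_le[OF finJ])
  hence "real (card {x \<in> ?X. \<exists>l\<in>J. x l \<in> T}) \<le> real (\<Sum>l\<in>J. card {x \<in> ?X. x l \<in> T})"
    by (rule of_nat_mono)
  also have "\<dots> = (\<Sum>l\<in>J. real (card (T \<inter> R l)) / real (card (R l))) * real (card ?X)"
    using one by (simp add: sum_distrib_right)
  also have "\<dots> \<le> real (card (T \<inter> U)) / \<rho> * real (card ?X)"
    using sum_row_density_le[OF finJ assms(4-8), of T] by (intro mult_right_mono) auto
  finally show ?thesis .
qed

section \<open>Random instances against a fixed seed\<close>

text \<open>Averaging over the seed. Measurability of \<open>E \<tau>\<close> comes from
  \<open>0 < c\<close>, since non-measurable sets have measure zero.\<close>

lemma exists_good_seed:
  assumes "prob_space M" "finite \<Omega>" "\<Omega> \<noteq> {}"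
    and E: "\<And>\<tau>. \<tau> \<in> \<Omega> \<Longrightarrow> E \<tau> \<subseteq> space M" "\<And>\<tau>. \<tau> \<in> \<Omega> \<Longrightarrow> c \<le> measure M (E \<tau>)" "0 < c"
  obtains (good) \<omega> where "\<omega> \<in> space M" "c * real (card \<Omega>) \<le> real (card {\<tau> \<in> \<Omega>. \<omega> \<in> E \<tau>})"
proof (rule ccontr)
  assume neg: "\<not> thesis"
  interpret prob_space M by fact
  let ?N = "\<lambda>\<omega>. real (card {\<tau> \<in> \<Omega>. \<omega> \<in> E \<tau>})"
  \<comment> \<open>The largest integer below the target. Counts are integers, so failure at every
    seed gives the uniform bound \<open>b\<close>, which preserves strictness under the
    integral.\<close>
  define b where "b = \<lceil>c * real (card \<Omega>)\<rceil> - 1"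
  have meas: "E \<tau> \<in> sets M" if "\<tau> \<in> \<Omega>" for \<tau>
    using E(2)[OF that] E(3) measure_notin_sets[of "E \<tau>" M] by fastforce
  have int: "integrable M (indicator (E \<tau>) :: _ \<Rightarrow> real)" if "\<tau> \<in> \<Omega>" for \<tau>
    using meas[OF that] by (intro integrable_real_indicator) (simp_all add: emeasure_eq_measure)
  have N: "?N \<omega> = (\<Sum>\<tau>\<in>\<Omega>. indicator (E \<tau>) \<omega>)" for \<omega>
    using assms(2) by (simp add: indicator_def sum.If_cases Int_def)
  have "?N \<omega> \<le> real_of_int b" if w: "\<omega> \<in> space M" for \<omega>
  proof -
    have "?N \<omega> < c * real (card \<Omega>)"
    proof (rule ccontr)
      assume "\<not> ?thesis"
      then have thesis by (intro good[OF w]) simp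
      with neg show False ..
    qed
    then have "int (card {\<tau> \<in> \<Omega>. \<omega> \<in> E \<tau>}) < \<lceil>c * real (card \<Omega>)\<rceil>"
      by (simp add: less_ceiling_iff)
    then have "int (card {\<tau> \<in> \<Omega>. \<omega> \<in> E \<tau>}) \<le> b" by (simp add: b_def)
    then show ?thesis by (metis of_int_le_iff of_int_of_nat_eq)
  qed
  hence "(\<integral>\<omega>. ?N \<omega> \<partial>M) \<le> (\<integral>\<omega>. real_of_int b \<partial>M)"
    unfolding N using int by (intro integral_mono Bochner_Integration.integrable_sum) auto
  also have "\<dots> = real_of_int b" by (simp add: prob_space)
  also have "\<dots> < c * real (card \<Omega>)" unfolding b_def by linarith
  also have "\<dots> = (\<Sum>\<tau>\<in>\<Omega>. c)" by simp
  also have "\<dots> \<le> (\<Sum>\<tau>\<in>\<Omega>. prob (E \<tau>))" by (intro sum_mono E(2))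
  also have "\<dots> = (\<integral>\<omega>. ?N \<omega> \<partial>M)"
    unfolding N using meas int by (subst Bochner_Integration.integral_sum) auto
  finally show False by simp
qed

text \<open>
  \<open>\<tau> j\<close> picks one element from each of the \<open>s\<close> rows of batch \<open>j\<close>. Rows may be shared between
  batches; the injectivity condition keeps the hidden sets of different batches disjoint.
\<close>

definition hidden_choices :: "nat \<Rightarrow> nat \<Rightarrow> (nat \<Rightarrow> nat \<Rightarrow> 'a set) \<Rightarrow> (nat \<Rightarrow> nat \<Rightarrow> 'a) set" where
  "hidden_choices t s R =
     {\<tau> \<in> PiE {..<t} (\<lambda>j. PiE {..<s} (R j)). \<forall>l<s. inj_on (\<lambda>j. \<tau> j l) {..<t}}"

definition hidden_sets :: "nat \<Rightarrow> nat \<Rightarrow> (nat \<Rightarrow> nat \<Rightarrow> 'a) \<Rightarrow> nat \<Rightarrow> 'a set" where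
  "hidden_sets t s \<tau> j = (if j < t then \<tau> j ` {..<s} else {})"

lemma finite_hidden_choices:
  "(\<And>j l. j < t \<Longrightarrow> l < s \<Longrightarrow> finite (R j l)) \<Longrightarrow> finite (hidden_choices t s R)"
  unfolding hidden_choices_def
  by (rule finite_subset[of _ "PiE {..<t} (\<lambda>j. PiE {..<s} (R j))"]) (auto intro!: finite_PiE)

text \<open>Conditioned on the other batches, the rows of batch \<open>j\<close> are still
  independent: the injectivity condition merely removes from each row the elements already taken
  there. This makes the product estimates for transversals applicable.\<close>

lemma hidden_choices_fiber:
  assumes "\<tau> \<in> hidden_choices t s R" "j < t"
  shows "{x. \<tau>(j := x) \<in> hidden_choices t s R}
       = PiE {..<s} (\<lambda>l. R j l - (\<lambda>i. \<tau> i l) ` ({..<t} - {j}))"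
proof -
  have "\<tau>(j := x) \<in> hidden_choices t s R \<longleftrightarrow>
      x \<in> PiE {..<s} (R j) \<and> (\<forall>l<s. inj_on (\<lambda>i. (\<tau>(j := x)) i l) {..<t})" for x
    using assms by (auto simp: hidden_choices_def PiE_def Pi_def extensional_def)
  moreover have "inj_on (\<lambda>i. (\<tau>(j := x)) i l) {..<t} \<longleftrightarrow> x l \<notin> (\<lambda>i. \<tau> i l) ` ({..<t} - {j})"
    if "l < s" for x l
  proof -
    have "inj_on (\<lambda>i. \<tau> i l) ({..<t} - {j})"
      using assms(1) that by (auto simp: hidden_choices_def intro: inj_on_subset)
    moreover have "{..<t} = insert j ({..<t} - {j})" using assms(2) by auto
    moreover have "inj_on (\<lambda>i. (\<tau>(j := x)) i l) ({..<t} - {j}) = inj_on (\<lambda>i. \<tau> i l) ({..<t} - {j})"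
      by (intro inj_on_cong) auto
    moreover have "(\<lambda>i. (\<tau>(j := x)) i l) ` ({..<t} - {j}) = (\<lambda>i. \<tau> i l) ` ({..<t} - {j})"
      by (intro image_cong) auto
    ultimately show ?thesis by (metis (no_types, lifting) Diff_idemp fun_upd_same inj_on_insert)
  qed
  ultimately show ?thesis by (auto simp: PiE_def Pi_def)
qed

lemma hidden_sets_fun_upd:
  "j < t \<Longrightarrow> hidden_sets t s (\<tau>(j := x)) = (hidden_sets t s \<tau>)(j := x ` {..<s})"
  by (auto simp: hidden_sets_def fun_eq_iff)

section \<open>Costs and outputs of an algorithm\<close>

lemma sum_increments_le:
  fixes g :: "nat \<Rightarrow> nat"
  assumes "mono g" "\<And>j. start j \<le> stop j" "\<And>j. stop j \<le> start (Suc j)"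
  shows "(\<Sum>j<t. g (stop j) - g (start j)) \<le> g (start t)"
proof (induction t)
  case (Suc t)
  have "g (start t) \<le> g (stop t)" "g (stop t) \<le> g (start (Suc t))"
    using assms by (auto intro: monoD)
  with Suc show ?case by simp
qed simp

lemma sum_batch_queries_le:
  assumes "amortized_query_complexity n M alg q" "problem_instance n V f us" "\<omega> \<in> space M"
    and "\<And>j. start j \<le> stop j" "\<And>j. stop j \<le> start (Suc j)" "start t \<le> n"
  shows "real (\<Sum>j<t. length (transcript (alg \<omega> V) f us (stop j))
                     - length (transcript (alg \<omega> V) f us (start j))) \<le> real n * q"
proof -
  have "(\<Sum>j<t. length (transcript (alg \<omega> V) f us (stop j)) - length (transcript (alg \<omega> V) f us (start j)))
      \<le> length (transcript (alg \<omega> V) f us (start t))"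
    by (rule sum_increments_le) (auto intro!: monoI length_transcript_mono assms)
  also have "\<dots> \<le> length (transcript (alg \<omega> V) f us n)"
    by (rule length_transcript_mono) fact
  also have "real \<dots> \<le> real n * q"
    using assms(1-3) by (auto simp: amortized_query_complexity_def)
  finally show ?thesis by simp
qed

lemma algorithm_queries_appeared:
  assumes "randomized_algorithm n k M alg" "problem_instance n V f us" "\<omega> \<in> space M" "i \<le> n"
    and "T \<in> fst ` set (transcript (alg \<omega> V) f us i)"
  shows "\<exists>r\<le>i. T \<subseteq> appeared (take r us)"
proof -
  obtain r where r: "1 \<le> r" "r \<le> i" "T \<in> fst ` set (comp_queries f (round_comp (alg \<omega> V) f us r))"
    using transcript_query_round[OF assms(5)] by blast
  then have "T \<subseteq> appeared (take r us)"
    using assms(1-4) unfolding randomized_algorithm_def by fastforce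
  then show ?thesis using r by blast
qed

lemma algorithm_solution:
  assumes "randomized_algorithm n k M alg" "problem_instance n V f us" "\<omega> \<in> space M" "1 \<le> i" "i \<le> n"
  shows "solution (alg \<omega> V) f us i \<subseteq> live (take i us)" "card (solution (alg \<omega> V) f us i) \<le> k"
  using assms unfolding randomized_algorithm_def by fastforce+

lemma good_seed_for_instances:
  assumes "randomized_algorithm n k M alg" "achieves_guarantee n k M alg \<gamma>"
    and "finite \<Omega>" "\<Omega> \<noteq> {}" "\<And>\<tau>. \<tau> \<in> \<Omega> \<Longrightarrow> problem_instance n V (f \<tau>) (us \<tau>)"
  obtains \<omega> where "\<omega> \<in> space M"
    "2 / 3 * real (card \<Omega>) \<le> real (card {\<tau> \<in> \<Omega>. \<forall>i\<in>{1..n}.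
       \<gamma> * OPT k (f \<tau>) (live (take i (us \<tau>))) \<le> f \<tau> (solution (alg \<omega> V) (f \<tau>) (us \<tau>) i)})"
proof -
  let ?E = "\<lambda>\<tau>. {\<omega> \<in> space M. \<forall>i\<in>{1..n}.
    \<gamma> * OPT k (f \<tau>) (live (take i (us \<tau>))) \<le> f \<tau> (solution (alg \<omega> V) (f \<tau>) (us \<tau>) i)}"
  have "prob_space M" using assms(1) by (auto simp: randomized_algorithm_def)
  show thesis
  proof (rule exists_good_seed[OF \<open>prob_space M\<close> assms(3,4), of ?E "2 / 3"])
    show "2 / 3 \<le> measure M (?E \<tau>)" if "\<tau> \<in> \<Omega>" for \<tau>
      using assms(2) assms(5)[OF that] by (auto simp: achieves_guarantee_def)
    fix \<omega> assume "\<omega> \<in> space M" "2 / 3 * real (card \<Omega>) \<le> real (card {\<tau> \<in> \<Omega>. \<omega> \<in> ?E \<tau>})"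
    then show thesis by (intro that[of \<omega>]) simp_all
  qed auto
qed

lemma le_OPT:
  assumes "finite W" "T \<subseteq> W" "card T \<le> k"
  shows "f T \<le> OPT k f W"
  unfolding OPT_def using assms by (intro Max_ge) auto

section \<open>Short streams\<close>

text \<open>The ratio 100 ensures that \<open>k\<close> elements of older batches are worth at most
  one percent of the newest hidden set, so the older choices may be known without helping. The
  function is modular.\<close>

definition geometric_weight :: "nat \<Rightarrow> (nat \<Rightarrow> nat set) \<Rightarrow> nat set \<Rightarrow> real" where
  "geometric_weight t H T = (\<Sum>j<t. 100 ^ j * real (card (T \<inter> H j)))"

lemma problem_instance_geometric_weight:
  assumes "finite V" "length us = n" "elem ` set us \<subseteq> V"
  shows "problem_instance n V (geometric_weight t H) us"
proof -
  have "mono_on (Pow V) (geometric_weight t H)"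
    unfolding geometric_weight_def using assms(1)
    by (intro mono_onI sum_mono mult_left_mono)
      (auto intro!: card_mono intro: finite_subset)
  moreover have "geometric_weight t H (S \<union> T) + geometric_weight t H (S \<inter> T)
      = geometric_weight t H S + geometric_weight t H T" if "S \<subseteq> V" "T \<subseteq> V" for S T
  proof -
    have "real (card ((S \<union> T) \<inter> H j)) + real (card (S \<inter> T \<inter> H j))
        = real (card (S \<inter> H j)) + real (card (T \<inter> H j))" for j
    proof -
      have "finite (S \<inter> H j)" "finite (T \<inter> H j)"
        using that assms(1) finite_subset by blast+
      from card_Un_Int[OF this] show ?thesis
        by (simp add: Int_Un_distrib2 flip: of_nat_add) (simp add: inf_sup_aci)
    qed
    then show ?thesis
      unfolding geometric_weight_def sum.distrib[symmetric] distrib_left[symmetric] by simp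
  qed
  ultimately show ?thesis
    using assms by (auto simp: problem_instance_def submodular_on_def geometric_weight_def intro!: sum_nonneg)
qed

lemma take_map_Insert_upt: "i \<le> n \<Longrightarrow> take i (map Insert [0..<n]) = map Insert [0..<i]"
  by (simp add: take_map take_upt)

lemma live_map_Insert: "live (map Insert xs) = set xs"
  by (simp add: live_def foldl_Insert)

text \<open>Only insertions occur: a batch consists of \<open>k\<close> pairs, and the hidden set
  takes one element of each. An output chosen without a query during the batch is independent of
  this choice and captures about \<open>k / 2\<close> hidden elements at most, whereas the guarantee
  demands \<open>0.584 k\<close> minus one percent for the older batches, hence more than
  \<open>0.57 k\<close>.\<close>

lemma query_needed_in_most_batches:
  fixes k n :: nat
  assumes k: "10000 \<le> k" "2 * k \<le> n"
    and alg: "randomized_algorithm n k M (alg :: real \<Rightarrow> nat set \<Rightarrow> nat strategy)"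
    and guar: "achieves_guarantee n k M alg 0.584"
    and cost: "amortized_query_complexity n M alg q"
  shows "real (n div (2 * k)) \<le> 2 * (real n * q)"
proof -
  define t where "t = n div (2 * k)"
  have t: "2 * k * t \<le> n" unfolding t_def by (metis div_times_less_eq_dividend mult.commute)
  define R where "R j l = {2 * (k * j + l), 2 * (k * j + l) + 1}" for j l :: nat
  define \<Omega> where "\<Omega> = hidden_choices t k R"
  define H where "H = (hidden_sets t k :: (nat \<Rightarrow> nat \<Rightarrow> nat) \<Rightarrow> nat \<Rightarrow> nat set)"
  define V where "V = {..<n}"
  define us where "us = map Insert [0..<n]"
  define f where "f h = geometric_weight t h" for h :: "nat \<Rightarrow> nat set"
  define start where "start j = 2 * k * j" for j
  define stop where "stop j = start (Suc j)" for j
  have R_sub: "R j l \<subseteq> {start j..<stop j}" if "l < k" for j l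
    using that by (auto simp: R_def start_def stop_def)
  have stop_le: "stop j \<le> n" if "j < t" for j
  proof -
    have "2 * k * Suc j \<le> 2 * k * t" using that by (intro mult_le_mono) auto
    then show ?thesis using t by (simp add: start_def stop_def)
  qed
  have start_mono: "start i \<le> start j" if "i \<le> j" for i j
    using that by (simp add: start_def)
  have inst: "problem_instance n V (f h) us" for h
    unfolding f_def by (rule problem_instance_geometric_weight) (auto simp: V_def us_def)
  have fin: "finite \<Omega>"
    unfolding \<Omega>_def by (rule finite_hidden_choices) (simp add: R_def)
  have "restrict (\<lambda>j. restrict (\<lambda>l. 2 * (k * j + l)) {..<k}) {..<t} \<in> \<Omega>"
    using k by (auto simp: \<Omega>_def hidden_choices_def R_def inj_on_def)
  hence ne: "\<Omega> \<noteq> {}" by auto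
  obtain \<omega> where \<omega>: "\<omega> \<in> space M"
    "2 / 3 * real (card \<Omega>) \<le> real (card {\<tau> \<in> \<Omega>. \<forall>i\<in>{1..n}.
       0.584 * OPT k (f (H \<tau>)) (live (take i us)) \<le> f (H \<tau>) (solution (alg \<omega> V) (f (H \<tau>)) us i)})"
    using good_seed_for_instances[OF alg guar fin ne, of V "\<lambda>\<tau>. f (H \<tau>)" "\<lambda>_. us"] inst by blast
  define A where "A = alg \<omega> V"
  define Succ where "Succ = {\<tau> \<in> \<Omega>. \<forall>i\<in>{1..n}.
       0.584 * OPT k (f (H \<tau>)) (live (take i us)) \<le> f (H \<tau>) (solution A (f (H \<tau>)) us i)}"
  define blind where "blind j \<tau> = f ((H \<tau>)(j := {}))" for j \<tau>
  define S where "S j \<tau> = solution A (blind j \<tau>) us (stop j)" for j \<tau>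
  define Hit where "Hit j = {\<tau> \<in> \<Omega>. 0.57 * real k \<le> real (card {l \<in> {..<k}. \<tau> j l \<in> S j \<tau>})}" for j
  define q' where "q' j \<tau> = length (transcript A (f (H \<tau>)) us (stop j))
                     - length (transcript A (f (H \<tau>)) us (start j))" for j \<tau>
  have sol: "solution A (f h) us i \<subseteq> {..<i}" "card (solution A (f h) us i) \<le> k" if "1 \<le> i" "i \<le> n" for h i
    using algorithm_solution[OF alg inst \<omega>(1) that, of h] that
    by (auto simp: A_def us_def take_map_Insert_upt live_map_Insert)
  have H_sub: "H \<tau> j \<subseteq> {start j..<stop j}" if "\<tau> \<in> \<Omega>" for \<tau> j
  proof
    fix y assume "y \<in> H \<tau> j"
    then obtain l where "j < t" "l < k" "y = \<tau> j l" by (auto simp: H_def hidden_sets_def split: if_splits)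
    with that have "y \<in> R j l" by (auto simp: \<Omega>_def hidden_choices_def)
    then show "y \<in> {start j..<stop j}" using R_sub[OF \<open>l < k\<close>] by blast
  qed
  have mem: "\<tau> j l \<in> R j l" if "\<tau> \<in> \<Omega>" "j < t" "l < k" for \<tau> j l
    using that by (auto simp: \<Omega>_def hidden_choices_def PiE_def Pi_def)
  have H_inj: "inj_on (\<tau> j) {..<k}" if "\<tau> \<in> \<Omega>" "j < t" for \<tau> j
  proof (rule inj_onI)
    fix l l' assume l: "l \<in> {..<k}" "l' \<in> {..<k}" "\<tau> j l = \<tau> j l'"
    have "\<tau> j l \<in> R j l" "\<tau> j l' \<in> R j l'"
      using mem[OF that, of l] mem[OF that, of l'] l(1,2) by simp_all
    then show "l = l'" using l(3) by (auto simp: R_def)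
  qed
  have Hit_small: "real (card (Hit j)) \<le> real (card \<Omega>) / 8" if j: "j < t" for j
  proof -
    have "real (card {\<tau> \<in> \<Omega>. 0.57 * real k \<le> real (card {l \<in> {..<k}. \<tau> j l \<in> S j \<tau>})})
        \<le> 1 / 8 * real (card \<Omega>)"
    proof (rule card_resample[OF fin, where j = j])
      fix \<tau> assume \<tau>: "\<tau> \<in> \<Omega>"
      have blind: "blind j (\<tau>(j := x)) = blind j \<tau>" for x
        using j by (simp add: blind_def H_def hidden_sets_fun_upd)
      let ?R = "\<lambda>l. R j l - (\<lambda>i. \<tau> i l) ` ({..<t} - {j})"
      \<comment> \<open>Here the rows of different batches are disjoint, so nothing is removed by
        conditioning.\<close>
      have R: "?R l = R j l" if l: "l < k" for l
      proof -
        have "\<tau> i l \<notin> R j l" if "i < t" "i \<noteq> j" for i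
        proof -
          have "\<tau> i l \<in> {start i..<start (Suc i)}"
            using subsetD[OF R_sub[OF l] mem[OF \<tau> that(1) l]] by (simp add: stop_def)
          moreover have "start (Suc i) \<le> start j \<or> start (Suc j) \<le> start i"
            using that start_mono[of "Suc i" j] start_mono[of "Suc j" i] by linarith
          ultimately have "\<tau> i l \<notin> {start j..<stop j}" by (auto simp: stop_def)
          then show ?thesis using R_sub[OF l, of j] by blast
        qed
        then show ?thesis by auto
      qed
      have fiber: "{x. \<tau>(j := x) \<in> \<Omega>} = PiE {..<k} (R j)"
      proof -
        have "PiE {..<k} ?R = PiE {..<k} (R j)" by (rule PiE_cong) (simp add: R)
        then show ?thesis using hidden_choices_fiber[OF \<tau>[unfolded \<Omega>_def] j] by (simp add: \<Omega>_def)
      qed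
      let ?U = "{start j..<stop j}"
      have "disjoint_family_on (R j) {..<k}"
        by (auto simp: disjoint_family_on_def R_def; presburger)
      have "real (card {x \<in> PiE {..<k} (R j). 0.57 * real k \<le> real (card {l \<in> {..<k}. x l \<in> S j \<tau>})})
        \<le> 1.1 powr (- (0.57 * real k)) * exp ((1.1 - 1) * (real (card (S j \<tau> \<inter> ?U)) / 2))
           * real (card (PiE {..<k} (R j)))"
        by (rule card_transversal_large) (use \<open>disjoint_family_on (R j) {..<k}\<close> R_sub in \<open>auto simp: R_def\<close>)
      also have "\<dots> \<le> 1 / 8 * real (card (PiE {..<k} (R j)))"
      proof (rule mult_right_mono)
        have "card (S j \<tau> \<inter> ?U) \<le> card (S j \<tau>)"
          using sol(1)[of "stop j"] stop_le[OF j] k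
          by (intro card_mono) (auto simp: S_def blind_def stop_def start_def intro: finite_subset)
        also have "\<dots> \<le> k"
          using sol(2)[of "stop j"] stop_le[OF j] k by (simp add: S_def blind_def stop_def start_def)
        finally have "exp ((1.1 - 1) * (real (card (S j \<tau> \<inter> ?U)) / 2)) \<le> exp (0.05 * real k)" by simp
        \<comment> \<open>With \<open>c = 1.1\<close> the gain \<open>0.57 * 0.09 = 0.0513\<close>
          per unit of \<open>k\<close> narrowly beats the loss \<open>0.1 / 2 = 0.05\<close>. The
          remaining \<open>0.0013 k\<close> is at least 13 for \<open>k \<ge> 10000\<close>.\<close>
        moreover have "1.1 powr (- (0.57 * real k)) \<le> exp (- (0.0513 * real k))"
        proof -
          have "0.09 \<le> ln (1.1 :: real)"
            using ln_one_plus_pos_lower_bound[of "0.1 :: real"] by (simp add: power2_eq_square)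
          then have "0.57 * real k * 0.09 \<le> 0.57 * real k * ln 1.1" by (intro mult_left_mono) auto
          then show ?thesis by (simp add: powr_def)
        qed
        ultimately have "1.1 powr (- (0.57 * real k)) * exp ((1.1 - 1) * (real (card (S j \<tau> \<inter> ?U)) / 2))
          \<le> exp (- (0.0513 * real k)) * exp (0.05 * real k)"
          by (intro mult_mono) auto
        also have "\<dots> = exp (- (0.0013 * real k))" by (simp flip: exp_add)
        also have "\<dots> \<le> exp (- 13)" using k by simp
        also have "\<dots> \<le> (1 / 8 :: real)"
          using exp_ge_add_one_self[of "13 :: real"] by (simp add: exp_minus field_simps)
        finally show "1.1 powr (- (0.57 * real k)) * exp ((1.1 - 1) * (real (card (S j \<tau> \<inter> ?U)) / 2)) \<le> 1 / 8" .
      qed simp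
      finally show "real (card {x. \<tau>(j := x) \<in> \<Omega> \<and>
            0.57 * real k \<le> real (card {l \<in> {..<k}. (\<tau>(j := x)) j l \<in> S j (\<tau>(j := x))})})
          \<le> 1 / 8 * real (card {x. \<tau>(j := x) \<in> \<Omega>})"
        using fiber by (simp add: S_def blind set_eq_iff)
    qed
    then show ?thesis by (simp add: Hit_def)
  qed
  have hit: "\<tau> \<in> Hit j" if \<tau>: "\<tau> \<in> Succ" and j: "j < t" and q0: "q' j \<tau> \<le> 0" for \<tau> j
  proof -
    have \<tau>': "\<tau> \<in> \<Omega>" using \<tau> by (simp add: Succ_def)
    let ?h = "H \<tau>"
    have stop: "1 \<le> stop j" "stop j \<le> n" using stop_le[OF j] k by (auto simp: stop_def start_def)
    have start_n: "start j \<le> n" using stop(2) start_mono[of j "Suc j"] by (simp add: stop_def)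
    have agree: "f ?h T = blind j \<tau> T" if T: "T \<in> fst ` set (transcript A (blind j \<tau>) us (start j))" for T
    proof -
      obtain r where "r \<le> start j" "T \<subseteq> appeared (take r us)"
        using algorithm_queries_appeared[OF alg inst \<omega>(1) start_n T[unfolded A_def blind_def]]
        by blast
      then have "T \<subseteq> {..<start j}"
        using appeared_subset_inserted[of "take r us"] start_n
        by (force simp: us_def take_map_Insert_upt)
      moreover have "{..<start j} \<inter> {start j..<stop j} = {}" by auto
      ultimately have "T \<inter> ?h j = {}" using H_sub[OF \<tau>', of j] by blast
      then show ?thesis
        unfolding f_def blind_def geometric_weight_def by (intro sum.cong) auto
    qed
    have pre: "transcript A (f ?h) us (start j) = transcript A (blind j \<tau>) us (start j)"
    proof (rule ccontr)
      assume "\<not> ?thesis"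
      from transcript_diff[OF this] agree show False by force
    qed
    have same: "transcript A (f ?h) us (stop j) = transcript A (blind j \<tau>) us (stop j)"
    proof (rule ccontr)
      assume "\<not> ?thesis"
      from transcript_diff[OF this] obtain m where m:
        "m < length (transcript A (blind j \<tau>) us (stop j))" "m < length (transcript A (f ?h) us (stop j))"
        "f ?h (fst (transcript A (blind j \<tau>) us (stop j) ! m))
           \<noteq> blind j \<tau> (fst (transcript A (blind j \<tau>) us (stop j) ! m))" by blast
      \<comment> \<open>The disagreement occurs within the actual run, which asks nothing during the
        batch; so it already occurs before the batch, where \<open>agree\<close> excludes
        it.\<close>
      have m': "m < length (transcript A (blind j \<tau>) us (start j))"
        using m(2) q0 pre by (simp add: q'_def)
      obtain ys where "transcript A (blind j \<tau>) us (stop j) = transcript A (blind j \<tau>) us (start j) @ ys"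
        using transcript_prefix[of "start j" "stop j" A "blind j \<tau>" us] start_mono[of j "Suc j"]
        by (auto simp: stop_def)
      then have "transcript A (blind j \<tau>) us (stop j) ! m \<in> set (transcript A (blind j \<tau>) us (start j))"
        using m' by (simp add: nth_append)
      then show False using agree m(3) by blast
    qed
    have S: "solution A (f ?h) us (stop j) = S j \<tau>"
      unfolding S_def by (rule solution_eq[OF same stop(1)])
    have S_sub: "S j \<tau> \<subseteq> {..<stop j}" and S_card: "card (S j \<tau>) \<le> k"
      using sol[OF stop, of ?h] by (simp_all add: S)
    have finS: "finite (S j \<tau>)" using S_sub finite_subset by blast
    have live: "live (take (stop j) us) = {..<stop j}"
      using stop by (auto simp: us_def take_map_Insert_upt live_map_Insert)
    have "100 ^ j * real k = 100 ^ j * real (card (?h j \<inter> ?h j))"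
      using H_inj[OF \<tau>' j] j by (simp add: H_def hidden_sets_def card_image)
    also have "\<dots> \<le> f ?h (?h j)"
      unfolding f_def geometric_weight_def using j
      by (intro member_le_sum[where f = "\<lambda>i. 100 ^ i * real (card (?h j \<inter> ?h i))"]) auto
    also have "\<dots> \<le> OPT k (f ?h) {..<stop j}"
      using H_sub[OF \<tau>', of j] H_inj[OF \<tau>' j] j
      by (intro le_OPT) (auto simp: H_def hidden_sets_def card_image)
    finally have opt: "100 ^ j * real k \<le> OPT k (f ?h) {..<stop j}" .
    have "0.584 * OPT k (f ?h) {..<stop j} \<le> f ?h (S j \<tau>)"
    proof -
      have "stop j \<in> {1..n}" using stop by simp
      with \<tau> have "0.584 * OPT k (f ?h) (live (take (stop j) us)) \<le> f ?h (solution A (f ?h) us (stop j))"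
        unfolding Succ_def by blast
      then show ?thesis by (simp only: S live)
    qed
    moreover have "0.584 * (100 ^ j * real k) \<le> 0.584 * OPT k (f ?h) {..<stop j}"
      using opt by (intro mult_left_mono) auto
    ultimately have "0.584 * (100 ^ j * real k) \<le> f ?h (S j \<tau>)" by (rule order_trans[rotated])
    also have "f ?h (S j \<tau>) \<le> 100 ^ j * real (card (S j \<tau> \<inter> ?h j)) + 100 ^ j / 100 * real k"
    proof -
      have split: "f ?h (S j \<tau>) = 100 ^ j * real (card (S j \<tau> \<inter> ?h j))
          + (\<Sum>i\<in>{..<t} - {j}. 100 ^ i * real (card (S j \<tau> \<inter> ?h i)))"
        unfolding f_def geometric_weight_def using j by (intro sum.remove) auto
      have "(\<Sum>i\<in>{..<t} - {j}. 100 ^ i * real (card (S j \<tau> \<inter> ?h i)))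
          \<le> (\<Sum>i\<in>{..<t} - {j}. 100 ^ j / 100 * real (card (S j \<tau> \<inter> ?h i)))"
      proof (rule sum_mono)
        fix i assume i: "i \<in> {..<t} - {j}"
        show "100 ^ i * real (card (S j \<tau> \<inter> ?h i)) \<le> 100 ^ j / 100 * real (card (S j \<tau> \<inter> ?h i))"
        proof (cases "i < j")
          case True
          have "(100 :: real) ^ Suc i \<le> 100 ^ j" using True by (intro power_increasing) auto
          then show ?thesis by (intro mult_right_mono) auto
        next
          case False
          then have "stop j \<le> start i" using i start_mono[of "Suc j" i] by (simp add: stop_def)
          then have "{..<stop j} \<inter> {start i..<stop i} = {}" by auto
          then have "S j \<tau> \<inter> ?h i = {}" using S_sub H_sub[OF \<tau>', of i] by blast
          then show ?thesis by simp
        qed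
      qed
      also have "\<dots> = 100 ^ j / 100 * real (\<Sum>i\<in>{..<t} - {j}. card (S j \<tau> \<inter> ?h i))"
        by (simp add: sum_distrib_left)
      finally have others: "(\<Sum>i\<in>{..<t} - {j}. 100 ^ i * real (card (S j \<tau> \<inter> ?h i)))
          \<le> 100 ^ j / 100 * real (\<Sum>i\<in>{..<t} - {j}. card (S j \<tau> \<inter> ?h i))" .
      have "(\<Sum>i\<in>{..<t} - {j}. card (S j \<tau> \<inter> ?h i)) = card (\<Union>i\<in>{..<t} - {j}. S j \<tau> \<inter> ?h i)"
      proof (rule card_UN_disjoint[symmetric])
        have "?h i \<inter> ?h i' = {}" if "i \<noteq> i'" for i i'
        proof -
          have "{start i..<stop i} \<inter> {start i'..<stop i'} = {}"
            using start_mono[of "Suc i" i'] start_mono[of "Suc i'" i] that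
            by (cases "i < i'") (auto simp: stop_def)
          then show ?thesis using H_sub[OF \<tau>', of i] H_sub[OF \<tau>', of i'] by blast
        qed
        then show "\<forall>i\<in>{..<t} - {j}. \<forall>i'\<in>{..<t} - {j}. i \<noteq> i' \<longrightarrow> S j \<tau> \<inter> ?h i \<inter> (S j \<tau> \<inter> ?h i') = {}"
          by blast
      qed (use finS in auto)
      also have "\<dots> \<le> card (S j \<tau>)" by (rule card_mono[OF finS]) auto
      finally have "(\<Sum>i\<in>{..<t} - {j}. card (S j \<tau> \<inter> ?h i)) \<le> k" using S_card by simp
      then have "100 ^ j / 100 * real (\<Sum>i\<in>{..<t} - {j}. card (S j \<tau> \<inter> ?h i)) \<le> 100 ^ j / 100 * real k"
        by (intro mult_left_mono of_nat_mono) auto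
      then show ?thesis using split others by linarith
    qed
    finally have bound: "0.584 * (100 ^ j * real k)
        \<le> 100 ^ j * real (card (S j \<tau> \<inter> ?h j)) + 100 ^ j / 100 * real k" .
    have "card (S j \<tau> \<inter> ?h j) \<le> card {l \<in> {..<k}. \<tau> j l \<in> S j \<tau>}"
    proof -
      have "S j \<tau> \<inter> ?h j = \<tau> j ` {l \<in> {..<k}. \<tau> j l \<in> S j \<tau>}"
        using j by (auto simp: H_def hidden_sets_def)
      then show ?thesis by (simp add: card_image_le)
    qed
    moreover have "100 ^ j * (0.584 * real k)
        \<le> 100 ^ j * (real (card (S j \<tau> \<inter> ?h j)) + real k / 100)"
      using bound by (simp add: algebra_simps)
    then have "0.584 * real k \<le> real (card (S j \<tau> \<inter> ?h j)) + real k / 100"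
      by (subst (asm) mult_le_cancel_left_pos) auto
    ultimately have "0.584 * real k \<le> real (card {l \<in> {..<k}. \<tau> j l \<in> S j \<tau>}) + real k / 100"
      by linarith
    then show ?thesis using \<tau>' by (simp add: Hit_def)
  qed
  have "real (0 + 1) * real t \<le> 2 * (real n * q)"
  proof (rule batch_counting[OF fin ne, where Succ = Succ and Bad = "{}" and Hit = Hit and q = q'])
    show "2 / 3 * real (card \<Omega>) \<le> real (card Succ)" using \<omega>(2) by (simp add: Succ_def A_def)
    show "real (\<Sum>j<t. q' j \<tau>) \<le> real n * q" if "\<tau> \<in> \<Omega>" for \<tau>
      unfolding q'_def A_def
      by (rule sum_batch_queries_le[OF cost inst \<omega>(1)])
        (use t start_mono in \<open>auto simp: stop_def start_def\<close>)
  qed (use Hit_small hit in \<open>auto simp: Succ_def Hit_def\<close>)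
  then show ?thesis by (simp add: t_def)
qed

section \<open>The hard function\<close>

text \<open>
  \<open>alpha\<close> and \<open>beta\<close> are the shares of the optimum in the long-lived ground set and in the current
  batch. Together with \<open>rate\<close> they nearly maximize the minimum over \<open>x \<in> {0..1}\<close> bounded below in
  \<open>generic_solution_bound\<close>; the optimal choice gives only about \<open>0.41615\<close>, so that
  \<open>1 - 0.41615\<close> is barely below \<open>0.584\<close>, and \<open>cutoff\<close> has to fit into the difference.
\<close>

definition alpha :: real where "alpha = 11 / 20"
definition beta :: real where "beta = 9 / 20"
definition rate :: real where "rate = 7566 / 10000"
definition cutoff :: real where "cutoff = 1 / 10000"
text \<open>Intersections with a hidden set of at most \<open>slack * k\<close> elements go
  unnoticed. On a complete batch part the linear piece drops to at most
  \<open>slack / beta = cutoff / 2\<close>, and the other half of \<open>cutoff\<close> absorbs the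
  rounding of \<open>beta * k\<close>.\<close>

definition slack :: real where "slack = cutoff * beta / 2"
text \<open>Both \<open>rate * 20\<close> and \<open>20 / beta\<close> exceed 15, and
  \<open>exp 15 > 10000\<close>; so \<open>20 k\<close> generic elements push the respective
  exponential below \<open>cutoff\<close>.\<close>

definition saturation :: real where "saturation = 20"
text \<open>What the full ground part of a hidden set leaves over. Only this share can be removed by
  batch elements, which is what couples the two parts in \<open>batch_factor\<close>.\<close>

definition hidden_share :: real where "hidden_share = exp_linear slack rate alpha"

lemma hidden_share_bounds: "0 \<le> hidden_share" "hidden_share \<le> 58389 / 100000"
proof -
  have "hidden_share = exp (- rate * slack) * (1 - rate * (alpha - slack))"
    by (simp add: hidden_share_def exp_linear_def alpha_def slack_def cutoff_def beta_def)
  moreover have "0 \<le> 1 - rate * (alpha - slack)" "1 - rate * (alpha - slack) \<le> 58389 / 100000"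
    by (simp_all add: rate_def alpha_def slack_def cutoff_def beta_def)
  moreover have "exp (- rate * slack) \<le> 1"
    by (simp add: rate_def slack_def cutoff_def beta_def)
  ultimately show "0 \<le> hidden_share" "hidden_share \<le> 58389 / 100000"
    using mult_right_mono[of "exp (- rate * slack)" 1 "1 - rate * (alpha - slack)"]
      mult_nonneg_nonneg[of "exp (- rate * slack)" "1 - rate * (alpha - slack)"] by auto
qed

text \<open>Taylor polynomials with remainder \<open>3 / fact 10 < 10^-6\<close>. The exponent
  \<open>0.41613\<close> is \<open>rate * alpha\<close>, the ground part of a generic solution with
  batch share \<open>beta\<close>.\<close>

lemma exp_minus_one_lower: "36787 / 100000 \<le> exp (- 1 :: real)"
  and exp_minus_41613_lower: "65959 / 100000 \<le> exp (- (41613 / 100000) :: real)"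
  and exp_minus_one_upper: "exp (- 1 :: real) \<le> 36789 / 100000"
proof -
  have bound: "\<bar>exp x - (\<Sum>m<10. x ^ m / fact m)\<bar> \<le> 3 / fact 10" if x: "\<bar>x\<bar> \<le> 1" for x :: real
  proof -
    obtain t where t: "\<bar>t\<bar> \<le> \<bar>x\<bar>" "exp x = (\<Sum>m<10. x ^ m / fact m) + exp t / fact 10 * x ^ 10"
      using Maclaurin_exp_le[of x 10] by blast
    have "exp t \<le> exp 1" using t(1) x by simp
    then have "exp t \<le> 3" using exp_le by linarith
    moreover have "\<bar>x ^ 10\<bar> \<le> 1" unfolding power_abs using x by (intro power_le_one) auto
    ultimately have "exp t * \<bar>x ^ 10\<bar> \<le> 3 * 1" by (intro mult_mono) auto
    then show ?thesis using t(2) by (simp add: abs_mult divide_right_mono)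
  qed
  show "36787 / 100000 \<le> exp (- 1 :: real)" "exp (- 1 :: real) \<le> 36789 / 100000"
    using bound[of "- 1"] unfolding abs_le_iff by (simp_all add: field_simps lessThan_nat_numeral lessThan_Suc fact_numeral)
  show "65959 / 100000 \<le> exp (- (41613 / 100000) :: real)"
    using bound[of "- (41613 / 100000)"] unfolding abs_le_iff by (simp add: field_simps lessThan_nat_numeral lessThan_Suc fact_numeral)
qed

lemma generic_solution_bound:
  assumes "0 \<le> x" "x \<le> 1"
  shows "41608 / 100000 \<le> exp (- rate * (1 - x)) * (1 - hidden_share + hidden_share * exp (- x / beta))"
proof -
  \<comment> \<open>The right-hand side is \<open>c\<^sub>1 exp (rate x) + c\<^sub>2 exp (- (1 / beta - rate) x)\<close>, which is convex with minimum
    very close to \<open>x = beta\<close>. Both exponentials are bounded by their tangents there.\<close>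
  define u where "u = x - beta"
  define v :: real where "v = 58389 / 100000"
  let ?e = "exp (- (41613 / 100000)) :: real"
  have u: "- 9 / 20 \<le> u" "u \<le> 11 / 20" using assms by (auto simp: u_def beta_def)
  have r: "- rate * (1 - x) = - (41613 / 100000) + rate * u"
    by (simp add: u_def rate_def beta_def field_simps)
  have s: "- rate * (1 - x) + - x / beta = - (41613 / 100000) + - 1 + - (1 / beta - rate) * u"
    by (simp add: u_def rate_def beta_def field_simps)
  have tangent: "(1 - v) * (1 + rate * u) + v * (exp (- 1) * (1 + - (1 / beta - rate) * u))
      \<le> (1 - v) * exp (rate * u) + v * (exp (- 1) * exp (- (1 / beta - rate) * u))"
    by (intro add_mono mult_left_mono exp_ge_add_one_self) (auto simp: v_def)
  have linear: "63085 / 100000 \<le> (1 - v) * (1 + rate * u) + v * (exp (- 1) * (1 + - (1 / beta - rate) * u))"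
  proof -
    define c :: real where "c = v * exp (- 1)"
    have c: "v * (36787 / 100000) \<le> c" "c \<le> v * (36789 / 100000)"
      unfolding c_def by (intro mult_left_mono exp_minus_one_lower exp_minus_one_upper; simp add: v_def)+
    define d where "d = (1 - v) * rate - c * (1 / beta - rate)"
    \<comment> \<open>\<open>d\<close> is the slope at \<open>beta\<close> and nearly vanishes
      because \<open>rate\<close> was chosen to put the minimum there; the linear term therefore
      costs less than \<open>0.00003\<close>.\<close>
    have "- (1 / 20000) \<le> d" "d \<le> 1 / 20000"
      using c by (auto simp: d_def v_def rate_def beta_def)
    then have "\<bar>d\<bar> * \<bar>u\<bar> \<le> 1 / 20000 * (11 / 20)"
      using u by (intro mult_mono) auto
    then have "- (1 / 20000 * (11 / 20)) \<le> d * u"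
      unfolding abs_mult[symmetric] by (simp add: abs_le_iff)
    moreover have "(1 - v) * (1 + rate * u) + v * (exp (- 1) * (1 + - (1 / beta - rate) * u)) = (1 - v) + c + d * u"
      by (simp add: c_def d_def algebra_simps)
    ultimately show ?thesis using c(1) by (simp add: v_def)
  qed
  have "41608 / 100000 \<le> 65959 / 100000 * (63085 / 100000 :: real)" by simp
  also have "\<dots> \<le> ?e * ((1 - v) * exp (rate * u) + v * (exp (- 1) * exp (- (1 / beta - rate) * u)))"
    using order_trans[OF linear tangent] by (intro mult_mono exp_minus_41613_lower) auto
  also have "\<dots> = exp (- rate * (1 - x)) * (1 - v) + v * exp (- rate * (1 - x) + - x / beta)"
    unfolding s unfolding r exp_add by (simp add: algebra_simps)
  also have "\<dots> = exp (- rate * (1 - x)) * (1 - v * (1 - exp (- x / beta)))"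
    unfolding exp_add by (simp add: algebra_simps)
  \<comment> \<open>The expression decreases in the share, so the rational upper bound
    \<open>v\<close> may stand in for \<open>hidden_share\<close>.\<close>
  also have "\<dots> \<le> exp (- rate * (1 - x)) * (1 - hidden_share * (1 - exp (- x / beta)))"
    using hidden_share_bounds(2) assms
    by (intro mult_left_mono diff_left_mono mult_right_mono) (auto simp: v_def beta_def)
  finally show ?thesis by (simp add: algebra_simps)
qed

lemma exp_saturation: "exp (- rate * saturation) \<le> cutoff" "exp (- (1 / beta) * saturation) \<le> cutoff"
proof -
  have "(10000 :: real) \<le> 2 ^ 15" by simp
  also have "\<dots> \<le> exp 1 ^ 15"
    using exp_ge_add_one_self[of "1 :: real"] by (intro power_mono) auto
  also have "\<dots> = exp 15" by (simp flip: exp_of_nat_mult)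
  finally have "exp (- 15 :: real) \<le> cutoff" by (simp add: exp_minus cutoff_def field_simps)
  moreover have "exp (- rate * saturation) \<le> exp (- 15)" "exp (- (1 / beta) * saturation) \<le> exp (- 15)"
    by (simp_all add: rate_def beta_def saturation_def)
  ultimately show "exp (- rate * saturation) \<le> cutoff" "exp (- (1 / beta) * saturation) \<le> cutoff"
    by linarith+
qed

lemma slack_pos: "0 < slack" and rate_pos: "0 < rate" and beta_pos: "0 < beta"
  and cutoff_pos: "0 < cutoff" and cutoff_le_1: "cutoff \<le> 1"
  by (simp_all add: slack_def cutoff_def beta_def rate_def)

text \<open>
  If \<open>H\<close> is empty, the ground elements and the batch elements act symmetrically. The truncation at
  \<open>cutoff\<close> makes the batch part constant for sets with many batch elements, whose intersection with
  \<open>H\<close> cannot be kept small.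
\<close>

definition batch_factor :: "nat \<Rightarrow> 'a set \<Rightarrow> 'a set \<Rightarrow> 'a set \<Rightarrow> 'a set \<Rightarrow> real" where
  "batch_factor k A B H T =
     exp_linear slack rate (real (card (T \<inter> (H \<inter> A))) / real k) - hidden_share
     + hidden_share * max cutoff
         (exp (- (1 / beta) * (real (card (T \<inter> (B - H))) / real k))
          * exp_linear slack (1 / beta) (real (card (T \<inter> (H \<inter> B))) / real k))"

text \<open>Ground elements in no hidden set enter through the common exponential, those of
  \<open>H j\<close> through the factor of batch \<open>j\<close>. As long as a factor is still
  exponential, both kinds count alike.\<close>

definition residual :: "nat \<Rightarrow> nat \<Rightarrow> 'a set \<Rightarrow> (nat \<Rightarrow> 'a set) \<Rightarrow> (nat \<Rightarrow> 'a set) \<Rightarrow> 'a set \<Rightarrow> real" where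
  "residual k t A B H T =
     exp (- rate * (real (card (T \<inter> (A - (\<Union>j<t. H j)))) / real k))
     * (\<Prod>j<t. batch_factor k A (B j) (H j) T)"

text \<open>The outer truncation makes the value constant on sets with at least
  \<open>saturation * k\<close> ground elements. Such sets could meet every hidden set, but then
  reveal nothing.\<close>

definition hard_function :: "nat \<Rightarrow> nat \<Rightarrow> 'a set \<Rightarrow> (nat \<Rightarrow> 'a set) \<Rightarrow> (nat \<Rightarrow> 'a set) \<Rightarrow> 'a set \<Rightarrow> real" where
  "hard_function k t A B H T = min (1 - residual k t A B H T) (1 - cutoff)"

text \<open>
  An exhaustive list of the situations in which the answer to the query \<open>T\<close> can depend on the hidden
  set. Without batch elements only a substantial part of \<open>H\<close> in the ground set is visible, since
  \<open>exp_linear\<close> starts out exponentially; in the presence of batch elements a single ground element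
  of \<open>H\<close> suffices.
\<close>

definition reveals :: "nat \<Rightarrow> 'a set \<Rightarrow> 'a set \<Rightarrow> 'a set \<Rightarrow> 'a set \<Rightarrow> bool" where
  "reveals k A B H T \<longleftrightarrow>
     real (card (T \<inter> A)) < saturation * real k \<and>
     (slack * real k < real (card (T \<inter> (H \<inter> A))) \<or>
      T \<inter> B \<noteq> {} \<and>
        (T \<inter> (H \<inter> A) \<noteq> {} \<or>
         real (card (T \<inter> B)) < saturation * real k \<and> slack * real k < real (card (T \<inter> (H \<inter> B)))))"

section \<open>Structure and values of the hard function\<close>

lemma convex_on_exp_scaled: "convex_on UNIV (\<lambda>x. exp (c * x) :: real)"
proof (rule convex_onI)
  fix s x y :: real assume "0 < s" "s < 1"
  then show "exp (c * ((1 - s) *\<^sub>R x + s *\<^sub>R y)) \<le> (1 - s) * exp (c * x) + s * exp (c * y)"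
    using convex_onD[OF exp_convex, of s "c * x" "c * y"] by (simp add: algebra_simps)
qed auto

lemma decreasing_supermodular_on_exp_card:
  assumes "finite X" "c \<le> 0"
  shows "decreasing_supermodular_on V (\<lambda>S. exp (c * (real (card (S \<inter> X)) / real k)))"
  by (rule decreasing_supermodular_on_card[where h = "\<lambda>x. exp (c * x)"])
    (use assms in \<open>auto intro!: convex_on_exp_scaled antimonoI mult_left_mono_neg\<close>)

text \<open>The cardinality bounds secure nonnegativity: up to \<open>alpha * k\<close> hidden
  ground elements the first term stays above \<open>hidden_share\<close>, and up to
  \<open>beta * k\<close> hidden batch elements the linear piece stays above zero.\<close>

lemma decreasing_supermodular_on_batch_factor:
  assumes "finite A" "finite B"
    and "real (card (H \<inter> A)) \<le> alpha * real k" "real (card (H \<inter> B)) \<le> beta * real k" "0 < k"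
  shows "decreasing_supermodular_on V (batch_factor k A B H)"
  unfolding batch_factor_def
proof (intro decreasing_supermodular_on_add_scaled decreasing_supermodular_on_max
    decreasing_supermodular_on_mult)
  have hidden: "hidden_share \<le> exp_linear slack rate (real (card (S \<inter> (H \<inter> A))) / real k)" for S
  proof -
    have "card (S \<inter> (H \<inter> A)) \<le> card (H \<inter> A)" using assms(1) by (intro card_mono) auto
    then have "real (card (S \<inter> (H \<inter> A))) / real k \<le> alpha" using assms(3,5) by (simp add: field_simps)
    then show ?thesis
      unfolding hidden_share_def using rate_pos by (intro antimonoD[OF antimono_exp_linear]) auto
  qed
  then show "hidden_share \<le> exp_linear slack rate (real (card (S \<inter> (H \<inter> A))) / real k)" for S .
  show "decreasing_supermodular_on V (\<lambda>S. exp_linear slack rate (real (card (S \<inter> (H \<inter> A))) / real k))"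
    using rate_pos assms(1) hidden[of UNIV] hidden_share_bounds(1)
    by (intro decreasing_supermodular_on_card convex_on_exp_linear antimono_exp_linear) auto
  show "decreasing_supermodular_on V (\<lambda>S. exp (- (1 / beta) * (real (card (S \<inter> (B - H))) / real k)))"
    using assms(2) beta_pos by (intro decreasing_supermodular_on_exp_card) auto
  have "0 \<le> exp_linear slack (1 / beta) beta"
    using beta_pos slack_pos by (simp add: exp_linear_def field_simps)
  also have "\<dots> \<le> exp_linear slack (1 / beta) (real (card (H \<inter> B)) / real k)"
    using beta_pos assms(4,5) by (intro antimonoD[OF antimono_exp_linear]) (auto simp: field_simps)
  finally show "decreasing_supermodular_on V (\<lambda>S. exp_linear slack (1 / beta) (real (card (S \<inter> (H \<inter> B))) / real k))"
    using beta_pos assms(2)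
    by (intro decreasing_supermodular_on_card convex_on_exp_linear antimono_exp_linear) auto
  show "0 \<le> hidden_share" by (rule hidden_share_bounds)
qed

lemma decreasing_supermodular_on_residual:
  assumes "finite A" "\<And>j. j < t \<Longrightarrow> finite (B j)" "0 < k"
    and "\<And>j. j < t \<Longrightarrow> real (card (H j \<inter> A)) \<le> alpha * real k"
    and "\<And>j. j < t \<Longrightarrow> real (card (H j \<inter> B j)) \<le> beta * real k"
  shows "decreasing_supermodular_on V (residual k t A B H)"
  unfolding residual_def using assms rate_pos
  by (intro decreasing_supermodular_on_mult decreasing_supermodular_on_prod
      decreasing_supermodular_on_exp_card decreasing_supermodular_on_batch_factor) auto

lemma batch_factor_bounds:
  assumes "finite A" "finite B" "0 < k"
    and "real (card (H \<inter> A)) \<le> alpha * real k" "real (card (H \<inter> B)) \<le> beta * real k"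
  shows "0 \<le> batch_factor k A B H T"
    and "batch_factor k A B H T \<le> 1"
    and "batch_factor k A B H T \<le> exp (- rate * (real (card (T \<inter> (H \<inter> A))) / real k))"
proof -
  note D = decreasing_supermodular_onD[OF decreasing_supermodular_on_batch_factor
      [OF assms(1,2,4,5,3), of UNIV]]
  show "0 \<le> batch_factor k A B H T" by (rule D) simp
  have "batch_factor k A B H T \<le> batch_factor k A B H {}" by (rule D) auto
  also have "\<dots> \<le> 1"
    using slack_pos cutoff_le_1 by (simp add: batch_factor_def exp_linear_0)
  finally show "batch_factor k A B H T \<le> 1" .
  have "exp (- (1 / beta) * (real (card (T \<inter> (B - H))) / real k))
        * exp_linear slack (1 / beta) (real (card (T \<inter> (H \<inter> B))) / real k) \<le> 1 * 1"
  proof (rule mult_mono)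
    have "0 \<le> exp_linear slack (1 / beta) beta"
      using beta_pos slack_pos by (simp add: exp_linear_def field_simps)
    also have "\<dots> \<le> exp_linear slack (1 / beta) (real (card (T \<inter> (H \<inter> B))) / real k)"
    proof (rule antimonoD[OF antimono_exp_linear])
      have "card (T \<inter> (H \<inter> B)) \<le> card (H \<inter> B)" using assms(2) by (intro card_mono) auto
      then show "real (card (T \<inter> (H \<inter> B))) / real k \<le> beta"
        using assms(3,5) by (simp add: field_simps)
    qed (use beta_pos in simp)
    finally show "0 \<le> exp_linear slack (1 / beta) (real (card (T \<inter> (H \<inter> B))) / real k)" .
  qed (use beta_pos slack_pos in \<open>auto intro!: exp_linear_le_1\<close>)
  then have "hidden_share * max cutoff (exp (- (1 / beta) * (real (card (T \<inter> (B - H))) / real k))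
        * exp_linear slack (1 / beta) (real (card (T \<inter> (H \<inter> B))) / real k)) \<le> hidden_share * 1"
    using cutoff_le_1 hidden_share_bounds(1) by (intro mult_left_mono) auto
  then show "batch_factor k A B H T \<le> exp (- rate * (real (card (T \<inter> (H \<inter> A))) / real k))"
    using exp_linear_le_exp[of rate slack "real (card (T \<inter> (H \<inter> A))) / real k"] rate_pos
    unfolding batch_factor_def by linarith
qed

lemma card_split_hidden:
  assumes "finite A" "finite J" "disjoint_family_on (\<lambda>j. H j \<inter> A) J"
  shows "card (T \<inter> (A - (\<Union>j\<in>J. H j))) + (\<Sum>j\<in>J. card (T \<inter> (H j \<inter> A))) = card (T \<inter> A)"
proof -
  have "(\<Sum>j\<in>J. card (T \<inter> (H j \<inter> A))) = card (\<Union>j\<in>J. T \<inter> (H j \<inter> A))"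
    using assms by (intro card_UN_disjoint[symmetric]) (auto simp: disjoint_family_on_def)
  moreover have "card (T \<inter> (A - (\<Union>j\<in>J. H j)) \<union> (\<Union>j\<in>J. T \<inter> (H j \<inter> A)))
      = card (T \<inter> (A - (\<Union>j\<in>J. H j))) + card (\<Union>j\<in>J. T \<inter> (H j \<inter> A))"
    using assms(1,2) by (intro card_Un_disjoint) auto
  moreover have "T \<inter> (A - (\<Union>j\<in>J. H j)) \<union> (\<Union>j\<in>J. T \<inter> (H j \<inter> A)) = T \<inter> A" by auto
  ultimately show ?thesis by simp
qed

lemma exp_card_split:
  fixes c :: real
  assumes "finite A" "finite J" "disjoint_family_on (\<lambda>j. H j \<inter> A) J"
  shows "exp (c * (real (card (T \<inter> (A - (\<Union>j\<in>J. H j)))) / real k))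
      * (\<Prod>j\<in>J. exp (c * (real (card (T \<inter> (H j \<inter> A))) / real k)))
    = exp (c * (real (card (T \<inter> A)) / real k))"
  using assms(2)
  by (simp add: card_split_hidden[OF assms, symmetric] exp_sum[symmetric] exp_add[symmetric]
      sum_distrib_left[symmetric] sum_divide_distrib[symmetric] add_divide_distrib algebra_simps)

text \<open>Cardinalities are bounded only from above, so the family in which one set is erased is
  again an instance.\<close>

locale hidden_family =
  fixes k t :: nat and A :: "'a set" and B :: "nat \<Rightarrow> 'a set" and H :: "nat \<Rightarrow> 'a set"
  assumes k_pos: "0 < k" and finite_A: "finite A" and finite_B: "j < t \<Longrightarrow> finite (B j)"
    and disjoint_H: "disjoint_family_on (\<lambda>j. H j \<inter> A) {..<t}"
    and card_HA: "j < t \<Longrightarrow> real (card (H j \<inter> A)) \<le> alpha * real k"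
    and card_HB: "j < t \<Longrightarrow> real (card (H j \<inter> B j)) \<le> beta * real k"
begin

lemma hidden_family_erase: "hidden_family k t A B (H(j := {}))"
  using k_pos finite_A finite_B disjoint_H card_HA card_HB
  by unfold_locales (auto simp: disjoint_family_on_def alpha_def beta_def)

lemmas factor_bounds = batch_factor_bounds[OF finite_A finite_B k_pos card_HA card_HB]

text \<open>Hidden ground elements are at least as effective as generic ones, so replacing all of
  them by generic ones can only raise the residual.\<close>

lemma residual_le_exp: "residual k t A B H T \<le> exp (- rate * (real (card (T \<inter> A)) / real k))"
proof -
  have "residual k t A B H T \<le> exp (- rate * (real (card (T \<inter> (A - (\<Union>j<t. H j)))) / real k))
     * (\<Prod>j<t. exp (- rate * (real (card (T \<inter> (H j \<inter> A))) / real k)))"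
    unfolding residual_def
    by (intro mult_left_mono prod_mono conjI factor_bounds(1,3)) auto
  then show ?thesis by (simp only: exp_card_split[OF finite_A finite_lessThan disjoint_H])
qed

lemma residual_le_factor:
  assumes "j < t"
  shows "residual k t A B H T \<le> batch_factor k A (B j) (H j) T"
proof -
  have "(\<Prod>i<t. batch_factor k A (B i) (H i) T)
      = batch_factor k A (B j) (H j) T * (\<Prod>i\<in>{..<t} - {j}. batch_factor k A (B i) (H i) T)"
    using assms by (intro prod.remove) auto
  also have "\<dots> \<le> batch_factor k A (B j) (H j) T * 1"
    using assms by (intro mult_left_mono prod_le_1) (auto intro: factor_bounds)
  finally have P: "(\<Prod>i<t. batch_factor k A (B i) (H i) T) \<le> batch_factor k A (B j) (H j) T" by simp
  have "residual k t A B H T \<le> 1 * (\<Prod>i<t. batch_factor k A (B i) (H i) T)"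
    unfolding residual_def using rate_pos
    by (intro mult_right_mono prod_nonneg) (auto intro: factor_bounds)
  with P show ?thesis by simp
qed

lemma residual_le_1: "residual k t A B H T \<le> 1"
proof -
  have "exp (- rate * (real (card (T \<inter> A)) / real k)) \<le> 1" using rate_pos by simp
  with residual_le_exp show ?thesis by (rule order_trans)
qed

lemma problem_instance_hard_function:
  assumes "finite V" "length us = n" "elem ` set us \<subseteq> V"
  shows "problem_instance n V (hard_function k t A B H) us"
proof -
  have "problem_instance n V (\<lambda>S. min (1 - residual k t A B H S) (1 - cutoff)) us"
    using assms cutoff_le_1 residual_le_1 k_pos finite_A finite_B card_HA card_HB
    by (intro problem_instance_min_one_minus decreasing_supermodular_on_residual) auto
  then show ?thesis by (simp add: hard_function_def[abs_def])
qed

lemma hard_function_saturated: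
  assumes "saturation * real k \<le> real (card (T \<inter> A))"
  shows "hard_function k t A B H T = 1 - cutoff"
proof -
  have "saturation \<le> real (card (T \<inter> A)) / real k" using assms k_pos by (simp add: field_simps)
  then have "exp (- rate * (real (card (T \<inter> A)) / real k)) \<le> exp (- rate * saturation)"
    using rate_pos by (subst exp_le_cancel_iff) (intro mult_left_mono_neg, auto)
  then have "residual k t A B H T \<le> cutoff"
    using residual_le_exp[of T] exp_saturation(1) by linarith
  then show ?thesis by (simp add: hard_function_def)
qed

text \<open>Without batch elements both sides are a pure exponential of the hidden ground elements.
  With batch elements there are no hidden ground elements, and the batch part is either cut off or
  still exponential, hence a function of the size of \<open>T \<inter> B j\<close> alone.\<close>

lemma batch_factor_erased:
  assumes "j < t" "\<not> reveals k A (B j) (H j) T" "real (card (T \<inter> A)) < saturation * real k"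
  shows "batch_factor k A (B j) (H j) T
       = exp (- rate * (real (card (T \<inter> (H j \<inter> A))) / real k)) * batch_factor k A (B j) {} T"
proof -
  let ?y = "real (card (T \<inter> (H j \<inter> A))) / real k"
  let ?g = "real (card (T \<inter> (B j - H j))) / real k" and ?h = "real (card (T \<inter> (H j \<inter> B j))) / real k"
  let ?b = "real (card (T \<inter> B j)) / real k"
  have y: "?y \<le> slack" using assms(2,3) k_pos by (simp add: reveals_def field_simps)
  have gh: "?b = ?g + ?h"
  proof -
    have "card (T \<inter> (B j - H j) \<union> T \<inter> (H j \<inter> B j)) = card (T \<inter> (B j - H j)) + card (T \<inter> (H j \<inter> B j))"
      using finite_B[OF assms(1)] by (intro card_Un_disjoint) auto
    moreover have "T \<inter> (B j - H j) \<union> T \<inter> (H j \<inter> B j) = T \<inter> B j" by auto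
    ultimately show ?thesis by (simp add: add_divide_distrib)
  qed
  have erased: "batch_factor k A (B j) {} T = 1 - hidden_share + hidden_share * max cutoff (exp (- (1 / beta) * ?b))"
    using slack_pos by (simp add: batch_factor_def exp_linear_0)
  show ?thesis
  proof (cases "T \<inter> B j = {}")
    case True
    then have "T \<inter> (B j - H j) = {}" "T \<inter> (H j \<inter> B j) = {}" by auto
    then show ?thesis
      using slack_pos cutoff_le_1 y True unfolding erased
      by (simp add: batch_factor_def exp_linear_0 exp_linear_eq_exp)
  next
    case False
    with assms(2,3) have none: "T \<inter> (H j \<inter> A) = {}"
      and or: "saturation * real k \<le> real (card (T \<inter> B j)) \<or> real (card (T \<inter> (H j \<inter> B j))) \<le> slack * real k"
      by (auto simp: reveals_def not_less)
    have "max cutoff (exp (- (1 / beta) * ?g) * exp_linear slack (1 / beta) ?h)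
        = max cutoff (exp (- (1 / beta) * ?b))"
      using or
    proof
      assume "saturation * real k \<le> real (card (T \<inter> B j))"
      then have "saturation \<le> ?b" using k_pos by (simp add: field_simps)
      then have "- (1 / beta) * ?b \<le> - (1 / beta) * saturation"
        using beta_pos by (intro mult_left_mono_neg) auto
      then have b: "exp (- (1 / beta) * ?b) \<le> cutoff"
        using exp_saturation(2) by (meson exp_le_cancel_iff order_trans)
      have "exp (- (1 / beta) * ?g) * exp_linear slack (1 / beta) ?h
          \<le> exp (- (1 / beta) * ?g) * exp (- (1 / beta) * ?h)"
        using beta_pos by (intro mult_left_mono exp_linear_le_exp) auto
      also have "\<dots> = exp (- (1 / beta) * ?b)"
        unfolding gh exp_add[symmetric] distrib_left ..
      finally show ?thesis using b by simp
    next
      assume "real (card (T \<inter> (H j \<inter> B j))) \<le> slack * real k"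
      then have "?h \<le> slack" using k_pos by (simp add: field_simps)
      then have "exp (- (1 / beta) * ?g) * exp_linear slack (1 / beta) ?h
          = exp (- (1 / beta) * ?g) * exp (- (1 / beta) * ?h)"
        by (simp only: exp_linear_eq_exp)
      also have "\<dots> = exp (- (1 / beta) * ?b)"
        unfolding gh exp_add[symmetric] distrib_left ..
      finally show ?thesis by simp
    qed
    then show ?thesis
      using none slack_pos unfolding erased by (simp add: batch_factor_def exp_linear_0)
  qed
qed

text \<open>Erasing \<open>H j\<close> turns its ground part into generic elements; the exponential
  split off by \<open>batch_factor_erased\<close> is exactly what the common exponential gains.
  Saturated sets have the value \<open>1 - cutoff\<close> under both functions.\<close>

lemma hard_function_erase:
  assumes "j < t" "\<not> reveals k A (B j) (H j) T"
  shows "hard_function k t A B H T = hard_function k t A B (H(j := {})) T"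
proof -
  interpret erased: hidden_family k t A B "H(j := {})" by (rule hidden_family_erase)
  show ?thesis
  proof (cases "real (card (T \<inter> A)) < saturation * real k")
    case False
    then show ?thesis by (simp add: hard_function_saturated erased.hard_function_saturated)
  next
    case True
    let ?J = "{..<t} - {j}"
    let ?P = "\<Prod>i\<in>?J. batch_factor k A (B i) (H i) T"
    let ?A = "A - (\<Union>i\<in>?J. H i)"
    have "residual k t A B H T
        = exp (- rate * (real (card (T \<inter> (A - (\<Union>i<t. H i)))) / real k))
          * (batch_factor k A (B j) (H j) T * ?P)"
      unfolding residual_def using assms(1) by (simp add: prod.remove[of "{..<t}" j])
    also have "\<dots> = exp (- rate * (real (card (T \<inter> (A - (\<Union>i<t. H i)))) / real k))
          * exp (- rate * (real (card (T \<inter> (H j \<inter> A))) / real k)) * (batch_factor k A (B j) {} T * ?P)"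
      by (simp only: batch_factor_erased[OF assms True] mult.assoc)
    also have "exp (- rate * (real (card (T \<inter> (A - (\<Union>i<t. H i)))) / real k))
          * exp (- rate * (real (card (T \<inter> (H j \<inter> A))) / real k))
        = exp (- rate * (real (card (T \<inter> ?A)) / real k))"
    proof -
      have "card (T \<inter> (A - (\<Union>i<t. H i)) \<union> T \<inter> (H j \<inter> A))
          = card (T \<inter> (A - (\<Union>i<t. H i))) + card (T \<inter> (H j \<inter> A))"
        using finite_A assms(1) by (intro card_Un_disjoint) auto
      moreover have "T \<inter> (A - (\<Union>i<t. H i)) \<union> T \<inter> (H j \<inter> A) = T \<inter> ?A"
        using disjoint_H assms(1) by (auto simp: disjoint_family_on_def)
      ultimately show ?thesis
        by (simp add: exp_add[symmetric] add_divide_distrib algebra_simps)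
    qed
    also have "\<dots> * (batch_factor k A (B j) {} T * ?P) = residual k t A B (H(j := {})) T"
    proof -
      have "?P = (\<Prod>i\<in>?J. batch_factor k A (B i) ((H(j := {})) i) T)"
        by (intro prod.cong) auto
      moreover have "(\<Union>i<t. (H(j := {})) i) = (\<Union>i\<in>?J. H i)"
        using assms(1) by (auto split: if_splits)
      ultimately show ?thesis
        unfolding residual_def using assms(1) by (simp add: prod.remove[of "{..<t}" j])
    qed
    finally show ?thesis by (simp add: hard_function_def)
  qed
qed

text \<open>The ground part leaves \<open>hidden_share\<close> and the batch part at most the
  fraction \<open>cutoff\<close> of it. Rounding \<open>alpha * k\<close> down adds at most
  \<open>rate / k\<close>, which fits in since \<open>hidden_share < 0.6\<close>.\<close>

lemma hard_function_hidden_set: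
  assumes "j < t" "200000 \<le> k"
    and "alpha * real k - 1 \<le> real (card (H j \<inter> A))" "beta * real k - 1 \<le> real (card (H j \<inter> B j))"
  shows "hard_function k t A B H (H j) = 1 - cutoff"
proof -
  let ?y = "real (card (H j \<inter> A)) / real k" and ?z = "real (card (H j \<inter> B j)) / real k"
  have k: "1 / real k \<le> 1 / 200000" using assms(2) by (simp add: field_simps)
  have y: "alpha - 1 / real k \<le> ?y" "?y \<le> alpha" and z: "beta - 1 / real k \<le> ?z"
    using divide_right_mono[OF assms(3), of "real k"] divide_right_mono[OF assms(4), of "real k"]
      card_HA[OF assms(1)] k_pos by (simp_all add: diff_divide_distrib pos_divide_le_eq)
  have "exp_linear slack rate ?y \<le> hidden_share + rate * (alpha - ?y)"
    unfolding hidden_share_def using rate_pos slack_pos y by (intro exp_linear_Lipschitz) auto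
  also have "rate * (alpha - ?y) \<le> rate * (1 / 200000)"
    using y k rate_pos by (intro mult_left_mono) auto
  finally have Y: "exp_linear slack rate ?y - hidden_share \<le> rate * (1 / 200000)" by simp
  have "exp_linear slack (1 / beta) ?z \<le> exp_linear slack (1 / beta) (beta - 1 / 200000)"
    using beta_pos z k by (intro antimonoD[OF antimono_exp_linear]) auto
  also have "\<dots> \<le> 1 * (1 - (1 / beta) * (beta - 1 / 200000 - slack))"
    unfolding exp_linear_def
    by (simp add: beta_def slack_def cutoff_def)
  also have "\<dots> \<le> cutoff" by (simp add: beta_def slack_def cutoff_def)
  finally have "hidden_share * max cutoff (exp_linear slack (1 / beta) ?z) \<le> 58389 / 100000 * cutoff"
    using hidden_share_bounds cutoff_pos by (intro mult_mono) auto
  moreover have "rate * (1 / 200000) + 58389 / 100000 * cutoff \<le> cutoff"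
    by (simp add: rate_def cutoff_def)
  moreover have "batch_factor k A (B j) (H j) (H j)
      = exp_linear slack rate ?y - hidden_share + hidden_share * max cutoff (exp_linear slack (1 / beta) ?z)"
  proof -
    have "H j \<inter> (B j - H j) = {}" "H j \<inter> (H j \<inter> A) = H j \<inter> A" "H j \<inter> (H j \<inter> B j) = H j \<inter> B j"
      by auto
    then show ?thesis by (simp add: batch_factor_def)
  qed
  ultimately have "residual k t A B H (H j) \<le> cutoff"
    using residual_le_factor[OF assms(1), of "H j"] Y by linarith
  then show ?thesis by (simp add: hard_function_def)
qed

text \<open>Elements of the other hidden sets count as generic, so only the split of
  \<open>S\<close> into a batch share \<open>x\<close> and a ground share of at most
  \<open>1 - x\<close> matters, and \<open>generic_solution_bound\<close> treats every
  \<open>x\<close>. The set \<open>H j\<close> is empty because the lemma is applied to the erased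
  family.\<close>

lemma hard_function_generic_solution:
  assumes "j < t" "H j = {}" "card S \<le> k" "finite S" "A \<inter> B j = {}"
    and "\<And>i. i < t \<Longrightarrow> i \<noteq> j \<Longrightarrow> real (card (S \<inter> (H i \<inter> A))) \<le> slack * real k"
    and "\<And>i. i < t \<Longrightarrow> i \<noteq> j \<Longrightarrow> S \<inter> B i = {}"
  shows "hard_function k t A B H S \<le> 58392 / 100000"
proof -
  let ?x = "real (card (S \<inter> B j)) / real k"
  have factor: "batch_factor k A (B i) (H i) S = exp (- rate * (real (card (S \<inter> (H i \<inter> A))) / real k))"
    if "i < t" "i \<noteq> j" for i
  proof -
    have "real (card (S \<inter> (H i \<inter> A))) / real k \<le> slack"
      using assms(6)[OF that] k_pos by (simp add: field_simps)
    moreover have "S \<inter> (B i - H i) = {}" "S \<inter> (H i \<inter> B i) = {}"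
      using assms(7)[OF that] by auto
    ultimately show ?thesis
      using slack_pos cutoff_le_1 by (simp add: batch_factor_def exp_linear_0 exp_linear_eq_exp)
  qed
  have "residual k t A B H S
      = exp (- rate * (real (card (S \<inter> (A - (\<Union>i<t. H i)))) / real k))
        * (batch_factor k A (B j) {} S * (\<Prod>i\<in>{..<t} - {j}. batch_factor k A (B i) (H i) S))"
    unfolding residual_def using assms(1,2) by (simp add: prod.remove[of "{..<t}" j])
  also have "(\<Prod>i\<in>{..<t} - {j}. batch_factor k A (B i) (H i) S)
      = (\<Prod>i\<in>{..<t} - {j}. exp (- rate * (real (card (S \<inter> (H i \<inter> A))) / real k)))"
    by (intro prod.cong) (auto simp: factor)
  also have "\<dots> = (\<Prod>i<t. exp (- rate * (real (card (S \<inter> (H i \<inter> A))) / real k)))"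
    using assms(1,2) by (simp add: prod.remove[of "{..<t}" j])
  finally have res: "residual k t A B H S = exp (- rate * (real (card (S \<inter> A)) / real k)) * batch_factor k A (B j) {} S"
    using exp_card_split[OF finite_A finite_lessThan disjoint_H, of "- rate" S k] by (simp add: mult_ac)
  have fac: "batch_factor k A (B j) {} S = 1 - hidden_share + hidden_share * max cutoff (exp (- ?x / beta))"
    using slack_pos by (simp add: batch_factor_def exp_linear_0 mult.commute)
  have le: "exp (- rate * (1 - ?x)) * (1 - hidden_share + hidden_share * exp (- ?x / beta))
    \<le> exp (- rate * (real (card (S \<inter> A)) / real k))
       * (1 - hidden_share + hidden_share * max cutoff (exp (- ?x / beta)))"
  proof (rule mult_mono)
    have "card (S \<inter> A) + card (S \<inter> B j) = card (S \<inter> A \<union> S \<inter> B j)"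
      using assms(4,5) by (intro card_Un_disjoint[symmetric]) auto
    also have "\<dots> \<le> card S" using assms(4) by (intro card_mono) auto
    finally have "real (card (S \<inter> A)) + real (card (S \<inter> B j)) \<le> real k" using assms(3) by linarith
    then have "real (card (S \<inter> A)) / real k \<le> 1 - ?x" using k_pos by (simp add: field_simps)
    then show "exp (- rate * (1 - ?x)) \<le> exp (- rate * (real (card (S \<inter> A)) / real k))"
      using rate_pos by (subst exp_le_cancel_iff) (intro mult_left_mono_neg, auto)
  qed (use hidden_share_bounds in \<open>auto intro!: mult_left_mono\<close>)
  have "?x \<le> 1"
  proof -
    have "card (S \<inter> B j) \<le> card S" using assms(4) by (intro card_mono) auto
    then show ?thesis using assms(3) k_pos by simp
  qed
  then have low: "41608 / 100000 \<le> exp (- rate * (1 - ?x)) * (1 - hidden_share + hidden_share * exp (- ?x / beta))"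
    by (intro generic_solution_bound) auto
  have "41608 / 100000 \<le> residual k t A B H S"
    unfolding res fac by (rule order_trans[OF low le])
  then show ?thesis unfolding hard_function_def by (intro min.coboundedI1) simp
qed

end

section \<open>The hard stream\<close>

text \<open>\<open>a\<close> and \<open>b\<close> count the hidden elements of a batch in the ground
  set and in the batch, one per row. The ground rows, of width \<open>p\<close>, are shared by all
  batches; batch rows have width \<open>w\<close>. A batch takes \<open>2 * (b * w) + a\<close>
  updates, and \<open>t \<le> p\<close> leaves room for distinct choices in each ground row.\<close>

locale hard_stream =
  fixes n k t p w a b :: nat
  assumes k: "200000 \<le> k"
    and a: "real a \<le> alpha * real k" "alpha * real k - 1 \<le> real a"
    and b: "real b \<le> beta * real k" "beta * real k - 1 \<le> real b"
    and fits: "a * p + t * (2 * (b * w) + a) \<le> n"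
    and room: "0 < p" "t \<le> p"
begin

definition "ground = {..<a * p}"
definition "batch_start j = a * p + j * (b * w)"
definition "batch_set j = {batch_start j..<batch_start (Suc j)}"
definition "universe = {..<batch_start t}"

definition candidates :: "nat \<Rightarrow> nat \<Rightarrow> nat set" where
  "candidates j l =
     (if l < a then {l * p..<Suc l * p}
      else {batch_start j + (l - a) * w..<batch_start j + Suc (l - a) * w})"

abbreviation "choices \<equiv> hidden_choices t (a + b) candidates"
abbreviation hidden :: "(nat \<Rightarrow> nat \<Rightarrow> nat) \<Rightarrow> nat \<Rightarrow> nat set" where
  "hidden \<equiv> hidden_sets t (a + b)"

text \<open>
  Deleting the ground part of the hidden set is essential: once found, it would be better than
  generic ground elements in all later batches.
\<close>

definition batch_updates :: "(nat \<Rightarrow> nat set) \<Rightarrow> nat \<Rightarrow> nat update list" where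
  "batch_updates h j =
     map Insert [batch_start j..<batch_start (Suc j)] @ map Delete [batch_start j..<batch_start (Suc j)]
     @ map Delete (sorted_list_of_set (h j \<inter> ground))"

definition stream_prefix :: "(nat \<Rightarrow> nat set) \<Rightarrow> nat \<Rightarrow> nat update list" where
  "stream_prefix h j = map Insert [0..<a * p] @ concat (map (batch_updates h) [0..<j])"

text \<open>Pads to length exactly \<open>n\<close>; deleting \<open>0\<close>, a ground element,
  keeps the stream inside \<open>universe\<close>.\<close>

definition stream :: "(nat \<Rightarrow> nat set) \<Rightarrow> nat update list" where
  "stream h = stream_prefix h t @ replicate (n - length (stream_prefix h t)) (Delete 0)"

text \<open>\<open>stop j\<close> is the round in which batch \<open>j\<close> is complete and the
  output is judged. It precedes all deletions of the batch, since those of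
  \<open>h j \<inter> ground\<close> disclose the hidden set.\<close>

definition "start j = a * p + j * (2 * (b * w) + a)"
definition "stop j = start j + b * w"

lemma a_pos: "0 < a" and ab_le_k: "a + b \<le> k" and k_pos: "0 < k"
proof -
  show "0 < k" using k by simp
  have "2 \<le> alpha * real k" using k by (simp add: alpha_def)
  with a(2) show "0 < a" by (cases a) auto
  have "real a + real b \<le> (alpha + beta) * real k" using a(1) b(1) by (simp add: distrib_right)
  also have "\<dots> = real k" by (simp add: alpha_def beta_def)
  finally show "a + b \<le> k" by linarith
qed

lemma start_le_stop: "start j \<le> stop j" and stop_le_start_Suc: "stop j \<le> start (Suc j)"
  by (simp_all add: start_def stop_def)

lemma start_mono: "i \<le> j \<Longrightarrow> start i \<le> start j"
  by (simp add: start_def)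

lemma start_t_le: "start t \<le> n"
  using fits by (simp add: start_def)

lemma stop_le_start: "i < j \<Longrightarrow> stop i \<le> start j"
  using stop_le_start_Suc[of i] start_mono[of "Suc i" j] by linarith

lemma stop_le_n: "j < t \<Longrightarrow> stop j \<le> n"
  using stop_le_start[of j t] start_t_le by linarith

lemma stop_pos: "1 \<le> stop j"
proof -
  have "0 < a * p" using a_pos room(1) by simp
  then show ?thesis unfolding stop_def start_def by linarith
qed

lemma batch_start_mono: "i \<le> j \<Longrightarrow> batch_start i \<le> batch_start j"
  unfolding batch_start_def by (intro add_left_mono mult_right_mono) auto

lemma batch_start_Suc: "batch_start (Suc j) = batch_start j + b * w"
  by (simp add: batch_start_def)

lemma ground_batch_disjoint: "ground \<inter> batch_set j = {}"
  by (auto simp: ground_def batch_set_def batch_start_def)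

lemma batch_set_disjoint:
  assumes "i \<noteq> j"
  shows "batch_set i \<inter> batch_set j = {}"
  using assms batch_start_mono[of "Suc i" j] batch_start_mono[of "Suc j" i]
  by (cases "i < j") (auto simp: batch_set_def)

lemma candidates_subset:
  assumes "l < a + b"
  shows "candidates j l \<subseteq> (if l < a then ground else batch_set j)"
proof (cases "l < a")
  case True
  then have "Suc l * p \<le> a * p" by (intro mult_right_mono) auto
  then show ?thesis using True by (auto simp: candidates_def ground_def)
next
  case False
  with assms have "Suc (l - a) * w \<le> b * w" by (intro mult_right_mono) auto
  then show ?thesis using False by (auto simp: candidates_def batch_set_def batch_start_Suc)
qed

lemma disjoint_multiples:
  assumes "l < l'"
  shows "{c + l * d..<c + Suc l * d} \<inter> {c + l' * d..<c + Suc l' * d} = ({} :: nat set)"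
proof -
  have "Suc l * d \<le> l' * d" using assms by (intro mult_right_mono) auto
  then show ?thesis by auto
qed

lemma candidates_disjoint:
  assumes "l < a + b" "l' < a + b" "l \<noteq> l'"
  shows "candidates i l \<inter> candidates j l' = {}"
proof -
  have *: "candidates i l \<inter> candidates j l' = {}" if "l < l'" "l' < a + b" for i j l l'
  proof -
    consider "l' < a" | "l < a" "a \<le> l'" | "a \<le> l" by linarith
    then show ?thesis
    proof cases
      case 1
      then show ?thesis using that disjoint_multiples[OF that(1), of 0 p] by (simp add: candidates_def)
    next
      case 2
      then show ?thesis
        using candidates_subset[of l i] candidates_subset[of l' j] ground_batch_disjoint[of j] that
        by auto
    next
      case 3
      show ?thesis
      proof (cases "i = j")
        case True
        have "l - a < l' - a" using 3 that by simp
        then show ?thesis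
          using 3 that True disjoint_multiples[of "l - a" "l' - a" "batch_start j" w]
          by (simp add: candidates_def)
      next
        case False
        then show ?thesis
          using candidates_subset[of l i] candidates_subset[of l' j] batch_set_disjoint[OF False] 3 that
          by auto
      qed
    qed
  qed
  show ?thesis
    using assms *[of l l' i j] *[of l' l j i] by (cases "l < l'") auto
qed

lemma finite_candidates: "finite (candidates j l)"
  by (simp add: candidates_def)

lemma finite_choices: "finite choices"
  by (rule finite_hidden_choices) (rule finite_candidates)

lemma choices_nonempty:
  assumes "0 < w"
  shows "choices \<noteq> {}"
proof -
  \<comment> \<open>Batch \<open>j\<close> takes the \<open>j\<close>-th candidate of every ground
    row, possible by \<open>t \<le> p\<close>, and the first one of each of its own rows.\<close>
  have "restrict (\<lambda>j. restrict (\<lambda>l. if l < a then l * p + j else batch_start j + (l - a) * w) {..<a + b}) {..<t}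
      \<in> choices" (is "?\<tau> \<in> _")
  proof -
    have "batch_start i = batch_start j \<longleftrightarrow> i = j" if "0 < b" for i j
      using that assms by (simp add: batch_start_def)
    then show ?thesis
      using room assms by (auto simp: hidden_choices_def candidates_def inj_on_def split: if_splits)
  qed
  then show ?thesis by auto
qed

lemma choice_mem:
  assumes "\<tau> \<in> choices" "j < t" "l < a + b"
  shows "\<tau> j l \<in> candidates j l"
  using assms by (auto simp: hidden_choices_def PiE_def Pi_def)

lemma choice_row_inj:
  assumes "\<tau> \<in> choices" "i < t" "j < t" "l < a + b" "l' < a + b" "\<tau> i l = \<tau> j l'"
  shows "i = j \<and> l = l'"
proof -
  have l: "l = l'"
    using choice_mem[OF assms(1,2,4)] choice_mem[OF assms(1,3,5)] candidates_disjoint[OF assms(4,5)] assms(6)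
    by auto
  have "inj_on (\<lambda>j. \<tau> j l) {..<t}" using assms(1,4) by (auto simp: hidden_choices_def)
  then show ?thesis using l assms(2,3,6) by (auto dest: inj_onD)
qed

lemma selection_Int_ground:
  assumes "\<And>l. l < a + b \<Longrightarrow> x l \<in> candidates j l"
  shows "x ` {..<a + b} \<inter> ground = x ` {..<a}" "x ` {..<a + b} \<inter> batch_set j = x ` {a..<a + b}"
proof -
  have g: "x l \<in> ground" if "l < a" for l
    using assms[of l] candidates_subset[of l j] that by auto
  have c: "x l \<in> batch_set j" if "\<not> l < a" "l < a + b" for l
    using assms[of l] candidates_subset[of l j] that by auto
  have "{..<a + b} = {..<a} \<union> {a..<a + b}" by auto
  then have split: "x ` {..<a + b} = x ` {..<a} \<union> x ` {a..<a + b}" by (simp only: image_Un)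
  have "x ` {..<a} \<subseteq> ground" "x ` {a..<a + b} \<subseteq> batch_set j" using g c by auto
  then show "x ` {..<a + b} \<inter> ground = x ` {..<a}" "x ` {..<a + b} \<inter> batch_set j = x ` {a..<a + b}"
    unfolding split using ground_batch_disjoint[of j] by blast+
qed

lemma hidden_Int:
  assumes "\<tau> \<in> choices" "j < t"
  shows "hidden \<tau> j \<inter> ground = \<tau> j ` {..<a}" "hidden \<tau> j \<inter> batch_set j = \<tau> j ` {a..<a + b}"
  using selection_Int_ground[of "\<tau> j" j] choice_mem[OF assms] assms(2)
  by (simp_all add: hidden_sets_def)

lemma hidden_subset:
  assumes "\<tau> \<in> choices" "j < t"
  shows "hidden \<tau> j \<subseteq> ground \<union> batch_set j"
proof -
  have "\<tau> j l \<in> ground \<union> batch_set j" if "l < a + b" for l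
    using subsetD[OF candidates_subset[OF that] choice_mem[OF assms that]] by (auto split: if_splits)
  then show ?thesis by (auto simp: hidden_sets_def)
qed

lemma card_hidden:
  assumes "\<tau> \<in> choices" "j < t"
  shows "card (hidden \<tau> j) = a + b" "card (hidden \<tau> j \<inter> ground) = a" "card (hidden \<tau> j \<inter> batch_set j) = b"
proof -
  have inj: "inj_on (\<tau> j) {..<a + b}"
    using choice_row_inj[OF assms(1,2,2)] by (intro inj_onI) blast
  moreover have "inj_on (\<tau> j) {..<a}" "inj_on (\<tau> j) {a..<a + b}"
    by (rule inj_on_subset[OF inj]; auto)+
  ultimately show "card (hidden \<tau> j) = a + b" "card (hidden \<tau> j \<inter> ground) = a" "card (hidden \<tau> j \<inter> batch_set j) = b"
    using assms(2) unfolding hidden_Int[OF assms] by (simp_all add: hidden_sets_def card_image)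
qed

lemma hidden_disjoint:
  assumes "\<tau> \<in> choices" "i \<noteq> j"
  shows "hidden \<tau> i \<inter> hidden \<tau> j = {}"
proof (cases "i < t \<and> j < t")
  case True
  have "\<tau> i l \<noteq> \<tau> j l'" if "l < a + b" "l' < a + b" for l l'
    using choice_row_inj[OF assms(1), of i j l l'] True that assms(2) by blast
  then show ?thesis using True by (auto simp: hidden_sets_def)
qed (auto simp: hidden_sets_def)

lemma hidden_family_choice:
  assumes "\<tau> \<in> choices"
  shows "hidden_family k t ground batch_set (hidden \<tau>)"
proof
  show "disjoint_family_on (\<lambda>j. hidden \<tau> j \<inter> ground) {..<t}"
    using hidden_disjoint[OF assms] by (auto simp: disjoint_family_on_def)
qed (use k_pos a b card_hidden[OF assms] in \<open>auto simp: ground_def batch_set_def\<close>)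

section \<open>Length, prefixes and live sets of the stream\<close>

lemma length_stream_prefix:
  assumes "\<And>i. i < j \<Longrightarrow> card (h i \<inter> ground) = a"
  shows "length (stream_prefix h j) = start j"
  using assms
proof (induction j)
  case (Suc j)
  have "length (stream_prefix h (Suc j)) = length (stream_prefix h j) + length (batch_updates h j)"
    by (simp add: stream_prefix_def)
  also have "length (batch_updates h j) = 2 * (b * w) + a"
    using Suc.prems[of j] by (simp add: batch_updates_def batch_start_Suc)
  finally show ?case using Suc by (simp add: start_def)
qed (simp add: stream_prefix_def start_def)

lemma length_stream:
  assumes "\<And>i. i < t \<Longrightarrow> card (h i \<inter> ground) = a"
  shows "length (stream h) = n"
  using length_stream_prefix[of t h, OF assms] start_t_le by (simp add: stream_def)

lemma stream_split:
  assumes "j < t"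
  obtains ys where "stream h = stream_prefix h j @ map Insert [batch_start j..<batch_start (Suc j)] @ ys"
proof -
  have "[0..<t] = [0..<j] @ j # [Suc j..<t]"
    using assms upt_add_eq_append[of 0 j "t - j"] upt_conv_Cons[of j t] by simp
  then show thesis
    by (intro that) (simp add: stream_def stream_prefix_def batch_updates_def)
qed

lemma take_stream:
  assumes "j < t" "\<And>i. i < t \<Longrightarrow> card (h i \<inter> ground) = a"
  shows "take (start j) (stream h) = stream_prefix h j"
    and "take (stop j) (stream h) = stream_prefix h j @ map Insert [batch_start j..<batch_start (Suc j)]"
proof -
  have len: "length (stream_prefix h j) = start j"
    by (rule length_stream_prefix) (use assms in simp)
  obtain ys where ys: "stream h = stream_prefix h j @ map Insert [batch_start j..<batch_start (Suc j)] @ ys"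
    using stream_split[OF assms(1)] .
  show "take (start j) (stream h) = stream_prefix h j"
    unfolding ys by (simp add: len)
  show "take (stop j) (stream h) = stream_prefix h j @ map Insert [batch_start j..<batch_start (Suc j)]"
    unfolding ys by (simp add: len stop_def batch_start_Suc)
qed

lemma stream_prefix_cong:
  "(\<And>i. i < j \<Longrightarrow> h i = h' i) \<Longrightarrow> stream_prefix h j = stream_prefix h' j"
  unfolding stream_prefix_def batch_updates_def by (auto intro!: arg_cong[of _ _ concat] map_cong)

lemma live_stream_prefix: "live (stream_prefix h j) = ground - (\<Union>i<j. h i)"
proof (induction j)
  case 0
  then show ?case by (auto simp: stream_prefix_def live_def foldl_Insert ground_def)
next
  case (Suc j)
  have fin: "finite (h j \<inter> ground)" by (simp add: ground_def)
  have "live (stream_prefix h (Suc j)) = foldl apply_update (live (stream_prefix h j)) (batch_updates h j)"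
    by (simp add: stream_prefix_def flip: live_append)
  also have "\<dots> = (ground - (\<Union>i<j. h i)) \<union> batch_set j - batch_set j - (h j \<inter> ground)"
    unfolding Suc.IH batch_updates_def foldl_append foldl_Insert foldl_Delete
    by (simp add: batch_set_def set_sorted_list_of_set[OF fin])
  also have "\<dots> = ground - (\<Union>i<Suc j. h i)"
    using ground_batch_disjoint[of j] by (auto simp: lessThan_Suc)
  finally show ?case .
qed

lemma inserted_stream_prefix: "{e. Insert e \<in> set (stream_prefix h j)} \<subseteq> {..<batch_start j}"
proof (induction j)
  case 0
  then show ?case by (auto simp: stream_prefix_def batch_start_def)
next
  case (Suc j)
  have "set (stream_prefix h (Suc j)) = set (stream_prefix h j) \<union> set (batch_updates h j)"
    by (auto simp: stream_prefix_def)
  then show ?case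
    using Suc batch_start_mono[of j "Suc j"] by (fastforce simp: batch_updates_def)
qed

lemma elem_stream:
  assumes "\<And>i. i < t \<Longrightarrow> card (h i \<inter> ground) = a"
  shows "elem ` set (stream h) \<subseteq> universe"
proof -
  have ground: "ground \<subseteq> universe" by (auto simp: ground_def universe_def batch_start_def)
  have "elem ` set (batch_updates h j) \<subseteq> universe" if "j < t" for j
  proof -
    have "finite (h j \<inter> ground)" by (simp add: ground_def)
    then have "elem ` set (batch_updates h j) \<subseteq> {batch_start j..<batch_start (Suc j)} \<union> ground"
      by (auto simp: batch_updates_def)
    then show ?thesis using ground batch_start_mono[of "Suc j" t] that by (fastforce simp: universe_def)
  qed
  moreover have "elem ` set (map Insert [0..<a * p]) \<subseteq> universe"
    using ground by (auto simp: ground_def)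
  moreover have "0 < a * p" using a_pos room(1) by simp
  then have "0 \<in> universe" by (simp add: universe_def batch_start_def)
  moreover have "set (stream h)
      \<subseteq> set (map Insert [0..<a * p]) \<union> (\<Union>j<t. set (batch_updates h j)) \<union> {Delete 0}"
    by (auto simp: stream_def stream_prefix_def)
  then have "elem ` set (stream h)
      \<subseteq> elem ` set (map Insert [0..<a * p]) \<union> (\<Union>j<t. elem ` set (batch_updates h j)) \<union> {0}"
    by (drule_tac image_mono[where f = elem]) (simp only: image_Un image_UN image_insert image_empty update.sel)
  ultimately show ?thesis by (elim order_trans) (intro Un_least UN_least, auto)
qed

end

section \<open>Probability that a fixed set reveals a hidden set\<close>

lemma card_Bex_le:
  assumes "finite F" "finite W" "\<And>T. T \<in> W \<Longrightarrow> real (card {x \<in> F. P T x}) \<le> c"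
  shows "real (card {x \<in> F. \<exists>T\<in>W. P T x}) \<le> real (card W) * c"
proof -
  have "{x \<in> F. \<exists>T\<in>W. P T x} = (\<Union>T\<in>W. {x \<in> F. P T x})" by auto
  then have "card {x \<in> F. \<exists>T\<in>W. P T x} \<le> (\<Sum>T\<in>W. card {x \<in> F. P T x})"
    by (simp only: card_UN_le[OF assms(2)])
  then have "real (card {x \<in> F. \<exists>T\<in>W. P T x}) \<le> (\<Sum>T\<in>W. real (card {x \<in> F. P T x}))"
    by (simp only: of_nat_sum[symmetric] of_nat_le_iff)
  also have "\<dots> \<le> (\<Sum>T\<in>W. c)" by (intro sum_mono assms)
  finally show ?thesis by simp
qed

text \<open>\<open>\<rho>\<close> bounds from below what is left of a ground row after the other
  batches have chosen. \<open>\<epsilon>\<close> dominates the Chernoff bounds with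
  \<open>c = 2\<close> for sets that are not saturated.\<close>

locale hard_stream_probability = hard_stream +
  fixes \<rho> \<epsilon> :: real
  assumes w_pos: "0 < w" and \<rho>_pos: "0 < \<rho>" and \<rho>_le: "\<rho> + real t \<le> real p"
    and \<epsilon>_ground: "2 powr (- (slack * real k)) * exp (saturation * real k / \<rho>) \<le> \<epsilon>"
    and \<epsilon>_batch: "2 powr (- (slack * real k)) * exp (saturation * real k / real w) \<le> \<epsilon>"
begin

lemma \<epsilon>_nonneg: "0 \<le> \<epsilon>"
  using \<epsilon>_ground by (rule order_trans[rotated]) simp

definition remaining :: "(nat \<Rightarrow> nat \<Rightarrow> nat) \<Rightarrow> nat \<Rightarrow> nat \<Rightarrow> nat set" where
  "remaining \<tau> j l = candidates j l - (\<lambda>i. \<tau> i l) ` ({..<t} - {j})"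

abbreviation "fiber \<tau> j \<equiv> PiE {..<a + b} (remaining \<tau> j)"

lemma fiber_eq: "\<tau> \<in> choices \<Longrightarrow> j < t \<Longrightarrow> {x. \<tau>(j := x) \<in> choices} = fiber \<tau> j"
  using hidden_choices_fiber[of \<tau> t "a + b" candidates j] by (simp add: remaining_def[abs_def])

lemma finite_remaining: "finite (remaining \<tau> j l)"
  by (simp add: remaining_def finite_candidates)

lemma finite_fiber: "finite (fiber \<tau> j)"
  by (intro finite_PiE finite_remaining) auto

lemma card_remaining:
  assumes "\<tau> \<in> choices" "j < t" "l < a + b"
  shows "(if l < a then \<rho> else real w) \<le> real (card (remaining \<tau> j l))"
proof (cases "l < a")
  case True
  have "card (candidates j l) - card ((\<lambda>i. \<tau> i l) ` ({..<t} - {j})) \<le> card (remaining \<tau> j l)"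
    unfolding remaining_def by (rule diff_card_le_card_Diff) simp
  moreover have "card (candidates j l) = p" using True by (simp add: candidates_def)
  moreover have "card ((\<lambda>i. \<tau> i l) ` ({..<t} - {j})) \<le> t"
    using card_image_le[of "{..<t} - {j}" "\<lambda>i. \<tau> i l"] assms(2) by simp
  ultimately have "real p - real t \<le> real (card (remaining \<tau> j l))" by linarith
  then show ?thesis using True \<rho>_le by simp
next
  case False
  have "\<tau> i l \<notin> candidates j l" if "i < t" "i \<noteq> j" for i
    using subsetD[OF candidates_subset[OF assms(3)] choice_mem[OF assms(1) that(1) assms(3)]]
      candidates_subset[OF assms(3), of j] batch_set_disjoint[OF that(2)] False by auto
  then have "remaining \<tau> j l = candidates j l" by (auto simp: remaining_def)
  then show ?thesis using False by (simp add: candidates_def)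
qed

lemma remaining_subset: "remaining \<tau> j l \<subseteq> candidates j l"
  by (auto simp: remaining_def)

lemma disjoint_remaining: "J \<subseteq> {..<a + b} \<Longrightarrow> disjoint_family_on (remaining \<tau> j) J"
proof (unfold disjoint_family_on_def, intro ballI impI)
  fix l l' assume "J \<subseteq> {..<a + b}" "l \<in> J" "l' \<in> J" "l \<noteq> l'"
  then have "candidates j l \<inter> candidates j l' = {}" by (intro candidates_disjoint) auto
  then show "remaining \<tau> j l \<inter> remaining \<tau> j l' = {}"
    using remaining_subset[of \<tau> j l] remaining_subset[of \<tau> j l'] by blast
qed

lemma fiber_large_ground:
  assumes "\<tau> \<in> choices" "j < t" "real (card (T \<inter> ground)) < saturation * real k"
  shows "real (card {x \<in> fiber \<tau> j. slack * real k \<le> real (card {l \<in> {..<a}. x l \<in> T})})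
    \<le> \<epsilon> * real (card (fiber \<tau> j))"
proof -
  have "real (card {x \<in> fiber \<tau> j. slack * real k \<le> real (card {l \<in> {..<a}. x l \<in> T})})
    \<le> 2 powr (- (slack * real k)) * exp ((2 - 1) * (real (card (T \<inter> ground)) / \<rho>)) * real (card (fiber \<tau> j))"
  proof (rule card_transversal_large)
    show "disjoint_family_on (remaining \<tau> j) {..<a}" by (rule disjoint_remaining) auto
    fix l assume l: "l \<in> {..<a}"
    then show "remaining \<tau> j l \<subseteq> ground"
      using remaining_subset[of \<tau> j l] candidates_subset[of l j] by auto
    show "\<rho> \<le> real (card (remaining \<tau> j l))"
      using card_remaining[OF assms(1,2), of l] l by simp
  qed (use \<rho>_pos in \<open>auto simp: finite_remaining ground_def\<close>)
  also have "\<dots> \<le> 2 powr (- (slack * real k)) * exp (saturation * real k / \<rho>) * real (card (fiber \<tau> j))"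
    using assms(3) \<rho>_pos by (intro mult_right_mono mult_left_mono) (auto intro!: divide_right_mono)
  also have "\<dots> \<le> \<epsilon> * real (card (fiber \<tau> j))"
    by (intro mult_right_mono \<epsilon>_ground) auto
  finally show ?thesis .
qed

lemma fiber_meets_ground:
  assumes "\<tau> \<in> choices" "j < t" "real (card (T \<inter> ground)) < saturation * real k"
  shows "real (card {x \<in> fiber \<tau> j. \<exists>l\<in>{..<a}. x l \<in> T})
    \<le> saturation * real k / \<rho> * real (card (fiber \<tau> j))"
proof -
  have "real (card {x \<in> fiber \<tau> j. \<exists>l\<in>{..<a}. x l \<in> T})
    \<le> real (card (T \<inter> ground)) / \<rho> * real (card (fiber \<tau> j))"
  proof (rule card_transversal_meets)
    show "disjoint_family_on (remaining \<tau> j) {..<a}" by (rule disjoint_remaining) auto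
    fix l assume l: "l \<in> {..<a}"
    then show "remaining \<tau> j l \<subseteq> ground"
      using remaining_subset[of \<tau> j l] candidates_subset[of l j] by auto
    show "\<rho> \<le> real (card (remaining \<tau> j l))"
      using card_remaining[OF assms(1,2), of l] l by simp
  qed (use \<rho>_pos in \<open>auto simp: finite_remaining ground_def\<close>)
  also have "\<dots> \<le> saturation * real k / \<rho> * real (card (fiber \<tau> j))"
    using assms(3) \<rho>_pos by (intro mult_right_mono divide_right_mono) auto
  finally show ?thesis .
qed

lemma fiber_large_batch:
  assumes "\<tau> \<in> choices" "j < t" "real (card (T \<inter> batch_set j)) < saturation * real k"
  shows "real (card {x \<in> fiber \<tau> j. slack * real k \<le> real (card {l \<in> {a..<a + b}. x l \<in> T})})
    \<le> \<epsilon> * real (card (fiber \<tau> j))"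
proof -
  have "real (card {x \<in> fiber \<tau> j. slack * real k \<le> real (card {l \<in> {a..<a + b}. x l \<in> T})})
    \<le> 2 powr (- (slack * real k)) * exp ((2 - 1) * (real (card (T \<inter> batch_set j)) / real w))
       * real (card (fiber \<tau> j))"
  proof (rule card_transversal_large)
    show "disjoint_family_on (remaining \<tau> j) {a..<a + b}" by (rule disjoint_remaining) auto
    fix l assume l: "l \<in> {a..<a + b}"
    then show "remaining \<tau> j l \<subseteq> batch_set j"
      using remaining_subset[of \<tau> j l] candidates_subset[of l j] by auto
    show "real w \<le> real (card (remaining \<tau> j l))"
      using card_remaining[OF assms(1,2), of l] l by simp
  qed (use w_pos in \<open>auto simp: finite_remaining batch_set_def\<close>)
  also have "\<dots> \<le> 2 powr (- (slack * real k)) * exp (saturation * real k / real w) * real (card (fiber \<tau> j))"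
    using assms(3) w_pos by (intro mult_right_mono mult_left_mono) (auto intro!: divide_right_mono)
  also have "\<dots> \<le> \<epsilon> * real (card (fiber \<tau> j))"
    by (intro mult_right_mono \<epsilon>_batch) auto
  finally show ?thesis .
qed

lemma reveals_selection:
  assumes "x \<in> fiber \<tau> j" "reveals k ground (batch_set j) (x ` {..<a + b}) T"
  shows "real (card (T \<inter> ground)) < saturation * real k"
    and "slack * real k \<le> real (card {l \<in> {..<a}. x l \<in> T}) \<or> T \<inter> batch_set j \<noteq> {} \<and>
      ((\<exists>l\<in>{..<a}. x l \<in> T) \<or> real (card (T \<inter> batch_set j)) < saturation * real k \<and>
         slack * real k \<le> real (card {l \<in> {a..<a + b}. x l \<in> T}))"
proof -
  have mem: "x l \<in> candidates j l" if "l < a + b" for l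
    using PiE_mem[OF assms(1), of l] that remaining_subset by blast
  have sel: "x ` {..<a + b} \<inter> ground = x ` {..<a}" "x ` {..<a + b} \<inter> batch_set j = x ` {a..<a + b}"
    using selection_Int_ground[of x j] mem by blast+
  have ground: "T \<inter> x ` {..<a} = x ` {l \<in> {..<a}. x l \<in> T}"
    and batch: "T \<inter> x ` {a..<a + b} = x ` {l \<in> {a..<a + b}. x l \<in> T}" by auto
  have "card (T \<inter> (x ` {..<a + b} \<inter> ground)) \<le> card {l \<in> {..<a}. x l \<in> T}"
    unfolding sel ground by (rule card_image_le) simp
  moreover have "card (T \<inter> (x ` {..<a + b} \<inter> batch_set j)) \<le> card {l \<in> {a..<a + b}. x l \<in> T}"
    unfolding sel batch by (rule card_image_le) simp
  moreover have "T \<inter> (x ` {..<a + b} \<inter> ground) \<noteq> {} \<longleftrightarrow> (\<exists>l\<in>{..<a}. x l \<in> T)"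
    unfolding sel ground by auto
  ultimately show "real (card (T \<inter> ground)) < saturation * real k"
    and "slack * real k \<le> real (card {l \<in> {..<a}. x l \<in> T}) \<or> T \<inter> batch_set j \<noteq> {} \<and>
      ((\<exists>l\<in>{..<a}. x l \<in> T) \<or> real (card (T \<inter> batch_set j)) < saturation * real k \<and>
         slack * real k \<le> real (card {l \<in> {a..<a + b}. x l \<in> T}))"
    using assms(2) unfolding reveals_def by linarith+
qed

text \<open>A set without batch elements can reveal only by containing more than
  \<open>slack * k\<close> hidden ground elements, so the chance is exponentially small.\<close>

lemma reveal_probability_early:
  assumes "\<tau> \<in> choices" "j < t" "T \<inter> batch_set j = {}"
  shows "real (card {x \<in> fiber \<tau> j. reveals k ground (batch_set j) (x ` {..<a + b}) T})
    \<le> \<epsilon> * real (card (fiber \<tau> j))"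
proof (cases "real (card (T \<inter> ground)) < saturation * real k")
  case True
  have "card {x \<in> fiber \<tau> j. reveals k ground (batch_set j) (x ` {..<a + b}) T}
      \<le> card {x \<in> fiber \<tau> j. slack * real k \<le> real (card {l \<in> {..<a}. x l \<in> T})}"
    using reveals_selection(2)[of _ \<tau> j T] assms(3) finite_fiber by (intro card_mono) auto
  with fiber_large_ground[OF assms(1,2) True] show ?thesis by linarith
next
  case False
  then have none: "{x \<in> fiber \<tau> j. reveals k ground (batch_set j) (x ` {..<a + b}) T} = {}"
    by (auto simp: reveals_def)
  show ?thesis unfolding none using \<epsilon>_nonneg by simp
qed

text \<open>The additional term \<open>saturation * k / \<rho>\<close>, of order
  \<open>k^2 / n\<close>, is the chance of hitting a single hidden ground element. It determines the
  lower bound.\<close>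

lemma reveal_probability:
  assumes "\<tau> \<in> choices" "j < t"
  shows "real (card {x \<in> fiber \<tau> j. reveals k ground (batch_set j) (x ` {..<a + b}) T})
    \<le> (2 * \<epsilon> + saturation * real k / \<rho>) * real (card (fiber \<tau> j))"
proof (cases "real (card (T \<inter> ground)) < saturation * real k")
  case True
  let ?E1 = "{x \<in> fiber \<tau> j. slack * real k \<le> real (card {l \<in> {..<a}. x l \<in> T})}"
  let ?E2 = "{x \<in> fiber \<tau> j. \<exists>l\<in>{..<a}. x l \<in> T}"
  let ?E3 = "{x \<in> fiber \<tau> j. real (card (T \<inter> batch_set j)) < saturation * real k \<and>
    slack * real k \<le> real (card {l \<in> {a..<a + b}. x l \<in> T})}"
  have E3: "real (card ?E3) \<le> \<epsilon> * real (card (fiber \<tau> j))"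
  proof (cases "real (card (T \<inter> batch_set j)) < saturation * real k")
    case True
    then show ?thesis using fiber_large_batch[OF assms True] by simp
  next
    case False
    then show ?thesis using \<epsilon>_nonneg by simp
  qed
  have "card {x \<in> fiber \<tau> j. reveals k ground (batch_set j) (x ` {..<a + b}) T} \<le> card (?E1 \<union> ?E2 \<union> ?E3)"
    using reveals_selection(2)[of _ \<tau> j T] finite_fiber by (intro card_mono) auto
  also have "\<dots> \<le> card ?E1 + card ?E2 + card ?E3"
    by (intro order_trans[OF card_Un_le] add_right_mono card_Un_le)
  finally have "real (card {x \<in> fiber \<tau> j. reveals k ground (batch_set j) (x ` {..<a + b}) T})
      \<le> real (card ?E1) + real (card ?E2) + real (card ?E3)" by linarith
  also have "\<dots> \<le> \<epsilon> * real (card (fiber \<tau> j)) + saturation * real k / \<rho> * real (card (fiber \<tau> j))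
      + \<epsilon> * real (card (fiber \<tau> j))"
    by (intro add_mono fiber_large_ground fiber_meets_ground assms True E3)
  finally show ?thesis by (simp add: algebra_simps)
next
  case False
  then have none: "{x \<in> fiber \<tau> j. reveals k ground (batch_set j) (x ` {..<a + b}) T} = {}"
    by (auto simp: reveals_def)
  show ?thesis unfolding none using \<epsilon>_nonneg \<rho>_pos by (simp add: saturation_def)
qed

end

section \<open>Runs with a fixed seed\<close>

locale hard_stream_run = hard_stream_probability +
  fixes M :: "'w measure" and alg :: "'w \<Rightarrow> nat set \<Rightarrow> nat strategy" and q :: real and \<omega> :: 'w
  assumes algorithm: "randomized_algorithm n k M alg"
    and cost: "amortized_query_complexity n M alg q" and \<omega>: "\<omega> \<in> space M"
begin

abbreviation "A \<equiv> alg \<omega> universe"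
abbreviation "updates \<tau> \<equiv> stream (hidden \<tau>)"

definition "actual \<tau> = hard_function k t ground batch_set (hidden \<tau>)"
definition "blind j \<tau> = hard_function k t ground batch_set ((hidden \<tau>)(j := {}))"

text \<open>Outputs of earlier batches are included, although the oracle is not asked about them:
  they must not happen to contain much of the ground part of hidden set \<open>j\<close>, which is
  already live. Everything is taken from the blind run and thus independent of
  \<open>\<tau> j\<close>.\<close>

definition early_sets :: "nat \<Rightarrow> (nat \<Rightarrow> nat \<Rightarrow> nat) \<Rightarrow> nat set set" where
  "early_sets j \<tau> = fst ` set (transcript A (blind j \<tau>) (updates \<tau>) (start j))
     \<union> (\<lambda>i. solution A (blind j \<tau>) (updates \<tau>) (stop i)) ` {..<j}"

text \<open>The blind run may ask more than \<open>L\<close> queries in the batch, but a run asking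
  at most \<open>L\<close> can deviate from it only at one of the first \<open>L\<close>. The output
  serves as a final query.\<close>

definition batch_query_sets :: "nat \<Rightarrow> nat \<Rightarrow> (nat \<Rightarrow> nat \<Rightarrow> nat) \<Rightarrow> nat set set" where
  "batch_query_sets L j \<tau> =
     fst ` set (take L (drop (length (transcript A (blind j \<tau>) (updates \<tau>) (start j)))
                         (transcript A (blind j \<tau>) (updates \<tau>) (stop j))))
     \<union> {solution A (blind j \<tau>) (updates \<tau>) (stop j)}"

abbreviation revealed :: "nat \<Rightarrow> (nat \<Rightarrow> nat \<Rightarrow> nat) \<Rightarrow> nat set \<Rightarrow> bool" where
  "revealed j \<tau> T \<equiv> reveals k ground (batch_set j) (hidden \<tau> j) T"

definition "early j = {\<tau> \<in> choices. \<exists>T\<in>early_sets j \<tau>. revealed j \<tau> T}"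
definition "hit L j = {\<tau> \<in> choices. \<exists>T\<in>batch_query_sets L j \<tau>. revealed j \<tau> T}"

lemma finite_universe: "finite universe"
  by (simp add: universe_def)

lemma problem_instances:
  assumes "\<tau> \<in> choices"
  shows "problem_instance n universe (actual \<tau>) (updates \<tau>)"
    and "problem_instance n universe (blind j \<tau>) (updates \<tau>)"
proof -
  interpret hidden_family k t ground batch_set "hidden \<tau>"
    using assms by (rule hidden_family_choice)
  interpret erased: hidden_family k t ground batch_set "(hidden \<tau>)(j := {})"
    by (rule hidden_family_erase)
  have "length (updates \<tau>) = n" "elem ` set (updates \<tau>) \<subseteq> universe"
    using length_stream[of "hidden \<tau>"] elem_stream[of "hidden \<tau>"] card_hidden(2)[OF assms] by auto
  then show "problem_instance n universe (actual \<tau>) (updates \<tau>)"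
    and "problem_instance n universe (blind j \<tau>) (updates \<tau>)"
    unfolding actual_def blind_def using finite_universe
    by (auto intro!: problem_instance_hard_function erased.problem_instance_hard_function)
qed

lemma actual_eq_blind:
  assumes "\<tau> \<in> choices" "j < t" "\<not> revealed j \<tau> T"
  shows "actual \<tau> T = blind j \<tau> T"
proof -
  interpret hidden_family k t ground batch_set "hidden \<tau>"
    using assms(1) by (rule hidden_family_choice)
  show ?thesis unfolding actual_def blind_def by (rule hard_function_erase[OF assms(2,3)])
qed

lemma blind_resample: "j < t \<Longrightarrow> blind j (\<tau>(j := x)) = blind j \<tau>"
  by (simp add: blind_def hidden_sets_fun_upd)

lemma take_updates:
  assumes "\<tau> \<in> choices" "j < t"
  shows "take (start j) (updates \<tau>) = stream_prefix (hidden \<tau>) j"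
    and "take (stop j) (updates \<tau>)
       = stream_prefix (hidden \<tau>) j @ map Insert [batch_start j..<batch_start (Suc j)]"
  using take_stream[OF assms(2), of "hidden \<tau>"] card_hidden(2)[OF assms(1)] by auto

text \<open>The \<open>j\<close>-th hidden set first influences the stream through the deletions
  after \<open>stop j\<close>.\<close>

lemma take_updates_resample:
  assumes "\<tau> \<in> choices" "\<tau>(j := x) \<in> choices" "j < t" "i \<le> stop j"
  shows "take i (updates (\<tau>(j := x))) = take i (updates \<tau>)"
proof -
  have "stream_prefix (hidden (\<tau>(j := x))) j = stream_prefix (hidden \<tau>) j"
    by (rule stream_prefix_cong) (simp add: hidden_sets_fun_upd assms(3))
  then have "take (stop j) (updates (\<tau>(j := x))) = take (stop j) (updates \<tau>)"
    using take_updates(2)[OF assms(1,3)] take_updates(2)[OF assms(2,3)] by simp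
  then have "take i (take (stop j) (updates (\<tau>(j := x)))) = take i (take (stop j) (updates \<tau>))" by simp
  then show ?thesis using assms(4) by (simp add: min_absorb1)
qed

lemma query_sets_resample:
  assumes "\<tau> \<in> choices" "\<tau>(j := x) \<in> choices" "j < t"
  shows "early_sets j (\<tau>(j := x)) = early_sets j \<tau>"
    and "batch_query_sets L j (\<tau>(j := x)) = batch_query_sets L j \<tau>"
proof -
  have tr: "transcript A (blind j (\<tau>(j := x))) (updates (\<tau>(j := x))) i = transcript A (blind j \<tau>) (updates \<tau>) i"
    and sol: "solution A (blind j (\<tau>(j := x))) (updates (\<tau>(j := x))) i = solution A (blind j \<tau>) (updates \<tau>) i"
    if "i \<le> stop j" for i
    unfolding blind_resample[OF assms(3)]
    by (rule transcript_cong solution_cong; rule take_updates_resample[OF assms that])+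
  have early: "stop i \<le> stop j" if "i < j" for i
    using stop_le_start[OF that] start_le_stop[of j] by linarith
  show "early_sets j (\<tau>(j := x)) = early_sets j \<tau>"
    unfolding early_sets_def
    by (intro arg_cong2[where f = "(\<union>)"] image_cong)
      (simp_all add: tr sol early start_le_stop)
  show "batch_query_sets L j (\<tau>(j := x)) = batch_query_sets L j \<tau>"
    unfolding batch_query_sets_def by (simp add: tr sol start_le_stop)
qed

text \<open>Relies on the rule that queries contain only elements that have appeared and outputs
  only live ones.\<close>

lemma early_sets_avoid_batch:
  assumes "\<tau> \<in> choices" "j < t" "T \<in> early_sets j \<tau>"
  shows "T \<inter> batch_set j = {}"
proof -
  have inserted: "{e. Insert e \<in> set (take r (updates \<tau>))} \<subseteq> {..<batch_start j}" if "r \<le> start j" for r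
  proof -
    have "take r (updates \<tau>) = take r (take (start j) (updates \<tau>))" using that by (simp add: min_absorb1)
    then have "set (take r (updates \<tau>)) \<subseteq> set (stream_prefix (hidden \<tau>) j)"
      unfolding take_updates(1)[OF assms(1,2)] by (metis set_take_subset)
    then show ?thesis using inserted_stream_prefix[of "hidden \<tau>" j] by blast
  qed
  have start: "start j \<le> n" using start_le_stop[of j] stop_le_n[OF assms(2)] by linarith
  note inst = problem_instances(2)[OF assms(1), of j]
  have "T \<subseteq> {..<batch_start j}"
    using assms(3) unfolding early_sets_def
  proof
    assume "T \<in> fst ` set (transcript A (blind j \<tau>) (updates \<tau>) (start j))"
    from algorithm_queries_appeared[OF algorithm inst \<omega> start this]
    obtain r where "r \<le> start j" "T \<subseteq> appeared (take r (updates \<tau>))" by blast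
    then show ?thesis
      using order_trans[OF appeared_subset_inserted inserted, of r] by blast
  next
    assume "T \<in> (\<lambda>i. solution A (blind j \<tau>) (updates \<tau>) (stop i)) ` {..<j}"
    then obtain i where i: "i < j" "T = solution A (blind j \<tau>) (updates \<tau>) (stop i)" by blast
    have "stop i \<le> start j" by (rule stop_le_start[OF i(1)])
    moreover from this have "T \<subseteq> live (take (stop i) (updates \<tau>))"
      unfolding i(2) using start by (intro algorithm_solution(1)[OF algorithm inst \<omega> stop_pos]) simp
    ultimately show ?thesis
      using order_trans[OF live_subset_inserted inserted, of "stop i"] by blast
  qed
  moreover have "{..<batch_start j} \<inter> batch_set j = {}" by (auto simp: batch_set_def)
  ultimately show ?thesis by blast
qed

lemma card_early_sets:
  assumes "\<tau> \<in> choices" "j < t"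
  shows "finite (early_sets j \<tau>)" "real (card (early_sets j \<tau>)) \<le> real n * q + real t"
proof -
  let ?tr = "transcript A (blind j \<tau>) (updates \<tau>)"
  show "finite (early_sets j \<tau>)" by (simp add: early_sets_def)
  have "card (early_sets j \<tau>) \<le> card (fst ` set (?tr (start j)))
      + card ((\<lambda>i. solution A (blind j \<tau>) (updates \<tau>) (stop i)) ` {..<j})"
    unfolding early_sets_def by (rule card_Un_le)
  also have "card (fst ` set (?tr (start j))) \<le> length (?tr (start j))"
    by (metis card_length length_map list.set_map)
  also have "length (?tr (start j)) \<le> length (?tr n)"
    using start_le_stop[of j] stop_le_n[OF assms(2)] by (intro length_transcript_mono) simp
  also have "card ((\<lambda>i. solution A (blind j \<tau>) (updates \<tau>) (stop i)) ` {..<j}) \<le> t"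
    using card_image_le[of "{..<j}"] assms(2) by (metis card_lessThan finite_lessThan less_imp_le order_trans)
  finally have "card (early_sets j \<tau>) \<le> length (?tr n) + t" by simp
  moreover have "real (length (?tr n)) \<le> real n * q"
    using cost problem_instances(2)[OF assms(1)] \<omega> by (simp add: amortized_query_complexity_def)
  ultimately show "real (card (early_sets j \<tau>)) \<le> real n * q + real t" by linarith
qed

lemma card_batch_query_sets:
  "finite (batch_query_sets L j \<tau>)" "card (batch_query_sets L j \<tau>) \<le> L + 1"
proof -
  let ?xs = "take L (drop (length (transcript A (blind j \<tau>) (updates \<tau>) (start j)))
                       (transcript A (blind j \<tau>) (updates \<tau>) (stop j)))"
  show "finite (batch_query_sets L j \<tau>)" by (simp add: batch_query_sets_def)
  have "card (batch_query_sets L j \<tau>) \<le> card (fst ` set ?xs) + 1"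
    unfolding batch_query_sets_def by (rule order_trans[OF card_Un_le]) simp
  also have "card (fst ` set ?xs) \<le> length ?xs" by (metis card_length length_map list.set_map)
  also have "length ?xs \<le> L" by simp
  finally show "card (batch_query_sets L j \<tau>) \<le> L + 1" by simp
qed

text \<open>\<open>W\<close> is constant on each fiber, so a union bound over its members is valid
  conditionally on the other batches.\<close>

lemma resample_bound:
  assumes "j < t" "\<And>\<tau>. \<tau> \<in> choices \<Longrightarrow> finite (W \<tau>)" "\<And>\<tau>. \<tau> \<in> choices \<Longrightarrow> real (card (W \<tau>)) \<le> c"
    and "\<And>\<tau> x. \<tau> \<in> choices \<Longrightarrow> \<tau>(j := x) \<in> choices \<Longrightarrow> W (\<tau>(j := x)) = W \<tau>"
    and "\<And>\<tau> T. \<tau> \<in> choices \<Longrightarrow> T \<in> W \<tau> \<Longrightarrow>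
      real (card {x \<in> fiber \<tau> j. reveals k ground (batch_set j) (x ` {..<a + b}) T}) \<le> d * real (card (fiber \<tau> j))"
    and "0 \<le> d"
  shows "real (card {\<tau> \<in> choices. \<exists>T\<in>W \<tau>. revealed j \<tau> T}) \<le> c * d * real (card choices)"
proof (rule card_resample[OF finite_choices, where j = j])
  fix \<tau> assume \<tau>: "\<tau> \<in> choices"
  have hid: "hidden (\<tau>(j := x)) j = x ` {..<a + b}" for x
    using assms(1) by (simp add: hidden_sets_fun_upd)
  have eq: "{x. \<tau>(j := x) \<in> choices \<and> (\<exists>T\<in>W (\<tau>(j := x)). revealed j (\<tau>(j := x)) T)}
      = {x \<in> fiber \<tau> j. \<exists>T\<in>W \<tau>. reveals k ground (batch_set j) (x ` {..<a + b}) T}"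
    using fiber_eq[OF \<tau> assms(1)] assms(4)[OF \<tau>] unfolding hid by blast
  have "real (card {x \<in> fiber \<tau> j. \<exists>T\<in>W \<tau>. reveals k ground (batch_set j) (x ` {..<a + b}) T})
      \<le> real (card (W \<tau>)) * (d * real (card (fiber \<tau> j)))"
    by (rule card_Bex_le[OF finite_fiber assms(2)[OF \<tau>] assms(5)[OF \<tau>]])
  also have "\<dots> \<le> c * (d * real (card (fiber \<tau> j)))"
    using assms(3)[OF \<tau>] assms(6) by (intro mult_right_mono) auto
  finally show "real (card {x. \<tau>(j := x) \<in> choices \<and> (\<exists>T\<in>W (\<tau>(j := x)). revealed j (\<tau>(j := x)) T)})
      \<le> c * d * real (card {x. \<tau>(j := x) \<in> choices})"
    unfolding eq fiber_eq[OF \<tau> assms(1)] by (simp only: mult.assoc)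
qed

lemma card_early:
  assumes "j < t"
  shows "real (card (early j)) \<le> (real n * q + real t) * \<epsilon> * real (card choices)"
  unfolding early_def
proof (rule resample_bound[where W = "early_sets j"])
  show "real (card {x \<in> fiber \<tau> j. reveals k ground (batch_set j) (x ` {..<a + b}) T})
      \<le> \<epsilon> * real (card (fiber \<tau> j))" if "\<tau> \<in> choices" "T \<in> early_sets j \<tau>" for \<tau> T
    by (rule reveal_probability_early[OF that(1) assms early_sets_avoid_batch[OF that(1) assms that(2)]])
  show "early_sets j (\<tau>(j := x)) = early_sets j \<tau>" if "\<tau> \<in> choices" "\<tau>(j := x) \<in> choices" for \<tau> x
    by (rule query_sets_resample(1)[OF that assms])
qed (use assms in \<open>auto intro!: card_early_sets \<epsilon>_nonneg\<close>)

lemma card_hit: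
  assumes "j < t"
  shows "real (card (hit L j)) \<le> real (L + 1) * (2 * \<epsilon> + saturation * real k / \<rho>) * real (card choices)"
  unfolding hit_def
proof (rule resample_bound[where W = "batch_query_sets L j"])
  show "real (card (batch_query_sets L j \<tau>)) \<le> real (L + 1)" for \<tau>
    using card_batch_query_sets(2) by (simp only: of_nat_le_iff)
  show "0 \<le> 2 * \<epsilon> + saturation * real k / \<rho>"
    using \<epsilon>_nonneg \<rho>_pos by (simp add: saturation_def)
  show "batch_query_sets L j (\<tau>(j := x)) = batch_query_sets L j \<tau>"
    if "\<tau> \<in> choices" "\<tau>(j := x) \<in> choices" for \<tau> x
    by (rule query_sets_resample(2)[OF that assms])
qed (use assms in \<open>auto intro!: card_batch_query_sets reveal_probability\<close>)

definition "batch_queries j \<tau> =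
  length (transcript A (actual \<tau>) (updates \<tau>) (stop j)) - length (transcript A (actual \<tau>) (updates \<tau>) (start j))"

lemma transcript_before_batch:
  assumes "\<tau> \<in> choices" "j < t" "\<tau> \<notin> early j"
  shows "transcript A (actual \<tau>) (updates \<tau>) (start j) = transcript A (blind j \<tau>) (updates \<tau>) (start j)"
proof (rule ccontr)
  assume "\<not> ?thesis"
  then obtain m where m: "m < length (transcript A (blind j \<tau>) (updates \<tau>) (start j))"
    "actual \<tau> (fst (transcript A (blind j \<tau>) (updates \<tau>) (start j) ! m))
       \<noteq> blind j \<tau> (fst (transcript A (blind j \<tau>) (updates \<tau>) (start j) ! m))"
    using transcript_diff by blast
  then have "fst (transcript A (blind j \<tau>) (updates \<tau>) (start j) ! m) \<in> early_sets j \<tau>"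
    by (simp add: early_sets_def)
  then show False using assms actual_eq_blind[OF assms(1,2)] m(2) by (auto simp: early_def)
qed

lemma transcript_after_batch:
  assumes "\<tau> \<in> choices" "j < t" "\<tau> \<notin> early j" "\<tau> \<notin> hit L j" "batch_queries j \<tau> \<le> L"
  shows "transcript A (actual \<tau>) (updates \<tau>) (stop j) = transcript A (blind j \<tau>) (updates \<tau>) (stop j)"
proof (rule ccontr)
  assume "\<not> ?thesis"
  let ?tr = "transcript A (blind j \<tau>) (updates \<tau>)"
  from \<open>\<not> ?thesis\<close> obtain m where m: "m < length (?tr (stop j))"
    "m < length (transcript A (actual \<tau>) (updates \<tau>) (stop j))"
    "actual \<tau> (fst (?tr (stop j) ! m)) \<noteq> blind j \<tau> (fst (?tr (stop j) ! m))"
    using transcript_diff by blast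
  obtain ys where ys: "?tr (stop j) = ?tr (start j) @ ys"
    using transcript_prefix[OF start_le_stop] by blast
  have "fst (?tr (stop j) ! m) \<in> early_sets j \<tau> \<union> batch_query_sets L j \<tau>"
  proof (cases "m < length (?tr (start j))")
    case True
    then show ?thesis by (simp add: ys nth_append early_sets_def)
  next
    case False
    \<comment> \<open>Uses the length of the actual run, which agrees with the blind one before the
      batch.\<close>
    have "m < length (?tr (start j)) + L"
      using m(2) assms(5) transcript_before_batch[OF assms(1-3)] by (simp add: batch_queries_def)
    then have "?tr (stop j) ! m \<in> set (take L ys)"
      using False m(1) by (auto simp: ys nth_append in_set_conv_nth intro!: exI[of _ "m - length (?tr (start j))"])
    then show ?thesis by (auto simp: batch_query_sets_def ys)
  qed
  then show False using assms(1-4) actual_eq_blind[OF assms(1,2)] m(3) by (auto simp: early_def hit_def)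
qed

text \<open>The output is that of the blind run and does not reveal, so its value is generic.
  Earlier hidden sets cannot help because their ground parts are deleted, later ones because the
  output belongs to their \<open>early_sets\<close>.\<close>

lemma solution_fails:
  assumes \<tau>: "\<tau> \<in> choices" and j: "j < t" and early: "\<And>i. i < t \<Longrightarrow> \<tau> \<notin> early i"
    and hit: "\<tau> \<notin> hit L j" and few: "batch_queries j \<tau> \<le> L"
  shows "actual \<tau> (solution A (actual \<tau>) (updates \<tau>) (stop j))
       < 0.584 * OPT k (actual \<tau>) (live (take (stop j) (updates \<tau>)))"
proof -
  interpret hidden_family k t ground batch_set "hidden \<tau>"
    using \<tau> by (rule hidden_family_choice)
  interpret erased: hidden_family k t ground batch_set "(hidden \<tau>)(j := {})"
    by (rule hidden_family_erase)
  let ?S = "solution A (actual \<tau>) (updates \<tau>) (stop j)"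
  note inst = problem_instances(1)[OF \<tau>]
  have live: "live (take (stop j) (updates \<tau>)) = (ground - (\<Union>i<j. hidden \<tau> i)) \<union> batch_set j"
    unfolding take_updates(2)[OF \<tau> j] live_append live_stream_prefix foldl_Insert
    by (simp add: batch_set_def)
  have S: "?S \<subseteq> (ground - (\<Union>i<j. hidden \<tau> i)) \<union> batch_set j" "card ?S \<le> k"
    using algorithm_solution[OF algorithm inst \<omega> stop_pos stop_le_n[OF j]] live by auto
  have finS: "finite ?S"
    using S(1) by (rule finite_subset) (simp add: ground_def batch_set_def)
  have "?S = solution A (blind j \<tau>) (updates \<tau>) (stop j)"
    by (rule solution_eq[OF transcript_after_batch[OF \<tau> j early[OF j] hit few] stop_pos])
  then have "\<not> revealed j \<tau> ?S"
    using hit \<tau> by (auto simp: hit_def batch_query_sets_def)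
  then have "actual \<tau> ?S = blind j \<tau> ?S" by (rule actual_eq_blind[OF \<tau> j])
  also have "\<dots> \<le> 58392 / 100000"
    unfolding blind_def
  proof (rule erased.hard_function_generic_solution[OF j _ S(2) finS ground_batch_disjoint])
    fix i assume i: "i < t" "i \<noteq> j"
    show "?S \<inter> batch_set i = {}"
      using S(1) ground_batch_disjoint[of i] batch_set_disjoint[OF i(2)] by blast
    have "real (card (?S \<inter> (hidden \<tau> i \<inter> ground))) \<le> slack * real k"
    proof (cases "i < j")
      case True
      then have "?S \<inter> (hidden \<tau> i \<inter> ground) = {}" using S(1) ground_batch_disjoint[of j] by blast
      then show ?thesis using slack_pos by simp
    next
      case False
      then have "j < i" using i(2) by simp
      \<comment> \<open>Compares with the run blind to the later batch \<open>i\<close>; the judged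
        round precedes \<open>start i\<close>.\<close>
      have "transcript A (actual \<tau>) (updates \<tau>) (stop j) = transcript A (blind i \<tau>) (updates \<tau>) (stop j)"
        by (rule transcript_eq_prefix[OF transcript_before_batch[OF \<tau> i(1) early[OF i(1)]]
              stop_le_start[OF \<open>j < i\<close>]])
      then have "?S = solution A (blind i \<tau>) (updates \<tau>) (stop j)"
        by (rule solution_eq[OF _ stop_pos])
      then have "?S \<in> early_sets i \<tau>" using \<open>j < i\<close> by (auto simp: early_sets_def)
      then have "\<not> revealed i \<tau> ?S" using early[OF i(1)] \<tau> by (auto simp: early_def)
      moreover have "real (card (?S \<inter> ground)) < saturation * real k"
      proof -
        have "card (?S \<inter> ground) \<le> k" using S(2) card_mono[OF finS, of "?S \<inter> ground"] by simp
        then show ?thesis using k_pos by (simp add: saturation_def)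
      qed
      ultimately show ?thesis by (auto simp: reveals_def not_less)
    qed
    then show "real (card (?S \<inter> (((hidden \<tau>)(j := {})) i \<inter> ground))) \<le> slack * real k"
      using i(2) by simp
  qed simp
  \<comment> \<open>\<open>0.584 * 0.9999 = 0.5839416\<close>, just above
    \<open>0.58392\<close>.\<close>
  also have "\<dots> < 0.584 * (1 - cutoff)" by (simp add: cutoff_def)
  also have "1 - cutoff = actual \<tau> (hidden \<tau> j)"
    unfolding actual_def using k a(2) b(2) card_hidden(2,3)[OF \<tau> j]
    by (intro hard_function_hidden_set[OF j, symmetric]) auto
  also have "0.584 * actual \<tau> (hidden \<tau> j) \<le> 0.584 * OPT k (actual \<tau>) (live (take (stop j) (updates \<tau>)))"
  proof (rule mult_left_mono)
    have "hidden \<tau> j \<subseteq> (ground - (\<Union>i<j. hidden \<tau> i)) \<union> batch_set j"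
    proof -
      have "hidden \<tau> j \<inter> hidden \<tau> i = {}" if "i < j" for i
        using hidden_disjoint[OF \<tau>, of j i] that by simp
      then show ?thesis using hidden_subset[OF \<tau> j] by blast
    qed
    then show "actual \<tau> (hidden \<tau> j) \<le> OPT k (actual \<tau>) (live (take (stop j) (updates \<tau>)))"
      unfolding live using card_hidden(1)[OF \<tau> j] ab_le_k
      by (intro le_OPT) (auto simp: ground_def batch_set_def)
  qed simp
  finally show ?thesis .
qed

end

text \<open>An instance is bad as soon as one batch is revealed early: the output for a batch is
  analysed relative to all later batches as well.\<close>

lemma (in hard_stream_probability) hard_stream_cost:
  assumes algorithm: "randomized_algorithm n k M (alg :: 'w \<Rightarrow> nat set \<Rightarrow> nat strategy)"
    and guarantee: "achieves_guarantee n k M alg 0.584"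
    and cost: "amortized_query_complexity n M alg q"
    and small: "real t * ((real n * q + real t) * \<epsilon>) \<le> 1 / 12"
      "real (L + 1) * (2 * \<epsilon> + saturation * real k / \<rho>) \<le> 1 / 8"
  shows "real (L + 1) * real t \<le> 2 * (real n * q)"
proof -
  let ?f = "\<lambda>\<tau>. hard_function k t ground batch_set (hidden \<tau>)" and ?us = "\<lambda>\<tau>. stream (hidden \<tau>)"
  have inst: "problem_instance n universe (?f \<tau>) (?us \<tau>)" if "\<tau> \<in> choices" for \<tau>
  proof -
    interpret hidden_family k t ground batch_set "hidden \<tau>"
      using that by (rule hidden_family_choice)
    show ?thesis
      using length_stream[of "hidden \<tau>"] elem_stream[of "hidden \<tau>"] card_hidden(2)[OF that]
      by (intro problem_instance_hard_function) (auto simp: universe_def)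
  qed
  obtain \<omega> where seed: "\<omega> \<in> space M"
    "2 / 3 * real (card choices) \<le> real (card {\<tau> \<in> choices. \<forall>i\<in>{1..n}.
       0.584 * OPT k (?f \<tau>) (live (take i (?us \<tau>))) \<le> ?f \<tau> (solution (alg \<omega> universe) (?f \<tau>) (?us \<tau>) i)})"
    using good_seed_for_instances[OF algorithm guarantee finite_choices choices_nonempty[OF w_pos], of universe ?f ?us]
      inst by blast
  interpret hard_stream_run n k t p w a b \<rho> \<epsilon> M alg q \<omega>
    using algorithm cost seed(1) by unfold_locales
  define Succ where "Succ = {\<tau> \<in> choices. \<forall>i\<in>{1..n}.
       0.584 * OPT k (actual \<tau>) (live (take i (updates \<tau>))) \<le> actual \<tau> (solution A (actual \<tau>) (updates \<tau>) i)}"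
  let ?Bad = "\<Union>j<t. early j"
  show ?thesis
  proof (rule batch_counting[OF finite_choices choices_nonempty[OF w_pos],
        where Succ = Succ and Bad = ?Bad and Hit = "hit L" and q = batch_queries])
    show "2 / 3 * real (card choices) \<le> real (card Succ)"
      using seed(2) by (simp add: Succ_def actual_def)
    show "real (card ?Bad) \<le> real (card choices) / 12"
    proof -
      have "real (card ?Bad) \<le> (\<Sum>j<t. real (card (early j)))"
        using card_UN_le[of "{..<t}" early] by (simp only: of_nat_sum[symmetric] of_nat_le_iff finite_lessThan)
      also have "\<dots> \<le> (\<Sum>j<t. (real n * q + real t) * \<epsilon> * real (card choices))"
        by (intro sum_mono card_early) simp
      also have "\<dots> = real t * ((real n * q + real t) * \<epsilon>) * real (card choices)" by simp
      also have "\<dots> \<le> 1 / 12 * real (card choices)" by (intro mult_right_mono small) simp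
      finally show ?thesis by simp
    qed
    show "real (card (hit L j)) \<le> real (card choices) / 8" if "j < t" for j
      using order_trans[OF card_hit[OF that, of L] mult_right_mono[OF small(2), of "real (card choices)"]]
      by simp
    show "real (\<Sum>j<t. batch_queries j \<tau>) \<le> real n * q" if "\<tau> \<in> choices" for \<tau>
      unfolding batch_queries_def
      by (rule sum_batch_queries_le[OF cost problem_instances(1)[OF that] seed(1) start_le_stop stop_le_start_Suc start_t_le])
    show "\<tau> \<in> hit L j" if "\<tau> \<in> Succ" "\<tau> \<notin> ?Bad" "j < t" "batch_queries j \<tau> \<le> L" for \<tau> j
    proof (rule ccontr)
      assume "\<tau> \<notin> hit L j"
      with that have "actual \<tau> (solution A (actual \<tau>) (updates \<tau>) (stop j))
          < 0.584 * OPT k (actual \<tau>) (live (take (stop j) (updates \<tau>)))"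
        by (intro solution_fails) (auto simp: Succ_def)
      moreover have "stop j \<in> {1..n}" using stop_pos stop_le_n[OF that(3)] by simp
      then have "0.584 * OPT k (actual \<tau>) (live (take (stop j) (updates \<tau>)))
          \<le> actual \<tau> (solution A (actual \<tau>) (updates \<tau>) (stop j))"
        using that(1) unfolding Succ_def by blast
      ultimately show False by linarith
    qed
  qed (auto simp: Succ_def early_def hit_def)
qed

section \<open>The lower bound\<close>

lemma div_ge_half:
  fixes n d :: nat
  assumes "0 < d" "d \<le> n"
  shows "real n / (2 * real d) \<le> real (n div d)"
proof -
  have "n < d * (n div d) + d"
    using mod_less_divisor[OF assms(1), of n] mult_div_mod_eq[of d n] by linarith
  moreover have "1 \<le> n div d" using div_le_mono[OF assms(2), of d] assms(1) by simp
  then have "d \<le> d * (n div d)" by simp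
  ultimately have "n \<le> 2 * (d * (n div d))" by linarith
  then have "real n \<le> 2 * (real d * real (n div d))" by (metis of_nat_le_iff of_nat_mult of_nat_numeral)
  then show ?thesis using assms(1) by (simp add: field_simps)
qed

lemma floor_share:
  fixes c :: real
  assumes "0 \<le> c"
  shows "real (nat \<lfloor>c * real k\<rfloor>) \<le> c * real k" "c * real k - 1 \<le> real (nat \<lfloor>c * real k\<rfloor>)"
  using assms by (auto simp: of_nat_nat)

text \<open>In this range \<open>n / k^3\<close> is \<open>O(1 / k)\<close>, and one query in a
  constant fraction of the \<open>n / (2 k)\<close> batches already costs
  \<open>\<Omega>(1 / k)\<close> per update.\<close>

lemma cost_when_few_elements:
  fixes n k :: nat
  assumes k: "200000 \<le> k" "2 * k \<le> n" and n: "real n \<le> 20000000 * real k ^ 2"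
    and alg: "randomized_algorithm n k M (alg :: real \<Rightarrow> nat set \<Rightarrow> nat strategy)"
    and guar: "achieves_guarantee n k M alg 0.584"
    and cost: "amortized_query_complexity n M alg q"
  shows "1 / 10 ^ 12 * (real n / real k ^ 3) \<le> q"
proof -
  have pos: "0 < real k" "0 < real n" using k by auto
  have "real n / (2 * real (2 * k)) \<le> real (n div (2 * k))"
    using k by (intro div_ge_half) auto
  also have "\<dots> \<le> 2 * (real n * q)"
    using k by (intro query_needed_in_most_batches[OF _ _ alg guar cost]) auto
  finally have "real n * (1 / (4 * real k)) \<le> real n * (2 * q)" by simp
  then have q: "1 / (8 * real k) \<le> q" using pos by (subst (asm) mult_le_cancel_left_pos) (auto simp: field_simps)
  have "1 / 10 ^ 12 * (real n / real k ^ 3) \<le> 1 / 10 ^ 12 * (20000000 * real k ^ 2 / real k ^ 3)"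
    using n pos by (intro mult_left_mono divide_right_mono) auto
  also have "\<dots> = 1 / (50000 * real k)"
    using pos by (simp add: power2_eq_square power3_eq_cube field_simps)
  also have "\<dots> \<le> 1 / (8 * real k)" using pos by (intro divide_left_mono) auto
  finally show ?thesis using q by simp
qed

lemma cost_when_many_elements:
  fixes n k :: nat
  assumes large: "200000 \<le> k" "500000 * ln (real n) \<le> real k" and n: "20000000 * real k ^ 2 \<le> real n"
    and alg: "randomized_algorithm n k M (alg :: real \<Rightarrow> nat set \<Rightarrow> nat strategy)"
    and guar: "achieves_guarantee n k M alg 0.584"
    and cost: "amortized_query_complexity n M alg q"
  shows "1 / 10 ^ 12 * (real n / real k ^ 3) \<le> q"
proof (rule ccontr)
  assume "\<not> ?thesis"
  then have q: "q < 1 / 10 ^ 12 * (real n / real k ^ 3)" by simp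
  \<comment> \<open>Makes \<open>saturation / w = 1/200000\<close>, a third of the decay rate
    \<open>slack * (2/3) = 3/200000\<close>; the rest gives \<open>\<epsilon>\<close>.\<close>
  define w :: nat where "w = 4000000"
  define p where "p = n div (2 * k)"
  \<comment> \<open>\<open>16000002 * k = 2 * (2 * k * w + k)\<close>: the batches use at most half
    of the stream, as does the ground set with \<open>p\<close>.\<close>
  define t where "t = n div (16000002 * k)"
  define a where "a = nat \<lfloor>alpha * real k\<rfloor>"
  define b where "b = nat \<lfloor>beta * real k\<rfloor>"
  define \<rho> where "\<rho> = real n / (4 * real k)"
  define \<epsilon> where "\<epsilon> = exp (- (real k / 100000))"
  \<comment> \<open>\<open>648 = 8 * 81\<close>: a query succeeds with probability at most
    \<open>81 k^2 / n\<close>, and \<open>L + 1\<close> of them may reach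
    \<open>1/8\<close>.\<close>
  define L where "L = nat \<lfloor>real n / (648 * real k ^ 2)\<rfloor> - 1"
  have kpos: "1 \<le> real k" "0 < real k" using large by auto
  have "real k * 1 \<le> real k ^ 2" unfolding power2_eq_square using kpos by (intro mult_left_mono) auto
  then have nk: "20000000 * real k \<le> real n" using n by linarith
  then have npos: "20000000 \<le> real n" using kpos by linarith
  have nk': "20000000 * k \<le> n" using nk by linarith
  have p_le: "2 * k * p \<le> n" unfolding p_def by (metis div_times_less_eq_dividend mult.commute)
  have t_le: "16000002 * k * t \<le> n" unfolding t_def by (metis div_times_less_eq_dividend mult.commute)
  have p_ge: "real n / (2 * real k) - 1 \<le> real p"
  proof -
    have "n < 2 * k * p + 2 * k"
      unfolding p_def using mod_less_divisor[of "2 * k" n] mult_div_mod_eq[of "2 * k" n] large by linarith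
    then have "real n < 2 * real k * real p + 2 * real k"
      by (metis of_nat_less_iff of_nat_add of_nat_mult of_nat_numeral)
    then show ?thesis using kpos by (simp add: field_simps)
  qed
  have t_le': "real t \<le> real n / (16000002 * real k)"
  proof -
    have "16000002 * real k * real t \<le> real n"
      using t_le by (metis of_nat_le_iff of_nat_mult of_nat_numeral)
    then show ?thesis using kpos by (simp add: field_simps)
  qed
  have share: "real a \<le> alpha * real k" "alpha * real k - 1 \<le> real a"
    "real b \<le> beta * real k" "beta * real k - 1 \<le> real b"
    unfolding a_def b_def by (rule floor_share; simp add: alpha_def beta_def)+
  have ab: "a \<le> k" "b \<le> k"
  proof -
    have "alpha * real k \<le> 1 * real k" "beta * real k \<le> 1 * real k"
      by (rule mult_right_mono; simp add: alpha_def beta_def)+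
    then show "a \<le> k" "b \<le> k" using share by linarith+
  qed
  have \<rho>: "\<rho> + real t \<le> real p"
  proof -
    define x where "x = real n / real k"
    have "20000000 \<le> x" using nk kpos by (simp add: x_def field_simps)
    moreover have "x / 2 - 1 \<le> real p" "\<rho> = x / 4" "real t \<le> x / 16000002"
      using p_ge t_le' by (simp_all add: \<rho>_def x_def mult.commute)
    ultimately show ?thesis by linarith
  qed
  have \<rho>_pos: "0 < \<rho>" using npos kpos by (simp add: \<rho>_def)
  have sat_\<rho>: "saturation * real k / \<rho> = 80 * real k ^ 2 / real n"
    by (simp add: \<rho>_def saturation_def power2_eq_square)
  have sat_small: "80 * real k ^ 2 / real n \<le> 1" using n npos by (simp add: field_simps)
  have two: "2 powr (- (slack * real k)) \<le> exp (- (3 / 200000 * real k))"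
  proof -
    have "slack * real k * (2 / 3) \<le> slack * real k * ln 2"
      using ln2_ge_two_thirds slack_pos by (intro mult_left_mono) auto
    then show ?thesis by (simp add: powr_def slack_def cutoff_def beta_def)
  qed
  interpret hard_stream_probability n k t p w a b \<rho> \<epsilon>
  proof
    show "a * p + t * (2 * (b * w) + a) \<le> n"
    proof -
      have "2 * (a * p) \<le> 2 * k * p" using ab by (simp add: mult_right_mono)
      moreover have "t * (2 * (b * w) + a) \<le> t * (2 * (k * w) + k)"
        using ab by (intro mult_left_mono add_mono) (auto simp: mult_right_mono)
      moreover have "2 * (t * (2 * (k * w) + k)) = 16000002 * k * t"
        by (simp add: w_def algebra_simps)
      ultimately show ?thesis using p_le t_le by linarith
    qed
    show "0 < p" using \<rho> \<rho>_pos by (cases p) auto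
    show "t \<le> p" using \<rho> \<rho>_pos by linarith
    have "2 powr (- (slack * real k)) * exp (saturation * real k / \<rho>)
        \<le> exp (- (3 / 200000 * real k)) * exp 1"
      unfolding sat_\<rho> using two sat_small by (intro mult_mono) auto
    also have "\<dots> = exp (- (3 / 200000 * real k) + 1)" by (simp only: exp_add)
    also have "\<dots> \<le> \<epsilon>" unfolding \<epsilon>_def using large by (subst exp_le_cancel_iff) simp
    finally show "2 powr (- (slack * real k)) * exp (saturation * real k / \<rho>) \<le> \<epsilon>" .
    have "2 powr (- (slack * real k)) * exp (saturation * real k / real w)
        \<le> exp (- (3 / 200000 * real k)) * exp (real k / 200000)"
      using two by (intro mult_mono) (auto simp: saturation_def w_def)
    also have "\<dots> = \<epsilon>" by (simp add: \<epsilon>_def flip: exp_add)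
    finally show "2 powr (- (slack * real k)) * exp (saturation * real k / real w) \<le> \<epsilon>" .
  qed (use large share \<rho> \<rho>_pos in \<open>auto simp: w_def\<close>)
  \<comment> \<open>The constant \<open>500000\<close> is 5 times the \<open>100000\<close> in
    \<open>\<epsilon>\<close>. The power 5 suffices against
    \<open>t * (n * q + t) \<le> 2 n^3\<close>.\<close>
  have \<epsilon>: "\<epsilon> \<le> 1 / real n ^ 5"
  proof -
    have "5 * ln (real n) \<le> real k / 100000" using large(2) by simp
    then have "\<epsilon> \<le> exp (- (5 * ln (real n)))" by (simp add: \<epsilon>_def)
    also have "5 * ln (real n) = ln (real n ^ 5)" using npos by (simp add: ln_realpow)
    also have "exp (- ln (real n ^ 5)) = 1 / real n ^ 5" using npos by (simp add: exp_minus field_simps)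
    finally show ?thesis .
  qed
  have q_le: "q \<le> real n"
  proof -
    have "real n / real k ^ 3 \<le> real n / 1" using kpos by (intro divide_left_mono) auto
    then show ?thesis using q npos by simp
  qed
  have t_n: "real t \<le> real n"
  proof -
    have "real n / (16000002 * real k) \<le> real n / 1" using kpos by (intro divide_left_mono) auto
    then show ?thesis using t_le' by simp
  qed
  have small1: "real t * ((real n * q + real t) * \<epsilon>) \<le> 1 / 12"
  proof -
    have "real n * q + real t \<le> real n * real n + real n * real n"
    proof (rule add_mono)
      show "real n * q \<le> real n * real n" using q_le by (intro mult_left_mono) auto
      have "real n * 1 \<le> real n * real n" using npos by (intro mult_left_mono) auto
      then show "real t \<le> real n * real n" using t_n by simp
    qed
    then have "(real n * q + real t) * \<epsilon> \<le> (real n * real n + real n * real n) * \<epsilon>"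
      using \<epsilon>_nonneg by (rule mult_right_mono)
    also have "\<dots> \<le> (real n * real n + real n * real n) * (1 / real n ^ 5)"
      using \<epsilon> by (rule mult_left_mono) simp
    finally have "real t * ((real n * q + real t) * \<epsilon>)
        \<le> real t * ((real n * real n + real n * real n) * (1 / real n ^ 5))"
      by (rule mult_left_mono) simp
    also have "\<dots> \<le> real n * ((real n * real n + real n * real n) * (1 / real n ^ 5))"
      using t_n by (rule mult_right_mono) simp
    also have "\<dots> = 2 / real n ^ 2"
    proof -
      have "x ^ 5 = x * (x * x) * x ^ 2" for x :: real by (simp add: eval_nat_numeral)
      moreover have "0 < real n" using npos by linarith
      ultimately show ?thesis by (simp add: field_simps)
    qed
    also have "\<dots> \<le> 1 / 12"
    proof -
      have "(5 :: real) ^ 2 \<le> real n ^ 2" using npos by (intro power_mono) linarith+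
      then have "2 / real n ^ 2 \<le> 2 / 5 ^ 2" using npos by (intro divide_left_mono) auto
      then show ?thesis by simp
    qed
    finally show ?thesis .
  qed
  have x1: "1 \<le> real n / (648 * real k ^ 2)" using n kpos by (simp add: field_simps)
  have L: "real (L + 1) \<le> real n / (648 * real k ^ 2)" "real n / (1296 * real k ^ 2) \<le> real (L + 1)"
  proof -
    define x where "x = real n / (648 * real k ^ 2)"
    have "1 \<le> x" using x1 by (simp add: x_def)
    then have "1 \<le> \<lfloor>x\<rfloor>" by (simp add: le_floor_iff)
    then have "int (L + 1) = \<lfloor>x\<rfloor>" unfolding L_def x_def[symmetric] by linarith
    then have "real (L + 1) = real_of_int \<lfloor>x\<rfloor>" by (metis of_int_of_nat_eq)
    moreover have "real_of_int \<lfloor>x\<rfloor> \<le> x" by (rule of_int_floor_le)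
    moreover have "x / 2 \<le> real_of_int \<lfloor>x\<rfloor>" using \<open>1 \<le> \<lfloor>x\<rfloor>\<close> by linarith
    moreover have "real n / (1296 * real k ^ 2) = x / 2" by (simp add: x_def)
    ultimately show "real (L + 1) \<le> real n / (648 * real k ^ 2)" "real n / (1296 * real k ^ 2) \<le> real (L + 1)"
      unfolding x_def[symmetric] by linarith+
  qed
  have small2: "real (L + 1) * (2 * \<epsilon> + saturation * real k / \<rho>) \<le> 1 / 8"
  proof -
    have "2 * \<epsilon> \<le> 2 * (1 / real n ^ 5)" using \<epsilon> by simp
    also have "\<dots> = (2 / real n ^ 4) / real n" by (simp add: eval_nat_numeral)
    also have "\<dots> \<le> real k ^ 2 / real n"
    proof (rule divide_right_mono)
      have "(2 :: real) \<le> 20000000 ^ 4" by simp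
      also have "\<dots> \<le> real n ^ 4" using npos by (intro power_mono) auto
      finally have "2 / real n ^ 4 \<le> 1" using npos by (simp add: field_simps)
      also have "1 \<le> real k ^ 2" using kpos by simp
      finally show "2 / real n ^ 4 \<le> real k ^ 2" .
    qed simp
    finally have "2 * \<epsilon> + saturation * real k / \<rho> \<le> 81 * (real k ^ 2 / real n)"
      unfolding sat_\<rho> by simp
    then have "real (L + 1) * (2 * \<epsilon> + saturation * real k / \<rho>)
        \<le> real n / (648 * real k ^ 2) * (81 * (real k ^ 2 / real n))"
      using L(1) \<epsilon>_nonneg \<rho>_pos by (intro mult_mono) (auto simp: saturation_def)
    also have "\<dots> = 1 / 8" using kpos npos by (simp add: field_simps)
    finally show ?thesis .
  qed
  have "real n / (1296 * real k ^ 2) * (real n / (2 * real (16000002 * k))) \<le> real (L + 1) * real t"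
    unfolding t_def using L(2) nk' large by (intro mult_mono div_ge_half) auto
  also have "\<dots> \<le> 2 * (real n * q)"
    by (rule hard_stream_cost[OF alg guar cost small1 small2])
  also have "\<dots> < 2 * (real n * (1 / 10 ^ 12 * (real n / real k ^ 3)))"
    using q npos by (intro mult_strict_left_mono) auto
  \<comment> \<open>\<open>41472005184 = 1296 * 2 * 16000002\<close>, well below the
    \<open>5 * 10^11\<close> coming from \<open>10^12 / 2\<close>.\<close>
  finally have "real n ^ 2 / real k ^ 3 * (1 / 41472005184) < real n ^ 2 / real k ^ 3 * (1 / 500000000000)"
    by (simp add: power2_eq_square power3_eq_cube field_simps)
  moreover have "0 < real n ^ 2 / real k ^ 3" using npos kpos by simp
  ultimately have "(1 :: real) / 41472005184 < 1 / 500000000000"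
    by (subst (asm) mult_less_cancel_left_pos) auto
  then show False by simp
qed

theorem theorem1p2:
  "\<exists>C::real. C > 0 \<and> (\<exists>c::real. c > 0 \<and>
     (\<forall>(n::nat) (k::nat). 1 \<le> k \<and> 2 * k \<le> n \<and> real k \<ge> C * ln (real n) \<longrightarrow>
       (\<forall>(M :: real measure) (alg :: real \<Rightarrow> nat set \<Rightarrow> nat strategy) (q::real).
          randomized_algorithm n k M alg \<longrightarrow>
          achieves_guarantee n k M alg 0.584 \<longrightarrow>
          amortized_query_complexity n M alg q \<longrightarrow>
          q \<ge> c * (real n / real k ^ 3))))"
proof (rule exI[of _ 500000], intro conjI, simp, rule exI[of _ "1 / 10 ^ 12"], intro conjI allI impI, simp)
  fix n k :: nat and M :: "real measure" and alg :: "real \<Rightarrow> nat set \<Rightarrow> nat strategy" and q :: real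
  assume nk: "1 \<le> k \<and> 2 * k \<le> n \<and> 500000 * ln (real n) \<le> real k"
    and alg: "randomized_algorithm n k M alg" "achieves_guarantee n k M alg 0.584"
      "amortized_query_complexity n M alg q"
  \<comment> \<open>Since \<open>n \<ge> 2\<close>, the logarithmic condition alone forces
    \<open>k\<close> to be large enough for both cases.\<close>
  have "ln 2 \<le> ln (real n)" using nk by (subst ln_le_cancel_iff) auto
  then have "500000 * (2 / 3) \<le> real k" using nk ln2_ge_two_thirds by linarith
  then have "200000 \<le> k" by linarith
  then show "1 / 10 ^ 12 * (real n / real k ^ 3) \<le> q"
    using nk alg cost_when_few_elements cost_when_many_elements
    by (cases "real n \<le> 20000000 * real k ^ 2") (meson, force)
qed

end
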